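(* Let $\mathcal V$ be a category with a class $\mathcal C$ of confined morphisms, a class of independent squares, a class $\mathcal S$ of specialized morphisms and a fibered category $\mathcal L$ over $\mathcal V$. For a morphism $f:X\to Y$ of $\mathcal V$ define $\mathbb{OM}^{\mathcal C}_{\mathcal S}(X\xrightarrow{f}Y)$ to be the free abelian group generated by the set of isomorphism classes of cobordism cycles $[V\xrightarrow{h}X;L_1,\dots,L_r]$ over $X$ such that $h\in\mathcal C$ and the composite $f\circ h:V\to Y$ belongs to $\mathcal S$. (1) The assignment $\mathbb{OM}^{\mathcal C}_{\mathcal S}$ becomes an oriented bivariant theory if the four operations are defined as follows (all extended (bi)linearly from generators). Orientation $\Phi$: for $f:X\to Y$ and a fiber-object $L$ over $X$, $\Phi(L):\mathbb{OM}^{\mathcal C}_{\mathcal S}(X\xrightarrow{f}Y)\to\mathbb{OM}^{\mathcal C}_{\mathcal S}(X\xrightarrow{f}Y)$ is $$\Phi(L)([V\xrightarrow{h_V}X;L_1,\dots,L_r])=[V\xrightarrow{h_V}X;L_1,\dots,L_r,(h_V)^*L].$$ Product: for $f:X\to Y$ and $g:Y\to Z$, $\bullet:\mathbb{OM}^{\mathcal C}_{\mathcal S}(X\xrightarrow{f}Y)\otimes\mathbb{OM}^{\mathcal C}_{\mathcal S}(Y\xrightarrow{g}Z)\to\mathbb{OM}^{\mathcal C}_{\mathcal S}(X\xrightarrow{gf}Z)$ is $$[V\xrightarrow{h_V}X;L_1,\dots,L_r]\bullet[W\xrightarrow{k_W}Y;M_1,\dots,M_s]=[V'\xrightarrow{h_V\circ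 k_W''}X;\,k_W''^*L_1,\dots,k_W''^*L_r,(f'\circ h_V')^*M_1,\dots,(f'\circ h_V')^*M_s],$$ where $X'=X\times_Y W$ with projections $f':X'\to W$, $k_W':X'\to X$, and $V'=V\times_X X'$ with projections $h_V':V'\to X'$, $k_W'':V'\to V$. Pushforward: for $f:X\to Y$ confined and $g:Y\to Z$, $f_*:\mathbb{OM}^{\mathcal C}_{\mathcal S}(X\xrightarrow{gf}Z)\to\mathbb{OM}^{\mathcal C}_{\mathcal S}(Y\xrightarrow{g}Z)$ is $$f_*\Big(\sum_V n_V[V\xrightarrow{h_V}X;L_1,\dots,L_r]\Big)=\sum_V n_V[V\xrightarrow{f\circ h_V}Y;L_1,\dots,L_r].$$ Pullback: for an independent square with $f:X\to Y$, $g:Y'\to Y$, $g':X'\to X$, $f':X'\to Y'$, $g^*:\mathbb{OM}^{\mathcal C}_{\mathcal S}(X\xrightarrow{f}Y)\to\mathbb{OM}^{\mathcal C}_{\mathcal S}(X'\xrightarrow{f'}Y')$ is $$g^*\Big(\sum_V n_V[V\xrightarrow{h_V}X;L_1,\dots,L_r]\Big)=\sum_V n_V[V'\xrightarrow{h_V'}X';g''^*L_1,\dots,g''^*L_r],$$ where $V'=V\times_X X'$ with projections $h_V':V'\to X'$ and $g'':V'\to V$. (2) Let $\mathcal{OBT}$ be a class of oriented bivariant theories $\mathbb{OB}$ on the same category $\mathcal V$ with a class $\mathcal C$ of confined morphisms, a class of independent squares, a class $\mathcal S$ of specialized morphisms and a fibered category $\mathcal L$ over $\mathcal V$. Let $\mathcal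 S$ be nice canonically $\mathbb{OB}$-oriented, with orientation $\theta_{\mathbb{OB}}$, for any oriented bivariant theory $\mathbb{OB}\in\mathcal{OBT}$. Then for each $\mathbb{OB}\in\mathcal{OBT}$ with an orientation $\phi$ there exists a unique oriented Grothendieck transformation $$\gamma_{\mathbb{OB}}:\mathbb{OM}^{\mathcal C}_{\mathcal S}\to\mathbb{OB}$$ such that for any $f:X\to Y$ in $\mathcal S$ the homomorphism $\gamma_{\mathbb{OB}}:\mathbb{OM}^{\mathcal C}_{\mathcal S}(X\xrightarrow{f}Y)\to\mathbb{OB}(X\xrightarrow{f}Y)$ satisfies the normalization condition $$\gamma_{\mathbb{OB}}([X\xrightarrow{\mathrm{id}_X}X;L_1,\dots,L_r])=\phi(L_1)\circ\cdots\circ\phi(L_r)(\theta_{\mathbb{OB}}(f)).$$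
   Context: **Category.** $\mathcal V$ has a final object $pt$ and fibre products. The class $\mathcal C$ of confined morphisms is closed under composition and base change and contains all identities. A fibre square is written with $f:X\to Y$ (right vertical), $g:Y'\to Y$ (bottom), $g':X'\to X$ (top), $f':X'\to Y'$ (left); it pulls $f$ back along $g$. A class of fibre squares, called independent, is given such that: (i) the outer square formed from two horizontally or vertically adjacent independent squares is independent; (ii) for every $f:X\to Y$ the square with both verticals $f$ and horizontals $\mathrm{id}_X,\mathrm{id}_Y$, and the square with both horizontals $f$ and verticals $\mathrm{id}_X,\mathrm{id}_Y$, are independent. **Bivariant theory.** A bivariant theory $\mathbb B$ on $\mathcal V$ assigns to each morphism $f:X\to Y$ a (graded; the grading may be ignored) abelian group $\mathbb B(X\xrightarrow{f}Y)$ with products $\bullet:\mathbb B(X\xrightarrow{f}Y)\otimes\mathbb B(Y\xrightarrow{g}Z)\to\mathbb B(X\xrightarrow{gf}Z)$; pushforwards $f_*:\mathbb B(X\xrightarrow{gf}Z)\to\mathbb B(Y\xrightarrow{g}Z)$ for $f$ confined; pullbacks $g^*:\mathbb B(X\xrightarrow{f}Y)\to\mathbb B(X'\xrightarrow{f'}Y')$ for each independent square; subject to: (B-1) $\bullet$ is associative; (B-2) pushforward is functorial; (B-3) pullback is functorial (for horizontally adjacent independent squares); (B-4) $f_*(\alpha\bullet\beta)=f_*\alpha\bullet\beta$ for $X\xrightarrow{f}Y\xrightarrow{g}Z\xrightarrow{h}W$, $f$ confined, $\alpha\in\mathbb B(gf)$, $\beta\in\mathbb B(h)$; (B-5) $h^*(\alpha\bullet\beta)=h'^*\alpha\bullet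 h^*\beta$ for $\alpha\in\mathbb B(X\xrightarrow{f}Y)$, $\beta\in\mathbb B(Y\xrightarrow{g}Z)$ and vertically stacked independent squares pulling $g$ back along $h:Z'\to Z$ and $f$ back along the induced $h':Y'\to Y$; (B-6) $f'_*(h^*\alpha)=h^*(f_*\alpha)$ for such stacked squares with $f$ confined, $\alpha\in\mathbb B(X\xrightarrow{gf}Z)$; (B-7) $g'_*(g^*\alpha\bullet\beta)=\alpha\bullet g_*\beta$ for an independent square with $g$ confined, $\alpha\in\mathbb B(X\xrightarrow{f}Y)$, $\beta\in\mathbb B(Y'\xrightarrow{hg}Z)$, $h:Y\to Z$; and units: $1_X\in\mathbb B(X\xrightarrow{\mathrm{id}}X)$ with $\alpha\bullet1_X=\alpha$, $1_X\bullet\beta=\beta$, $g^*1_X=1_{X'}$ for all $g:X'\to X$. All bivariant theories are assumed commutative: for $f:X\to Z$, $g:Y\to Z$ such that the fibre square of $f,g$ is independent both as a square pulling $f$ back along $g$ and as one pulling $g$ back along $f$, $g^*\alpha\bullet\beta=f^*\beta\bullet\alpha$ for $\alpha\in\mathbb B(f)$, $\beta\in\mathbb B(g)$. A Grothendieck transformation $\gamma:\mathbb B\to\mathbb B'$ is a collection of homomorphisms $\mathbb B(X\to Y)\to\mathbb B'(X\to Y)$ commuting with products, pushforwards and pullbacks. **Specialized maps and orientations.** $\mathcal S$ is a class of morphisms (specialized) closed under composition and base change and containing all identities. $\mathcal S$ is nice canonically $\mathbb B$-oriented if to each $f:X\to Y$ in $\mathcal S$ there is assigned $\theta_{\mathbb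 B}(f)\in\mathbb B(X\xrightarrow{f}Y)$ with $\theta_{\mathbb B}(g\circ f)=\theta_{\mathbb B}(f)\bullet\theta_{\mathbb B}(g)$, $\theta_{\mathbb B}(\mathrm{id}_X)=1_X$, and $\theta_{\mathbb B}(f')=g^*\theta_{\mathbb B}(f)$ for every independent square with $f\in\mathcal S$. **Oriented bivariant theory.** An object $L$ of the fibre $\mathcal L(X)$ over $X$ is called a fiber-object over $X$; for $f:X\to Y$, $f^*$ denotes pullback of fiber-objects. An oriented bivariant theory is a bivariant theory $\mathbb{OB}$ with, for every $f:X\to Y$ and fiber-object $L$ over $X$, an endomorphism $\phi(L)$ of $\mathbb{OB}(X\xrightarrow{f}Y)$ (the orientation) such that: (O-1) $\phi(L)=\phi(L')$ if $L\cong L'$; (O-2) $\phi(L)\circ\phi(L')=\phi(L')\circ\phi(L)$; (O-3) for $\alpha\in\mathbb{OB}(X\xrightarrow{f}Y)$, $\beta\in\mathbb{OB}(Y\xrightarrow{g}Z)$, $L$ over $X$, $M$ over $Y$: $\phi(L)(\alpha\bullet\beta)=\phi(L)(\alpha)\bullet\beta$ and $\phi(f^*M)(\alpha\bullet\beta)=\alpha\bullet\phi(M)(\beta)$; (O-4) for $f:X\to Y$ confined and $M$ over $Y$: $f_*(\phi(f^*M)(\alpha))=\phi(M)(f_*\alpha)$; (O-5) for an independent square and $L$ over $X$: $g^*(\phi(L)(\alpha))=\phi(g'^*L)(g^*\alpha)$. An oriented Grothendieck transformation is a Grothendieck transformation $\gamma$ with $\gamma\circ\phi(L)=\phi'(L)\circ\gamma$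 for all $L$. **Cobordism cycles.** A cobordism cycle over $X$ is a tuple $(V\xrightarrow{h}X;L_1,\dots,L_r)$ with $r\ge0$ and each $L_i$ a fiber-object over $V$. $(V\xrightarrow{h_V}X;L_1,\dots,L_r)$ and $(W\xrightarrow{h_W}X;M_1,\dots,M_{r'})$ are isomorphic if $r=r'$ and there are an isomorphism $g:V\cong W$ over $X$, a bijection $\sigma$ of $\{1,\dots,r\}$ and isomorphisms $L_i\cong g^*M_{\sigma(i)}$ for all $i$. Brackets denote isomorphism classes.
   Formalization: Existence in (2) additionally assumes that the fibre squares used for cycles are independent: h_V pulled back along g' in the pullback, and f∘h_V pulled back along k_W in the product; without this existence can fail. Part (1) and uniqueness need no such assumption. *)

theory Defs
  imports "HOL-Algebra.Free_Abelian_Groups"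
begin

section \<open>Categories and fibre squares\<close>

record ('o, 'm) cat =
  Obj :: "'o set"
  Arr :: "'m set"
  Dom :: "'m \<Rightarrow> 'o"
  Cod :: "'m \<Rightarrow> 'o"
  Ide :: "'o \<Rightarrow> 'm"
  Comp :: "'m \<Rightarrow> 'm \<Rightarrow> 'm" (infixr "\<cdot>\<index>" 75)

definition hom_set :: "('o, 'm) cat \<Rightarrow> 'o \<Rightarrow> 'o \<Rightarrow> 'm set" where
  "hom_set V X Y = {f \<in> Arr V. Dom V f = X \<and> Cod V f = Y}"

locale category =
  fixes V :: "('o, 'm) cat" (structure)
  assumes dom_cod: "f \<in> Arr V \<Longrightarrow> Dom V f \<in> Obj V \<and> Cod V f \<in> Obj V"
    and ide: "X \<in> Obj V \<Longrightarrow> Ide V X \<in> hom_set V X X"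
    and comp: "\<lbrakk>f \<in> hom_set V X Y; g \<in> hom_set V Y Z\<rbrakk> \<Longrightarrow> g \<cdot> f \<in> hom_set V X Z"
    and comp_ide: "f \<in> hom_set V X Y \<Longrightarrow> f \<cdot> Ide V X = f"
    and ide_comp: "f \<in> hom_set V X Y \<Longrightarrow> Ide V Y \<cdot> f = f"
    and comp_assoc: "\<lbrakk>f \<in> hom_set V X Y; g \<in> hom_set V Y Z; h \<in> hom_set V Z W\<rbrakk>
      \<Longrightarrow> (h \<cdot> g) \<cdot> f = h \<cdot> (g \<cdot> f)"

definition is_iso :: "('o, 'm) cat \<Rightarrow> 'm \<Rightarrow> bool" where
  "is_iso V f \<longleftrightarrow> f \<in> Arr V \<and>
     (\<exists>g \<in> hom_set V (Cod V f) (Dom V f).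
        g \<cdot>\<^bsub>V\<^esub> f = Ide V (Dom V f) \<and> f \<cdot>\<^bsub>V\<^esub> g = Ide V (Cod V f))"

text \<open>Squares are always listed as \<open>f g g' f'\<close>: right, bottom, top, left. The square
  pulls the right-hand morphism \<open>f\<close> back along the bottom morphism \<open>g\<close>.\<close>

definition fibre_square :: "('o, 'm) cat \<Rightarrow> 'm \<Rightarrow> 'm \<Rightarrow> 'm \<Rightarrow> 'm \<Rightarrow> bool" where
  "fibre_square V f g g' f' \<longleftrightarrow>
     f \<in> Arr V \<and> g \<in> Arr V \<and> g' \<in> Arr V \<and> f' \<in> Arr V \<and>
     Cod V f = Cod V g \<and> Dom V g' = Dom V f' \<and> Cod V g' = Dom V f \<and> Cod V f' = Dom V g \<and>
     f \<cdot>\<^bsub>V\<^esub> g' = g \<cdot>\<^bsub>V\<^esub> f' \<and>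
     (\<forall>T a b. a \<in> hom_set V T (Dom V f) \<and> b \<in> hom_set V T (Dom V g) \<and> f \<cdot>\<^bsub>V\<^esub> a = g \<cdot>\<^bsub>V\<^esub> b
        \<longrightarrow> (\<exists>!u. u \<in> hom_set V T (Dom V g') \<and> g' \<cdot>\<^bsub>V\<^esub> u = a \<and> f' \<cdot>\<^bsub>V\<^esub> u = b))"

definition has_final :: "('o, 'm) cat \<Rightarrow> bool" where
  "has_final V \<longleftrightarrow> (\<exists>pt \<in> Obj V. \<forall>X \<in> Obj V. \<exists>!f. f \<in> hom_set V X pt)"

definition has_fibre_products :: "('o, 'm) cat \<Rightarrow> bool" where
  "has_fibre_products V \<longleftrightarrow>
     (\<forall>f \<in> Arr V. \<forall>g \<in> Arr V. Cod V f = Cod V g \<longrightarrow> (\<exists>g' f'. fibre_square V f g g' f'))"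

definition stable_class :: "('o, 'm) cat \<Rightarrow> 'm set \<Rightarrow> bool" where
  "stable_class V K \<longleftrightarrow> K \<subseteq> Arr V \<and>
     (\<forall>X \<in> Obj V. Ide V X \<in> K) \<and>
     (\<forall>f \<in> K. \<forall>g \<in> K. Cod V f = Dom V g \<longrightarrow> g \<cdot>\<^bsub>V\<^esub> f \<in> K) \<and>
     (\<forall>f g g' f'. f \<in> K \<and> fibre_square V f g g' f' \<longrightarrow> f' \<in> K)"

definition independence_class ::
    "('o, 'm) cat \<Rightarrow> ('m \<Rightarrow> 'm \<Rightarrow> 'm \<Rightarrow> 'm \<Rightarrow> bool) \<Rightarrow> bool" where
  "independence_class V Ind \<longleftrightarrow>
     (\<forall>f g g' f'. Ind f g g' f' \<longrightarrow> fibre_square V f g g' f') \<and>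
     \<comment> \<open>horizontal composition\<close>
     (\<forall>f g g' f' h h' f''. Ind f g g' f' \<and> Ind f' h h' f''
        \<longrightarrow> Ind f (g \<cdot>\<^bsub>V\<^esub> h) (g' \<cdot>\<^bsub>V\<^esub> h') f'') \<and>
     \<comment> \<open>vertical composition, the upper square being the one that contains \<open>f\<close>\<close>
     (\<forall>f g h h' h'' g' f'. Ind g h h' g' \<and> Ind f h' h'' f'
        \<longrightarrow> Ind (g \<cdot>\<^bsub>V\<^esub> f) h h'' (g' \<cdot>\<^bsub>V\<^esub> f')) \<and>
     (\<forall>X Y. \<forall>f \<in> hom_set V X Y.
        Ind f (Ide V Y) (Ide V X) f \<and> Ind (Ide V Y) f f (Ide V X))"


section \<open>Fibred categories\<close>

text \<open>A fibred category over \<open>V\<close> with a cleavage: \<open>Lift F f L\<close> is the chosen cartesian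
  morphism over \<open>f\<close> with codomain \<open>L\<close>, and its domain is the pullback of \<open>L\<close> along \<open>f\<close>.\<close>

record ('o, 'm, 'l, 'k) fibred =
  Tot :: "('l, 'k) cat"
  PObj :: "'l \<Rightarrow> 'o"
  PArr :: "'k \<Rightarrow> 'm"
  Lift :: "'m \<Rightarrow> 'l \<Rightarrow> 'k"

definition cartesian :: "('o, 'm) cat \<Rightarrow> ('o, 'm, 'l, 'k) fibred \<Rightarrow> 'k \<Rightarrow> bool" where
  "cartesian V F k \<longleftrightarrow> k \<in> Arr (Tot F) \<and>
     (\<forall>J. \<forall>j \<in> hom_set (Tot F) J (Cod (Tot F) k).
        \<forall>w \<in> hom_set V (PObj F J) (PObj F (Dom (Tot F) k)).
          PArr F j = PArr F k \<cdot>\<^bsub>V\<^esub> w \<longrightarrow>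
          (\<exists>!v. v \<in> hom_set (Tot F) J (Dom (Tot F) k) \<and> PArr F v = w \<and> k \<cdot>\<^bsub>Tot F\<^esub> v = j))"

locale fibred_category =
  base: category V + total: category "Tot F"
  for V :: "('o, 'm) cat" and F :: "('o, 'm, 'l, 'k) fibred" +
  assumes proj_obj: "L \<in> Obj (Tot F) \<Longrightarrow> PObj F L \<in> Obj V"
    and proj_arr: "k \<in> hom_set (Tot F) K L \<Longrightarrow> PArr F k \<in> hom_set V (PObj F K) (PObj F L)"
    and proj_ide: "L \<in> Obj (Tot F) \<Longrightarrow> PArr F (Ide (Tot F) L) = Ide V (PObj F L)"
    and proj_comp: "\<lbrakk>j \<in> hom_set (Tot F) J K; k \<in> hom_set (Tot F) K L\<rbrakk>
      \<Longrightarrow> PArr F (k \<cdot>\<^bsub>Tot F\<^esub> j) = PArr F k \<cdot>\<^bsub>V\<^esub> PArr F j"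
    and lift: "\<lbrakk>f \<in> Arr V; L \<in> Obj (Tot F); PObj F L = Cod V f\<rbrakk>
      \<Longrightarrow> cartesian V F (Lift F f L) \<and> Cod (Tot F) (Lift F f L) = L \<and> PArr F (Lift F f L) = f"

definition fibre_objs :: "('o, 'm, 'l, 'k) fibred \<Rightarrow> 'o \<Rightarrow> 'l set" where
  "fibre_objs F X = {L \<in> Obj (Tot F). PObj F L = X}"

definition pb :: "('o, 'm, 'l, 'k) fibred \<Rightarrow> 'm \<Rightarrow> 'l \<Rightarrow> 'l" where
  "pb F f L = Dom (Tot F) (Lift F f L)"

definition fibre_iso ::
    "('o, 'm) cat \<Rightarrow> ('o, 'm, 'l, 'k) fibred \<Rightarrow> 'o \<Rightarrow> 'l \<Rightarrow> 'l \<Rightarrow> bool" where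
  "fibre_iso V F X L L' \<longleftrightarrow> L \<in> fibre_objs F X \<and> L' \<in> fibre_objs F X \<and>
     (\<exists>k \<in> hom_set (Tot F) L L'. is_iso (Tot F) k \<and> PArr F k = Ide V X)"


section \<open>Bivariant theories\<close>

locale bivariant_setting =
  fibred_category V F
  for V :: "('o, 'm) cat" and F :: "('o, 'm, 'l, 'k) fibred" +
  fixes C :: "'m set" and Ind :: "'m \<Rightarrow> 'm \<Rightarrow> 'm \<Rightarrow> 'm \<Rightarrow> bool" and S :: "'m set"
  assumes final: "has_final V"
    and fibre_products: "has_fibre_products V"
    and confined: "stable_class V C"
    and independent: "independence_class V Ind"
    and specialized: "stable_class V S"

text \<open>The abelian groups are written multiplicatively, as in \<open>HOL-Algebra\<close>. For composable
  \<open>f\<close>, \<open>g\<close> (first \<open>f\<close>, then \<open>g\<close>), \<open>Bprod B f g\<close> is the product of \<open>\<B>(f)\<close> and \<open>\<B>(g)\<close> with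
  values in \<open>\<B>(g \<circ> f)\<close>, and \<open>Push B f g\<close> is the pushforward along \<open>f\<close> from \<open>\<B>(g \<circ> f)\<close> to \<open>\<B>(g)\<close>.
  \<open>Pull B f g g' f'\<close> is the pullback \<open>\<B>(f) \<rightarrow> \<B>(f')\<close> along \<open>g\<close> for the square \<open>f g g' f'\<close>.\<close>

record ('o, 'm, 'b) bivariant =
  Grp :: "'m \<Rightarrow> 'b monoid"
  Bprod :: "'m \<Rightarrow> 'm \<Rightarrow> 'b \<Rightarrow> 'b \<Rightarrow> 'b"
  Push :: "'m \<Rightarrow> 'm \<Rightarrow> 'b \<Rightarrow> 'b"
  Pull :: "'m \<Rightarrow> 'm \<Rightarrow> 'm \<Rightarrow> 'm \<Rightarrow> 'b \<Rightarrow> 'b"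
  Bone :: "'o \<Rightarrow> 'b"

locale bivariant_theory =
  fixes V :: "('o, 'm) cat" (structure)
    and C :: "'m set"
    and Ind :: "'m \<Rightarrow> 'm \<Rightarrow> 'm \<Rightarrow> 'm \<Rightarrow> bool"
    and B :: "('o, 'm, 'b, 'z) bivariant_scheme"
  assumes grp: "f \<in> Arr V \<Longrightarrow> comm_group (Grp B f)"
    and prod_hom_right: "\<lbrakk>f \<in> hom_set V X Y; g \<in> hom_set V Y Z; \<alpha> \<in> carrier (Grp B f)\<rbrakk>
      \<Longrightarrow> (\<lambda>\<beta>. Bprod B f g \<alpha> \<beta>) \<in> hom (Grp B g) (Grp B (g \<cdot> f))"
    and prod_hom_left: "\<lbrakk>f \<in> hom_set V X Y; g \<in> hom_set V Y Z; \<beta> \<in> carrier (Grp B g)\<rbrakk>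
      \<Longrightarrow> (\<lambda>\<alpha>. Bprod B f g \<alpha> \<beta>) \<in> hom (Grp B f) (Grp B (g \<cdot> f))"
    and push_hom: "\<lbrakk>f \<in> hom_set V X Y; g \<in> hom_set V Y Z; f \<in> C\<rbrakk>
      \<Longrightarrow> Push B f g \<in> hom (Grp B (g \<cdot> f)) (Grp B g)"
    and pull_hom: "Ind f g g' f' \<Longrightarrow> Pull B f g g' f' \<in> hom (Grp B f) (Grp B f')"
    and one_closed: "X \<in> Obj V \<Longrightarrow> Bone B X \<in> carrier (Grp B (Ide V X))"
    and B1: "\<lbrakk>f \<in> hom_set V X Y; g \<in> hom_set V Y Z; h \<in> hom_set V Z W;
        \<alpha> \<in> carrier (Grp B f); \<beta> \<in> carrier (Grp B g); \<delta> \<in> carrier (Grp B h)\<rbrakk>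
      \<Longrightarrow> Bprod B (g \<cdot> f) h (Bprod B f g \<alpha> \<beta>) \<delta> = Bprod B f (h \<cdot> g) \<alpha> (Bprod B g h \<beta> \<delta>)"
    and B2_ide: "\<lbrakk>f \<in> hom_set V X Y; \<alpha> \<in> carrier (Grp B f)\<rbrakk> \<Longrightarrow> Push B (Ide V X) f \<alpha> = \<alpha>"
    and B2_comp: "\<lbrakk>f \<in> hom_set V X Y; g \<in> hom_set V Y Z; h \<in> hom_set V Z W; f \<in> C; g \<in> C;
        \<alpha> \<in> carrier (Grp B (h \<cdot> (g \<cdot> f)))\<rbrakk>
      \<Longrightarrow> Push B (g \<cdot> f) h \<alpha> = Push B g h (Push B f (h \<cdot> g) \<alpha>)"
    and B3_ide: "\<lbrakk>f \<in> hom_set V X Y; \<alpha> \<in> carrier (Grp B f)\<rbrakk>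
      \<Longrightarrow> Pull B f (Ide V Y) (Ide V X) f \<alpha> = \<alpha>"
    and B3_comp: "\<lbrakk>Ind f g g' f'; Ind f' h h' f''; \<alpha> \<in> carrier (Grp B f)\<rbrakk>
      \<Longrightarrow> Pull B f (g \<cdot> h) (g' \<cdot> h') f'' \<alpha> = Pull B f' h h' f'' (Pull B f g g' f' \<alpha>)"
    and B4: "\<lbrakk>f \<in> hom_set V X Y; g \<in> hom_set V Y Z; h \<in> hom_set V Z W; f \<in> C;
        \<alpha> \<in> carrier (Grp B (g \<cdot> f)); \<beta> \<in> carrier (Grp B h)\<rbrakk>
      \<Longrightarrow> Push B f (h \<cdot> g) (Bprod B (g \<cdot> f) h \<alpha> \<beta>) = Bprod B g h (Push B f g \<alpha>) \<beta>"
    and B5: "\<lbrakk>Ind g h h' g'; Ind f h' h'' f'; \<alpha> \<in> carrier (Grp B f); \<beta> \<in> carrier (Grp B g)\<rbrakk>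
      \<Longrightarrow> Pull B (g \<cdot> f) h h'' (g' \<cdot> f') (Bprod B f g \<alpha> \<beta>)
        = Bprod B f' g' (Pull B f h' h'' f' \<alpha>) (Pull B g h h' g' \<beta>)"
    and B6: "\<lbrakk>Ind g h h' g'; Ind f h' h'' f'; f \<in> C; \<alpha> \<in> carrier (Grp B (g \<cdot> f))\<rbrakk>
      \<Longrightarrow> Push B f' g' (Pull B (g \<cdot> f) h h'' (g' \<cdot> f') \<alpha>) = Pull B g h h' g' (Push B f g \<alpha>)"
    and B7: "\<lbrakk>Ind f g g' f'; g \<in> C; h \<in> hom_set V (Cod V g) Z;
        \<alpha> \<in> carrier (Grp B f); \<beta> \<in> carrier (Grp B (h \<cdot> g))\<rbrakk>
      \<Longrightarrow> Push B g' (h \<cdot> f) (Bprod B f' (h \<cdot> g) (Pull B f g g' f' \<alpha>) \<beta>)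
        = Bprod B f h \<alpha> (Push B g h \<beta>)"
    and one_right: "\<lbrakk>f \<in> hom_set V X Y; \<alpha> \<in> carrier (Grp B f)\<rbrakk>
      \<Longrightarrow> Bprod B f (Ide V Y) \<alpha> (Bone B Y) = \<alpha>"
    and one_left: "\<lbrakk>f \<in> hom_set V X Y; \<beta> \<in> carrier (Grp B f)\<rbrakk>
      \<Longrightarrow> Bprod B (Ide V X) f (Bone B X) \<beta> = \<beta>"
    and one_pull: "g \<in> hom_set V X' X
      \<Longrightarrow> Pull B (Ide V X) g g (Ide V X') (Bone B X) = Bone B X'"
    and commutative: "\<lbrakk>Ind f g g' f'; Ind g f f' g';
        \<alpha> \<in> carrier (Grp B f); \<beta> \<in> carrier (Grp B g)\<rbrakk>
      \<Longrightarrow> Bprod B f' g (Pull B f g g' f' \<alpha>) \<beta> = Bprod B g' f (Pull B g f f' g' \<beta>) \<alpha>"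

record ('o, 'm, 'b, 'l) oriented_bivariant = "('o, 'm, 'b) bivariant" +
  Ori :: "'m \<Rightarrow> 'l \<Rightarrow> 'b \<Rightarrow> 'b"

locale oriented_bivariant_theory =
  bivariant_theory V C Ind B
  for V :: "('o, 'm) cat" (structure)
    and F :: "('o, 'm, 'l, 'k) fibred"
    and C :: "'m set"
    and Ind :: "'m \<Rightarrow> 'm \<Rightarrow> 'm \<Rightarrow> 'm \<Rightarrow> bool"
    and B :: "('o, 'm, 'b, 'l) oriented_bivariant" +
  assumes ori_hom: "\<lbrakk>f \<in> hom_set V X Y; L \<in> fibre_objs F X\<rbrakk>
      \<Longrightarrow> Ori B f L \<in> hom (Grp B f) (Grp B f)"
    and O1: "\<lbrakk>f \<in> hom_set V X Y; fibre_iso V F X L L'; \<alpha> \<in> carrier (Grp B f)\<rbrakk>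
      \<Longrightarrow> Ori B f L \<alpha> = Ori B f L' \<alpha>"
    and O2: "\<lbrakk>f \<in> hom_set V X Y; L \<in> fibre_objs F X; L' \<in> fibre_objs F X;
        \<alpha> \<in> carrier (Grp B f)\<rbrakk>
      \<Longrightarrow> Ori B f L (Ori B f L' \<alpha>) = Ori B f L' (Ori B f L \<alpha>)"
    and O3_left: "\<lbrakk>f \<in> hom_set V X Y; g \<in> hom_set V Y Z; L \<in> fibre_objs F X;
        \<alpha> \<in> carrier (Grp B f); \<beta> \<in> carrier (Grp B g)\<rbrakk>
      \<Longrightarrow> Ori B (g \<cdot> f) L (Bprod B f g \<alpha> \<beta>) = Bprod B f g (Ori B f L \<alpha>) \<beta>"
    and O3_right: "\<lbrakk>f \<in> hom_set V X Y; g \<in> hom_set V Y Z; M \<in> fibre_objs F Y;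
        \<alpha> \<in> carrier (Grp B f); \<beta> \<in> carrier (Grp B g)\<rbrakk>
      \<Longrightarrow> Ori B (g \<cdot> f) (pb F f M) (Bprod B f g \<alpha> \<beta>) = Bprod B f g \<alpha> (Ori B g M \<beta>)"
    and O4: "\<lbrakk>f \<in> hom_set V X Y; g \<in> hom_set V Y Z; f \<in> C; M \<in> fibre_objs F Y;
        \<alpha> \<in> carrier (Grp B (g \<cdot> f))\<rbrakk>
      \<Longrightarrow> Push B f g (Ori B (g \<cdot> f) (pb F f M) \<alpha>) = Ori B g M (Push B f g \<alpha>)"
    and O5: "\<lbrakk>Ind f g g' f'; L \<in> fibre_objs F (Dom V f); \<alpha> \<in> carrier (Grp B f)\<rbrakk>
      \<Longrightarrow> Pull B f g g' f' (Ori B f L \<alpha>) = Ori B f' (pb F g' L) (Pull B f g g' f' \<alpha>)"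

definition grothendieck_transformation ::
    "('o, 'm) cat \<Rightarrow> 'm set \<Rightarrow> ('m \<Rightarrow> 'm \<Rightarrow> 'm \<Rightarrow> 'm \<Rightarrow> bool) \<Rightarrow>
     ('o, 'm, 'a, 'y) bivariant_scheme \<Rightarrow> ('o, 'm, 'b, 'z) bivariant_scheme \<Rightarrow>
     ('m \<Rightarrow> 'a \<Rightarrow> 'b) \<Rightarrow> bool" where
  "grothendieck_transformation V C Ind B B' \<gamma> \<longleftrightarrow>
     (\<forall>f \<in> Arr V. \<gamma> f \<in> hom (Grp B f) (Grp B' f)) \<and>
     (\<forall>X Y Z. \<forall>f \<in> hom_set V X Y. \<forall>g \<in> hom_set V Y Z.
        \<forall>\<alpha> \<in> carrier (Grp B f). \<forall>\<beta> \<in> carrier (Grp B g).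
          \<gamma> (g \<cdot>\<^bsub>V\<^esub> f) (Bprod B f g \<alpha> \<beta>) = Bprod B' f g (\<gamma> f \<alpha>) (\<gamma> g \<beta>)) \<and>
     (\<forall>X Y Z. \<forall>f \<in> hom_set V X Y. \<forall>g \<in> hom_set V Y Z. f \<in> C \<longrightarrow>
        (\<forall>\<alpha> \<in> carrier (Grp B (g \<cdot>\<^bsub>V\<^esub> f)).
          \<gamma> g (Push B f g \<alpha>) = Push B' f g (\<gamma> (g \<cdot>\<^bsub>V\<^esub> f) \<alpha>))) \<and>
     (\<forall>f g g' f'. Ind f g g' f' \<longrightarrow>
        (\<forall>\<alpha> \<in> carrier (Grp B f). \<gamma> f' (Pull B f g g' f' \<alpha>) = Pull B' f g g' f' (\<gamma> f \<alpha>)))"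

definition oriented_grothendieck_transformation ::
    "('o, 'm) cat \<Rightarrow> ('o, 'm, 'l, 'k) fibred \<Rightarrow> 'm set \<Rightarrow> ('m \<Rightarrow> 'm \<Rightarrow> 'm \<Rightarrow> 'm \<Rightarrow> bool) \<Rightarrow>
     ('o, 'm, 'a, 'l) oriented_bivariant \<Rightarrow> ('o, 'm, 'b, 'l) oriented_bivariant \<Rightarrow>
     ('m \<Rightarrow> 'a \<Rightarrow> 'b) \<Rightarrow> bool" where
  "oriented_grothendieck_transformation V F C Ind B B' \<gamma> \<longleftrightarrow>
     grothendieck_transformation V C Ind B B' \<gamma> \<and>
     (\<forall>X Y. \<forall>f \<in> hom_set V X Y. \<forall>L \<in> fibre_objs F X. \<forall>\<alpha> \<in> carrier (Grp B f).
        \<gamma> f (Ori B f L \<alpha>) = Ori B' f L (\<gamma> f \<alpha>))"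

definition nice_canonical_orientation ::
    "('o, 'm) cat \<Rightarrow> ('m \<Rightarrow> 'm \<Rightarrow> 'm \<Rightarrow> 'm \<Rightarrow> bool) \<Rightarrow> 'm set \<Rightarrow>
     ('o, 'm, 'b, 'z) bivariant_scheme \<Rightarrow> ('m \<Rightarrow> 'b) \<Rightarrow> bool" where
  "nice_canonical_orientation V Ind S B \<theta> \<longleftrightarrow>
     (\<forall>f \<in> S. \<theta> f \<in> carrier (Grp B f)) \<and>
     (\<forall>f \<in> S. \<forall>g \<in> S. Cod V f = Dom V g \<longrightarrow> \<theta> (g \<cdot>\<^bsub>V\<^esub> f) = Bprod B f g (\<theta> f) (\<theta> g)) \<and>
     (\<forall>X \<in> Obj V. \<theta> (Ide V X) = Bone B X) \<and>
     (\<forall>f g g' f'. f \<in> S \<and> Ind f g g' f' \<longrightarrow> \<theta> f' = Pull B f g g' f' (\<theta> f))"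


section \<open>Cobordism cycles\<close>

text \<open>The cycle \<open>(V \<rightarrow> X; L\<^sub>1, \<dots>, L\<^sub>r)\<close> is the pair of its structure morphism (whose domain
  is the source object) and the list of its fiber-objects.\<close>

type_synonym ('m, 'l) cycle = "'m \<times> 'l list"

fun is_cycle :: "('o, 'm) cat \<Rightarrow> ('o, 'm, 'l, 'k) fibred \<Rightarrow> 'o \<Rightarrow> ('m, 'l) cycle \<Rightarrow> bool" where
  "is_cycle V F X (h, Ls) \<longleftrightarrow> h \<in> Arr V \<and> Cod V h = X \<and> set Ls \<subseteq> fibre_objs F (Dom V h)"

fun cycle_iso ::
    "('o, 'm) cat \<Rightarrow> ('o, 'm, 'l, 'k) fibred \<Rightarrow> ('m, 'l) cycle \<Rightarrow> ('m, 'l) cycle \<Rightarrow> bool" where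
  "cycle_iso V F (h, Ls) (k, Ms) \<longleftrightarrow> length Ls = length Ms \<and>
     (\<exists>g \<in> hom_set V (Dom V h) (Dom V k). is_iso V g \<and> k \<cdot>\<^bsub>V\<^esub> g = h \<and>
        (\<exists>\<sigma>. bij_betw \<sigma> {..<length Ls} {..<length Ls} \<and>
           (\<forall>i < length Ls. fibre_iso V F (Dom V h) (Ls ! i) (pb F g (Ms ! \<sigma> i)))))"

definition cycle_class ::
    "('o, 'm) cat \<Rightarrow> ('o, 'm, 'l, 'k) fibred \<Rightarrow> 'o \<Rightarrow> ('m, 'l) cycle \<Rightarrow> ('m, 'l) cycle set" where
  "cycle_class V F X c = {d. is_cycle V F X d \<and> cycle_iso V F c d}"

definition OM_gens ::
    "('o, 'm) cat \<Rightarrow> ('o, 'm, 'l, 'k) fibred \<Rightarrow> 'm set \<Rightarrow> 'm set \<Rightarrow> 'm \<Rightarrow> ('m, 'l) cycle set set" where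
  "OM_gens V F C S f =
     {cycle_class V F (Dom V f) (h, Ls) | h Ls.
        is_cycle V F (Dom V f) (h, Ls) \<and> h \<in> C \<and> f \<cdot>\<^bsub>V\<^esub> h \<in> S}"

text \<open>On isomorphism classes \<open>A\<close>, \<open>A'\<close> the operations are the unions, over all representatives and
  all choices of fibre products, of the class of the resulting cycle. Such a union can only
  be an isomorphism class again if all these choices give one and the same class, so that the
  closure conditions in \<^const>\<open>oriented_bivariant_theory\<close> include that the operations are well
  defined.\<close>

definition gen_ori ::
    "('o, 'm) cat \<Rightarrow> ('o, 'm, 'l, 'k) fibred \<Rightarrow> 'm \<Rightarrow> 'l \<Rightarrow>
     ('m, 'l) cycle set \<Rightarrow> ('m, 'l) cycle set" where
  "gen_ori V F f L A =
     \<Union> {cycle_class V F (Dom V f) (h, Ls @ [pb F h L]) | h Ls. (h, Ls) \<in> A}"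

definition gen_prod ::
    "('o, 'm) cat \<Rightarrow> ('o, 'm, 'l, 'k) fibred \<Rightarrow> 'm \<Rightarrow>
     ('m, 'l) cycle set \<Rightarrow> ('m, 'l) cycle set \<Rightarrow> ('m, 'l) cycle set" where
  "gen_prod V F f A A' =
     \<Union> {cycle_class V F (Dom V f)
           (h \<cdot>\<^bsub>V\<^esub> k'', map (pb F k'') Ls @ map (pb F (f' \<cdot>\<^bsub>V\<^esub> h')) Ms) | h Ls k Ms k' f' k'' h'.
         (h, Ls) \<in> A \<and> (k, Ms) \<in> A' \<and>
         fibre_square V f k k' f' \<and> fibre_square V h k' k'' h'}"

definition gen_push ::
    "('o, 'm) cat \<Rightarrow> ('o, 'm, 'l, 'k) fibred \<Rightarrow> 'm \<Rightarrow>
     ('m, 'l) cycle set \<Rightarrow> ('m, 'l) cycle set" where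
  "gen_push V F f A = \<Union> {cycle_class V F (Cod V f) (f \<cdot>\<^bsub>V\<^esub> h, Ls) | h Ls. (h, Ls) \<in> A}"

definition gen_pull ::
    "('o, 'm) cat \<Rightarrow> ('o, 'm, 'l, 'k) fibred \<Rightarrow> 'm \<Rightarrow>
     ('m, 'l) cycle set \<Rightarrow> ('m, 'l) cycle set" where
  "gen_pull V F g' A =
     \<Union> {cycle_class V F (Dom V g') (h', map (pb F g'') Ls) | h Ls g'' h'.
         (h, Ls) \<in> A \<and> fibre_square V h g' g'' h'}"

definition OM ::
    "('o, 'm) cat \<Rightarrow> ('o, 'm, 'l, 'k) fibred \<Rightarrow> 'm set \<Rightarrow> 'm set \<Rightarrow>
     ('o, 'm, ('m, 'l) cycle set \<Rightarrow>\<^sub>0 int, 'l) oriented_bivariant" where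
  "OM V F C S =
    \<lparr>Grp = (\<lambda>f. free_Abelian_group (OM_gens V F C S f)),
     Bprod = (\<lambda>f g \<alpha> \<beta>.
       frag_extend (\<lambda>A. frag_extend (\<lambda>A'. frag_of (gen_prod V F f A A')) \<beta>) \<alpha>),
     Push = (\<lambda>f g. frag_extend (\<lambda>A. frag_of (gen_push V F f A))),
     Pull = (\<lambda>f g g' f'. frag_extend (\<lambda>A. frag_of (gen_pull V F g' A))),
     Bone = (\<lambda>X. frag_of (cycle_class V F X (Ide V X, []))),
     Ori = (\<lambda>f L. frag_extend (\<lambda>A. frag_of (gen_ori V F f L A)))\<rparr>"

definition normalized ::
    "('o, 'm) cat \<Rightarrow> ('o, 'm, 'l, 'k) fibred \<Rightarrow> 'm set \<Rightarrow> ('o, 'm, 'b, 'l) oriented_bivariant \<Rightarrow>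
     ('m \<Rightarrow> 'b) \<Rightarrow> ('m \<Rightarrow> (('m, 'l) cycle set \<Rightarrow>\<^sub>0 int) \<Rightarrow> 'b) \<Rightarrow> bool" where
  "normalized V F S B \<theta> \<gamma> \<longleftrightarrow>
     (\<forall>X Y. \<forall>f \<in> hom_set V X Y \<inter> S. \<forall>Ls. set Ls \<subseteq> fibre_objs F X \<longrightarrow>
        \<gamma> f (frag_of (cycle_class V F X (Ide V X, Ls))) = foldr (Ori B f) Ls (\<theta> f))"

text \<open>Independence of the squares occurring in the formulas for pullback and product on cycles:
  the upper square \<open>h g' g'' h'\<close> in the pullback of \<open>(h; \<dots>)\<close>, and the outer square
  with right side \<open>f \<circ> h\<close> and bottom \<open>k\<close> in the product of \<open>(h; \<dots>)\<close> and \<open>(k; \<dots>)\<close>.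
  If not all of them are independent, a theory need not relate its
  operations along these squares, and the transformation into it need not exist.\<close>

definition cycle_squares_independent ::
    "('o, 'm) cat \<Rightarrow> 'm set \<Rightarrow> ('m \<Rightarrow> 'm \<Rightarrow> 'm \<Rightarrow> 'm \<Rightarrow> bool) \<Rightarrow> 'm set \<Rightarrow> bool" where
  "cycle_squares_independent V C Ind S \<longleftrightarrow>
     (\<forall>f g g' f' h g'' h'.
        Ind f g g' f' \<and> h \<in> C \<and> Cod V h = Dom V f \<and> f \<cdot>\<^bsub>V\<^esub> h \<in> S \<and>
        fibre_square V h g' g'' h' \<longrightarrow> Ind h g' g'' h') \<and>
     (\<forall>f g h k k'' p.
        f \<in> Arr V \<and> g \<in> Arr V \<and> Cod V f = Dom V g \<and>
        h \<in> C \<and> Cod V h = Dom V f \<and> f \<cdot>\<^bsub>V\<^esub> h \<in> S \<and>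
        k \<in> C \<and> Cod V k = Dom V g \<and> g \<cdot>\<^bsub>V\<^esub> k \<in> S \<and>
        fibre_square V (f \<cdot>\<^bsub>V\<^esub> h) k k'' p \<longrightarrow> Ind (f \<cdot>\<^bsub>V\<^esub> h) k k'' p)"

end

theory Submission
  imports Defs "HOL-Combinatorics.List_Permutation"
begin

text \<open>
  Everything rests on the calculus of fibre squares: pasting, cancelling and transposing them, and
  their uniqueness up to isomorphism. A cycle is determined up to isomorphism by its structure
  morphism and the multiset of isomorphism classes of its fibre-objects (\<open>fibre_classes\<close>), and
  pullback of fibre-objects is functorial on isomorphism classes because cartesian lifts are
  unique. Hence the product and the pullback of classes can be computed from any
  representatives and any fibre squares. Moreover, by pasting, the product of \<open>(h; L\<^sub>i)\<close> and
  \<open>(k; M\<^sub>j)\<close> over \<open>f\<close> and \<open>g\<close> needs only one fibre product, that of \<open>f \<circ> h\<close> and \<open>k\<close>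
  (\<open>gen_prod_class\<close>). Each bivariant axiom then says that two
  ways of forming an iterated fibre product agree. It is proved by choosing
  the squares so that both sides are read off from one diagram, and it extends from generators to
  the free abelian groups by linearity.

  For a theory \<open>\<B>\<close> with orientation \<open>\<phi>\<close> and orientation classes \<open>\<theta>\<close>, a cycle over \<open>f\<close> satisfies
  \<open>[h; L\<^sub>1, \<dots>, L\<^sub>r] = h\<^sub>* [id; L\<^sub>1, \<dots>, L\<^sub>r]\<close>, where the cycle on the right lies over \<open>f \<circ> h\<close>. A
  normalized transformation must therefore send it to \<open>h\<^sub>* (\<phi>(L\<^sub>1) \<dots> \<phi>(L\<^sub>r) \<theta>(f \<circ> h))\<close>
  (\<open>cycle_value\<close>). This gives uniqueness, and it is the definition used for existence.

  For existence, the value must depend only on the isomorphism class of the cycle. This reduces to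
  \<open>a\<^sub>* \<theta>(s \<circ> a) = \<theta>(s)\<close> for an isomorphism \<open>a\<close> (\<open>push_iso_theta\<close>), which follows from base change
  along a square with sides \<open>a\<close> and an identity. Compatibility with the product combines
  the projection formula with stability and multiplicativity of \<open>\<theta>\<close>; compatibility with
  pullback is base change together with stability of \<open>\<theta>\<close>. In both cases the independence of the
  squares formed from cycles is what makes the operations of \<open>\<B>\<close> available along them.
\<close>

section \<open>Fibre squares\<close>

context category
begin

lemma comp_simps [simp]:
  assumes "f \<in> Arr V" "g \<in> Arr V" "Cod V f = Dom V g"
  shows "g \<cdot> f \<in> Arr V" "Dom V (g \<cdot> f) = Dom V f" "Cod V (g \<cdot> f) = Cod V g"
  using comp[of f "Dom V f" "Cod V f" g "Cod V g"] assms by (auto simp: hom_set_def)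

lemma assoc [simp]:
  assumes "f \<in> Arr V" "g \<in> Arr V" "h \<in> Arr V" "Cod V f = Dom V g" "Cod V g = Dom V h"
  shows "(h \<cdot> g) \<cdot> f = h \<cdot> (g \<cdot> f)"
  using comp_assoc[of f "Dom V f" "Cod V f" g "Cod V g" h "Cod V h"] assms
  by (auto simp: hom_set_def)

lemma ide_simps [simp]:
  assumes "X \<in> Obj V"
  shows "Ide V X \<in> Arr V" "Dom V (Ide V X) = X" "Cod V (Ide V X) = X"
  using ide[OF assms] by (auto simp: hom_set_def)

lemma ide_comp_simps [simp]:
  assumes "f \<in> Arr V"
  shows "Dom V f = X \<Longrightarrow> f \<cdot> Ide V X = f" "Cod V f = Y \<Longrightarrow> Ide V Y \<cdot> f = f"
  using comp_ide[of f "Dom V f" "Cod V f"] ide_comp[of f "Dom V f" "Cod V f"] assms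
  by (auto simp: hom_set_def)

lemma Dom_Cod_Obj [simp]:
  assumes "f \<in> Arr V"
  shows "Dom V f \<in> Obj V" "Cod V f \<in> Obj V"
  using dom_cod assms by auto

lemma is_isoE:
  assumes "is_iso V a"
  obtains b where "is_iso V b" "a \<in> Arr V" "b \<in> Arr V" "Dom V b = Cod V a" "Cod V b = Dom V a"
    "b \<cdot> a = Ide V (Dom V a)" "a \<cdot> b = Ide V (Cod V a)"
  using assms by (fastforce simp: is_iso_def hom_set_def)

lemma is_isoI:
  assumes "a \<in> Arr V" "b \<in> Arr V" "Dom V b = Cod V a" "Cod V b = Dom V a"
    "b \<cdot> a = Ide V (Dom V a)" "a \<cdot> b = Ide V (Cod V a)"
  shows "is_iso V a"
  using assms by (auto simp: is_iso_def hom_set_def)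

lemma is_iso_ide [simp]: "X \<in> Obj V \<Longrightarrow> is_iso V (Ide V X)"
  by (rule is_isoI[of _ "Ide V X"]) auto

lemma is_iso_comp:
  assumes "is_iso V a" "is_iso V b" "Cod V a = Dom V b"
  shows "is_iso V (b \<cdot> a)"
proof -
  from assms(1) obtain a' where a: "a \<in> Arr V" "a' \<in> Arr V" "Dom V a' = Cod V a"
    "Cod V a' = Dom V a" "a' \<cdot> a = Ide V (Dom V a)" "a \<cdot> a' = Ide V (Cod V a)"
    by (rule is_isoE)
  from assms(2) obtain b' where b: "b \<in> Arr V" "b' \<in> Arr V" "Dom V b' = Cod V b"
    "Cod V b' = Dom V b" "b' \<cdot> b = Ide V (Dom V b)" "b \<cdot> b' = Ide V (Cod V b)"
    by (rule is_isoE)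
  have 1: "b' \<cdot> (b \<cdot> a) = a" and 2: "a \<cdot> (a' \<cdot> b') = b'"
    using a b assms(3) assoc[of a b b'] assoc[of b' a' a] by auto
  show ?thesis
    using a b assms(3) 1 2 by (intro is_isoI[of _ "a' \<cdot> b'"]) auto
qed

lemma fibre_squareD:
  assumes "fibre_square V f g g' f'"
  shows "f \<in> Arr V" "g \<in> Arr V" "g' \<in> Arr V" "f' \<in> Arr V"
    "Cod V g = Cod V f" "Dom V f' = Dom V g'" "Cod V g' = Dom V f" "Cod V f' = Dom V g"
    "f \<cdot> g' = g \<cdot> f'"
  using assms by (auto simp: fibre_square_def)

lemma fibre_square_comp:
  assumes "fibre_square V f g g' f'" "u \<in> Arr V" "Cod V u = Dom V g'"
  shows "f \<cdot> (g' \<cdot> u) = g \<cdot> (f' \<cdot> u)"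
  using fibre_squareD[OF assms(1)] assms(2,3) assoc[of u g' f] assoc[of u f' g] by simp

lemma fibre_square_lift:
  assumes "fibre_square V f g g' f'" "a \<in> hom_set V T (Dom V f)" "b \<in> hom_set V T (Dom V g)"
    "f \<cdot> a = g \<cdot> b"
  shows "\<exists>!u. u \<in> hom_set V T (Dom V g') \<and> g' \<cdot> u = a \<and> f' \<cdot> u = b"
  using assms unfolding fibre_square_def by blast

lemma fibre_square_factor:
  assumes "fibre_square V f g g' f'" "a \<in> Arr V" "b \<in> Arr V" "Dom V b = Dom V a"
    "Cod V a = Dom V f" "Cod V b = Dom V g" "f \<cdot> a = g \<cdot> b"
  obtains u where "u \<in> Arr V" "Dom V u = Dom V a" "Cod V u = Dom V g'" "g' \<cdot> u = a" "f' \<cdot> u = b"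
proof -
  have "\<exists>!u. u \<in> hom_set V (Dom V a) (Dom V g') \<and> g' \<cdot> u = a \<and> f' \<cdot> u = b"
    by (rule fibre_square_lift[OF assms(1)]) (use assms in \<open>simp_all add: hom_set_def\<close>)
  then obtain u where "u \<in> hom_set V (Dom V a) (Dom V g')" "g' \<cdot> u = a" "f' \<cdot> u = b"
    by blast
  then show thesis by (intro that) (simp_all add: hom_set_def)
qed

lemma fibre_square_unique:
  assumes S: "fibre_square V f g g' f'" and "u \<in> Arr V" "v \<in> Arr V" "Dom V v = Dom V u"
    "Cod V u = Dom V g'" "Cod V v = Dom V g'" "g' \<cdot> u = g' \<cdot> v" "f' \<cdot> u = f' \<cdot> v"
  shows "u = v"
proof -
  have D: "f \<cdot> (g' \<cdot> u) = g \<cdot> (f' \<cdot> u)" "g' \<in> Arr V" "f' \<in> Arr V" "Dom V f' = Dom V g'"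
    "Cod V g' = Dom V f" "Cod V f' = Dom V g"
    using fibre_square_comp[OF S] fibre_squareD[OF S] assms(2,5) by blast+
  have "\<exists>!w. w \<in> hom_set V (Dom V u) (Dom V g') \<and> g' \<cdot> w = g' \<cdot> u \<and> f' \<cdot> w = f' \<cdot> u"
    by (rule fibre_square_lift[OF S]) (use assms(2-6) D in \<open>simp_all add: hom_set_def\<close>)
  moreover have "u \<in> hom_set V (Dom V u) (Dom V g')" "v \<in> hom_set V (Dom V u) (Dom V g')"
    using assms(2-6) by (simp_all add: hom_set_def)
  ultimately show ?thesis using assms(7,8) by metis
qed

lemma fibre_squareI:
  assumes "f \<in> Arr V" "g \<in> Arr V" "g' \<in> Arr V" "f' \<in> Arr V"
    "Cod V g = Cod V f" "Dom V f' = Dom V g'" "Cod V g' = Dom V f" "Cod V f' = Dom V g"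
    "f \<cdot> g' = g \<cdot> f'"
    and ex: "\<And>a b. \<lbrakk>a \<in> Arr V; b \<in> Arr V; Dom V b = Dom V a; Cod V a = Dom V f; Cod V b = Dom V g;
        f \<cdot> a = g \<cdot> b\<rbrakk>
      \<Longrightarrow> \<exists>u. u \<in> Arr V \<and> Dom V u = Dom V a \<and> Cod V u = Dom V g' \<and> g' \<cdot> u = a \<and> f' \<cdot> u = b"
    and un: "\<And>u v. \<lbrakk>u \<in> Arr V; v \<in> Arr V; Dom V v = Dom V u; Cod V u = Dom V g';
        Cod V v = Dom V g'; g' \<cdot> u = g' \<cdot> v; f' \<cdot> u = f' \<cdot> v\<rbrakk> \<Longrightarrow> u = v"
  shows "fibre_square V f g g' f'"
proof -
  have "\<exists>!u. u \<in> hom_set V T (Dom V g') \<and> g' \<cdot> u = a \<and> f' \<cdot> u = b"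
    if "a \<in> hom_set V T (Dom V f)" "b \<in> hom_set V T (Dom V g)" "f \<cdot> a = g \<cdot> b" for T a b
  proof -
    from ex[of a b] that obtain u where
      "u \<in> hom_set V T (Dom V g')" "g' \<cdot> u = a" "f' \<cdot> u = b"
      by (auto simp: hom_set_def)
    moreover from this have "v = u"
      if "v \<in> hom_set V T (Dom V g')" "g' \<cdot> v = a" "f' \<cdot> v = b" for v
      using that un[of v u] by (auto simp: hom_set_def)
    ultimately show ?thesis by blast
  qed
  then show ?thesis unfolding fibre_square_def using assms(1-9) by auto
qed

lemma fibre_square_transpose:
  assumes "fibre_square V f g g' f'"
  shows "fibre_square V g f f' g'"
proof -
  note D = fibre_squareD[OF assms]
  show ?thesis
  proof (rule fibre_squareI)
    fix a b assume *: "a \<in> Arr V" "b \<in> Arr V" "Dom V b = Dom V a" "Cod V a = Dom V g"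
      "Cod V b = Dom V f" "g \<cdot> a = f \<cdot> b"
    from fibre_square_factor[OF assms, of b a] * D
    obtain u where "u \<in> Arr V" "Dom V u = Dom V b" "Cod V u = Dom V g'" "g' \<cdot> u = b" "f' \<cdot> u = a"
      by metis
    then show "\<exists>u. u \<in> Arr V \<and> Dom V u = Dom V a \<and> Cod V u = Dom V f' \<and> f' \<cdot> u = a \<and> g' \<cdot> u = b"
      using * D by auto
  next
    fix u v assume "u \<in> Arr V" "v \<in> Arr V" "Dom V v = Dom V u" "Cod V u = Dom V f'"
      "Cod V v = Dom V f'" "f' \<cdot> u = f' \<cdot> v" "g' \<cdot> u = g' \<cdot> v"
    then show "u = v"
      using D by - (rule fibre_square_unique[OF assms, of u v]; simp)
  qed (use D in auto)
qed

lemma fibre_square_ide: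
  assumes "f \<in> Arr V" "Dom V f = X" "Cod V f = Y"
  shows "fibre_square V f (Ide V Y) (Ide V X) f" "fibre_square V (Ide V Y) f f (Ide V X)"
proof -
  show "fibre_square V f (Ide V Y) (Ide V X) f"
    by (rule fibre_squareI) (use assms in auto)
  then show "fibre_square V (Ide V Y) f f (Ide V X)"
    by (rule fibre_square_transpose)
qed

lemma fibre_square_hpaste:
  assumes 1: "fibre_square V f g g' f'" and 2: "fibre_square V f' h h' f''"
  shows "fibre_square V f (g \<cdot> h) (g' \<cdot> h') f''"
proof -
  note D1 = fibre_squareD[OF 1] and D2 = fibre_squareD[OF 2]
  show ?thesis
  proof (rule fibre_squareI)
    show "f \<cdot> (g' \<cdot> h') = (g \<cdot> h) \<cdot> f''"
      using D1 D2 fibre_square_comp[OF 1, of h'] by simp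
  next
    fix a b assume *: "a \<in> Arr V" "b \<in> Arr V" "Dom V b = Dom V a" "Cod V a = Dom V f"
      "Cod V b = Dom V (g \<cdot> h)" "f \<cdot> a = (g \<cdot> h) \<cdot> b"
    obtain u where u: "u \<in> Arr V" "Dom V u = Dom V a" "Cod V u = Dom V g'" "g' \<cdot> u = a"
      "f' \<cdot> u = h \<cdot> b"
      using fibre_square_factor[OF 1, of a "h \<cdot> b"] * D1 D2 by auto
    obtain v where v: "v \<in> Arr V" "Dom V v = Dom V u" "Cod V v = Dom V h'" "h' \<cdot> v = u"
      "f'' \<cdot> v = b"
      using fibre_square_factor[OF 2, of u b] u * D1 D2 by auto
    show "\<exists>u. u \<in> Arr V \<and> Dom V u = Dom V a \<and> Cod V u = Dom V (g' \<cdot> h') \<and> (g' \<cdot> h') \<cdot> u = a \<and>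
      f'' \<cdot> u = b"
      by (rule exI[of _ v]) (use u v D1 D2 in auto)
  next
    fix u v assume *: "u \<in> Arr V" "v \<in> Arr V" "Dom V v = Dom V u" "Cod V u = Dom V (g' \<cdot> h')"
      "Cod V v = Dom V (g' \<cdot> h')" "(g' \<cdot> h') \<cdot> u = (g' \<cdot> h') \<cdot> v" "f'' \<cdot> u = f'' \<cdot> v"
    have uv: "Cod V u = Dom V h'" "Cod V v = Dom V h'" using * D1 D2 by simp_all
    have "f' \<cdot> (h' \<cdot> u) = f' \<cdot> (h' \<cdot> v)"
      using fibre_square_comp[OF 2, of u] fibre_square_comp[OF 2, of v] * uv by metis
    moreover have "g' \<cdot> (h' \<cdot> u) = g' \<cdot> (h' \<cdot> v)"
      using *(1-6) uv D1 D2 by simp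
    ultimately have "h' \<cdot> u = h' \<cdot> v"
      using *(1-3) uv D1(6) D2(1-8) by - (rule fibre_square_unique[OF 1]; simp)
    then show "u = v"
      using * uv by - (rule fibre_square_unique[OF 2]; simp)
  qed (use D1 D2 in auto)
qed

lemma fibre_square_vpaste:
  assumes "fibre_square V g h h' g'" "fibre_square V f h' h'' f'"
  shows "fibre_square V (g \<cdot> f) h h'' (g' \<cdot> f')"
  using assms fibre_square_hpaste fibre_square_transpose by blast

text \<open>The converse of pasting, used to recognize an iterated fibre product inside a given fibre square.\<close>

lemma fibre_square_hcancel:
  assumes 1: "fibre_square V f g g' f'" and 2: "fibre_square V f (g \<cdot> h) k f''"
    and h: "h \<in> Arr V" "Cod V h = Dom V g"
  obtains h' where "fibre_square V f' h h' f''" "g' \<cdot> h' = k"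
proof -
  note D1 = fibre_squareD[OF 1] and D2 = fibre_squareD[OF 2]
  obtain h' where h': "h' \<in> Arr V" "Dom V h' = Dom V k" "Cod V h' = Dom V g'" "g' \<cdot> h' = k"
      "f' \<cdot> h' = h \<cdot> f''"
    using fibre_square_factor[OF 1, of k "h \<cdot> f''"] h D1 D2 by auto
  have "fibre_square V f' h h' f''"
  proof (rule fibre_squareI)
    fix a b assume *: "a \<in> Arr V" "b \<in> Arr V" "Dom V b = Dom V a" "Cod V a = Dom V f'"
      "Cod V b = Dom V h" "f' \<cdot> a = h \<cdot> b"
    have "f \<cdot> (g' \<cdot> a) = (g \<cdot> h) \<cdot> b"
      using * D1 h fibre_square_comp[OF 1, of a] by simp
    then obtain u where u: "u \<in> Arr V" "Dom V u = Dom V a" "Cod V u = Dom V k" "k \<cdot> u = g' \<cdot> a"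
      "f'' \<cdot> u = b"
      using fibre_square_factor[OF 2, of "g' \<cdot> a" b] h D1 D2 * by auto
    have "f' \<cdot> (h' \<cdot> u) = h \<cdot> b"
      using assoc[of u h' f'] u h h' D1 D2 by simp
    moreover have "g' \<cdot> (h' \<cdot> u) = g' \<cdot> a"
      using assoc[of u h' g'] u h h' D1 D2 by simp
    ultimately have "h' \<cdot> u = a"
      using * u h h' D1 D2 by - (rule fibre_square_unique[OF 1]; simp)
    then show "\<exists>u. u \<in> Arr V \<and> Dom V u = Dom V a \<and> Cod V u = Dom V h' \<and> h' \<cdot> u = a \<and> f'' \<cdot> u = b"
      using u h' by auto
  next
    fix u v assume *: "u \<in> Arr V" "v \<in> Arr V" "Dom V v = Dom V u" "Cod V u = Dom V h'"
      "Cod V v = Dom V h'" "h' \<cdot> u = h' \<cdot> v" "f'' \<cdot> u = f'' \<cdot> v"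
    have "k \<cdot> u = k \<cdot> v"
      using assoc[of u h' g'] assoc[of v h' g'] * h' D1 by auto
    then show "u = v"
      using * h' by - (rule fibre_square_unique[OF 2]; simp)
  qed (use D1 D2 h h' in auto)
  then show thesis using h' that by blast
qed

lemma fibre_square_vcancel:
  assumes 1: "fibre_square V g h h' g'" and 2: "fibre_square V (g \<cdot> f) h h'' p"
    and f: "f \<in> Arr V" "Cod V f = Dom V g"
  obtains f' where "fibre_square V f h' h'' f'" "g' \<cdot> f' = p"
  using fibre_square_hcancel[OF fibre_square_transpose[OF 1] fibre_square_transpose[OF 2] f]
    fibre_square_transpose by metis

lemma fibre_square_iso:
  assumes 1: "fibre_square V f g g1 f1" and 2: "fibre_square V f g g2 f2"
  obtains u where "is_iso V u" "u \<in> Arr V" "Dom V u = Dom V g1" "Cod V u = Dom V g2"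
    "g2 \<cdot> u = g1" "f2 \<cdot> u = f1"
proof -
  note D1 = fibre_squareD[OF 1] and D2 = fibre_squareD[OF 2]
  obtain u where u: "u \<in> Arr V" "Dom V u = Dom V g1" "Cod V u = Dom V g2" "g2 \<cdot> u = g1"
      "f2 \<cdot> u = f1"
    using fibre_square_factor[OF 2, of g1 f1] D1 by auto
  obtain v where v: "v \<in> Arr V" "Dom V v = Dom V g2" "Cod V v = Dom V g1" "g1 \<cdot> v = g2"
      "f1 \<cdot> v = f2"
    using fibre_square_factor[OF 1, of g2 f2] D2 by auto
  have "v \<cdot> u = Ide V (Dom V u)"
    using u v D1 D2 assoc[of u v g1] assoc[of u v f1]
    by - (rule fibre_square_unique[OF 1]; simp)
  moreover have "u \<cdot> v = Ide V (Cod V u)"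
    using u v D1 D2 assoc[of v u g2] assoc[of v u f2]
    by - (rule fibre_square_unique[OF 2]; simp)
  ultimately have "is_iso V u"
    using u v by (intro is_isoI[of u v]) auto
  then show thesis using u that by blast
qed

text \<open>Fibre squares may be transported along an isomorphism of the source of their right or bottom
  side. This is how a change of representatives of cycles is absorbed.\<close>

lemma fibre_square_iso_right:
  assumes S: "fibre_square V (f \<cdot> a) g g' f'" and a: "is_iso V a"
    and f: "f \<in> Arr V" "Cod V a = Dom V f"
  shows "fibre_square V f g (a \<cdot> g') f'"
proof -
  obtain b where b: "a \<in> Arr V" "b \<in> Arr V" "Dom V b = Cod V a" "Cod V b = Dom V a"
    "b \<cdot> a = Ide V (Dom V a)" "a \<cdot> b = Ide V (Cod V a)"
    using a by (rule is_isoE)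
  have D: "g \<in> Arr V" "g' \<in> Arr V" "f' \<in> Arr V" "Cod V g = Cod V f" "Dom V f' = Dom V g'"
    "Cod V g' = Dom V a" "Cod V f' = Dom V g" "f \<cdot> (a \<cdot> g') = g \<cdot> f'"
    using fibre_squareD[OF S] b f by auto
  have cancel: "a \<cdot> (b \<cdot> x) = x" if "x \<in> Arr V" "Cod V x = Dom V f" for x
    using that b f assoc[of x b a] by simp
  have cancel': "b \<cdot> (a \<cdot> x) = x" if "x \<in> Arr V" "Cod V x = Dom V a" for x
    using that b f assoc[of x a b] by simp
  show ?thesis
  proof (rule fibre_squareI)
    fix x y assume *: "x \<in> Arr V" "y \<in> Arr V" "Dom V y = Dom V x" "Cod V x = Dom V f"
      "Cod V y = Dom V g" "f \<cdot> x = g \<cdot> y"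
    obtain u where u: "u \<in> Arr V" "Dom V u = Dom V x" "Cod V u = Dom V g'" "g' \<cdot> u = b \<cdot> x"
      "f' \<cdot> u = y"
      using fibre_square_factor[OF S, of "b \<cdot> x" y] * b f cancel[of x] by auto
    then show "\<exists>u. u \<in> Arr V \<and> Dom V u = Dom V x \<and> Cod V u = Dom V (a \<cdot> g') \<and> (a \<cdot> g') \<cdot> u = x \<and>
      f' \<cdot> u = y"
      using b D * f cancel[of x] by (intro exI[of _ u]) auto
  next
    fix u v assume *: "u \<in> Arr V" "v \<in> Arr V" "Dom V v = Dom V u" "Cod V u = Dom V (a \<cdot> g')"
      "Cod V v = Dom V (a \<cdot> g')" "(a \<cdot> g') \<cdot> u = (a \<cdot> g') \<cdot> v" "f' \<cdot> u = f' \<cdot> v"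
    have "b \<cdot> (a \<cdot> (g' \<cdot> u)) = b \<cdot> (a \<cdot> (g' \<cdot> v))"
      using * b D by simp
    then have "g' \<cdot> u = g' \<cdot> v"
      using * b D cancel'[of "g' \<cdot> u"] cancel'[of "g' \<cdot> v"] by simp
    then show "u = v"
      using * b D by - (rule fibre_square_unique[OF S]; simp)
  qed (use b D f in auto)
qed

lemma fibre_square_iso_bottom:
  assumes S: "fibre_square V f (g \<cdot> a) g' f'" and a: "is_iso V a"
    and g: "g \<in> Arr V" "Cod V a = Dom V g"
  shows "fibre_square V f g g' (a \<cdot> f')"
  by (rule fibre_square_transpose,
      rule fibre_square_iso_right[OF fibre_square_transpose[OF S] a g])

text \<open>An isomorphism is a base change of an identity.\<close>

lemma stable_class_iso:
  assumes K: "stable_class V K" and a: "is_iso V a"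
  shows "a \<in> K"
proof -
  obtain b where b: "is_iso V b" "a \<in> Arr V" "b \<in> Arr V" "Dom V b = Cod V a" "Cod V b = Dom V a"
    "b \<cdot> a = Ide V (Dom V a)" "a \<cdot> b = Ide V (Cod V a)"
    using a by (rule is_isoE)
  have "fibre_square V (Ide V (Cod V a)) (Ide V (Cod V a)) a a"
  proof -
    have "fibre_square V (Ide V (Cod V a)) (Ide V (Cod V a) \<cdot> a) a (Ide V (Dom V a))"
      using b fibre_square_ide(2)[of a "Dom V a" "Cod V a"] by simp
    from fibre_square_iso_bottom[OF this a] b show ?thesis by simp
  qed
  moreover have "Ide V (Cod V a) \<in> K"
    using K b unfolding stable_class_def by simp
  ultimately show ?thesis using K unfolding stable_class_def by metis
qed

end


section \<open>Pullback of fibre-objects up to isomorphism\<close>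

context fibred_category
begin

lemma PArr_simps [simp]:
  assumes "k \<in> Arr (Tot F)"
  shows "PArr F k \<in> Arr V" "Dom V (PArr F k) = PObj F (Dom (Tot F) k)"
    "Cod V (PArr F k) = PObj F (Cod (Tot F) k)"
  using proj_arr[of k "Dom (Tot F) k" "Cod (Tot F) k"] assms by (auto simp: hom_set_def)

lemma PArr_comp [simp]:
  assumes "j \<in> Arr (Tot F)" "k \<in> Arr (Tot F)" "Cod (Tot F) j = Dom (Tot F) k"
  shows "PArr F (k \<cdot>\<^bsub>Tot F\<^esub> j) = PArr F k \<cdot>\<^bsub>V\<^esub> PArr F j"
  using proj_comp[of j "Dom (Tot F) j" "Cod (Tot F) j" k "Cod (Tot F) k"] assms
  by (auto simp: hom_set_def)

lemma cartesian_Arr: "cartesian V F k \<Longrightarrow> k \<in> Arr (Tot F)"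
  by (simp add: cartesian_def)

lemma cartesian_factor:
  assumes k: "cartesian V F k" and "j \<in> Arr (Tot F)" "Cod (Tot F) j = Cod (Tot F) k"
    "w \<in> Arr V" "Dom V w = PObj F (Dom (Tot F) j)" "Cod V w = PObj F (Dom (Tot F) k)"
    "PArr F j = PArr F k \<cdot>\<^bsub>V\<^esub> w"
  shows "\<exists>!v. v \<in> hom_set (Tot F) (Dom (Tot F) j) (Dom (Tot F) k) \<and> PArr F v = w \<and>
    k \<cdot>\<^bsub>Tot F\<^esub> v = j"
proof -
  have "j \<in> hom_set (Tot F) (Dom (Tot F) j) (Cod (Tot F) k)"
    "w \<in> hom_set V (PObj F (Dom (Tot F) j)) (PObj F (Dom (Tot F) k))"
    using assms by (simp_all add: hom_set_def)
  then show ?thesis using k assms(7) unfolding cartesian_def by blast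
qed

lemma cartesian_lift:
  assumes k: "cartesian V F k" and "j \<in> Arr (Tot F)" "Cod (Tot F) j = Cod (Tot F) k"
    "w \<in> Arr V" "Dom V w = PObj F (Dom (Tot F) j)" "Cod V w = PObj F (Dom (Tot F) k)"
    "PArr F j = PArr F k \<cdot>\<^bsub>V\<^esub> w"
  obtains v where "v \<in> Arr (Tot F)" "Dom (Tot F) v = Dom (Tot F) j"
    "Cod (Tot F) v = Dom (Tot F) k" "PArr F v = w" "k \<cdot>\<^bsub>Tot F\<^esub> v = j"
  using cartesian_factor[OF assms] by (auto simp: hom_set_def)

lemma cartesian_cancel:
  assumes k: "cartesian V F k" and "u \<in> Arr (Tot F)" "v \<in> Arr (Tot F)"
    "Dom (Tot F) u = Dom (Tot F) v" "Cod (Tot F) u = Dom (Tot F) k"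
    "Cod (Tot F) v = Dom (Tot F) k" "PArr F u = PArr F v" "k \<cdot>\<^bsub>Tot F\<^esub> u = k \<cdot>\<^bsub>Tot F\<^esub> v"
  shows "u = v"
proof -
  have "\<exists>!w. w \<in> hom_set (Tot F) (Dom (Tot F) (k \<cdot>\<^bsub>Tot F\<^esub> v)) (Dom (Tot F) k) \<and>
      PArr F w = PArr F v \<and> k \<cdot>\<^bsub>Tot F\<^esub> w = k \<cdot>\<^bsub>Tot F\<^esub> v"
    by (rule cartesian_factor[OF k]) (use assms cartesian_Arr[OF k] in simp_all)
  moreover have "u \<in> hom_set (Tot F) (Dom (Tot F) (k \<cdot>\<^bsub>Tot F\<^esub> v)) (Dom (Tot F) k)"
    "v \<in> hom_set (Tot F) (Dom (Tot F) (k \<cdot>\<^bsub>Tot F\<^esub> v)) (Dom (Tot F) k)"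
    using assms cartesian_Arr[OF k] by (simp_all add: hom_set_def)
  ultimately show ?thesis using assms(7,8) by metis
qed

text \<open>Each morphism lifts uniquely through the other one. All compatibilities of pullbacks of
  fibre-objects are comparisons of this kind.\<close>

lemma cartesian_fibre_iso:
  assumes k: "cartesian V F k" and l: "cartesian V F l"
    and eq: "Cod (Tot F) k = Cod (Tot F) l" "PArr F k = PArr F l"
  shows "fibre_iso V F (PObj F (Dom (Tot F) k)) (Dom (Tot F) k) (Dom (Tot F) l)"
proof -
  note kl = cartesian_Arr[OF k] cartesian_Arr[OF l]
  have X: "PObj F (Dom (Tot F) k) = PObj F (Dom (Tot F) l)" (is "?X = _")
    using PArr_simps(2) kl eq by metis
  have XO: "?X \<in> Obj V" using kl by (simp add: proj_obj)
  have r: "PArr F l = PArr F l \<cdot>\<^bsub>V\<^esub> Ide V ?X"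
    using kl X XO by simp
  obtain u where u: "u \<in> Arr (Tot F)" "Dom (Tot F) u = Dom (Tot F) k"
    "Cod (Tot F) u = Dom (Tot F) l" "PArr F u = Ide V ?X" "l \<cdot>\<^bsub>Tot F\<^esub> u = k"
    by (rule cartesian_lift[OF l kl(1) eq(1), of "Ide V ?X"]) (use X XO kl eq r in simp_all)
  obtain v where v: "v \<in> Arr (Tot F)" "Dom (Tot F) v = Dom (Tot F) l"
    "Cod (Tot F) v = Dom (Tot F) k" "PArr F v = Ide V ?X" "k \<cdot>\<^bsub>Tot F\<^esub> v = l"
    by (rule cartesian_lift[OF k kl(2) eq(1)[symmetric], of "Ide V ?X"])
      (use X XO kl eq r in simp_all)
  have "k \<cdot>\<^bsub>Tot F\<^esub> (v \<cdot>\<^bsub>Tot F\<^esub> u) = k"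
    using total.assoc[of u v k] u v kl by simp
  then have vu: "v \<cdot>\<^bsub>Tot F\<^esub> u = Ide (Tot F) (Dom (Tot F) u)"
    using u v kl XO by - (rule cartesian_cancel[OF k]; simp add: proj_ide)
  have "l \<cdot>\<^bsub>Tot F\<^esub> (u \<cdot>\<^bsub>Tot F\<^esub> v) = l"
    using total.assoc[of v u l] u v kl by simp
  then have "u \<cdot>\<^bsub>Tot F\<^esub> v = Ide (Tot F) (Cod (Tot F) u)"
    using u v kl XO X by - (rule cartesian_cancel[OF l]; simp add: proj_ide)
  with vu have "is_iso (Tot F) u"
    using u v by (intro total.is_isoI[of u v]) auto
  then show ?thesis
    using u kl X unfolding fibre_iso_def fibre_objs_def hom_set_def by auto
qed

lemma cartesian_comp:
  assumes k: "cartesian V F k" and l: "cartesian V F l" and kl: "Cod (Tot F) k = Dom (Tot F) l"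
  shows "cartesian V F (l \<cdot>\<^bsub>Tot F\<^esub> k)"
  unfolding cartesian_def
proof (intro conjI allI ballI impI)
  note A = cartesian_Arr[OF k] cartesian_Arr[OF l]
  show "l \<cdot>\<^bsub>Tot F\<^esub> k \<in> Arr (Tot F)" using A kl by simp
  fix J j w
  assume j: "j \<in> hom_set (Tot F) J (Cod (Tot F) (l \<cdot>\<^bsub>Tot F\<^esub> k))"
    and w: "w \<in> hom_set V (PObj F J) (PObj F (Dom (Tot F) (l \<cdot>\<^bsub>Tot F\<^esub> k)))"
    and e: "PArr F j = PArr F (l \<cdot>\<^bsub>Tot F\<^esub> k) \<cdot>\<^bsub>V\<^esub> w"
  have j': "j \<in> Arr (Tot F)" "Dom (Tot F) j = J" "Cod (Tot F) j = Cod (Tot F) l"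
    and w': "w \<in> Arr V" "Dom V w = PObj F J" "Cod V w = PObj F (Dom (Tot F) k)"
    using j w A kl by (simp_all add: hom_set_def)
  have e': "PArr F j = PArr F l \<cdot>\<^bsub>V\<^esub> (PArr F k \<cdot>\<^bsub>V\<^esub> w)"
    using e A kl w' by simp
  obtain x where x: "x \<in> Arr (Tot F)" "Dom (Tot F) x = J" "Cod (Tot F) x = Dom (Tot F) l"
      "PArr F x = PArr F k \<cdot>\<^bsub>V\<^esub> w" "l \<cdot>\<^bsub>Tot F\<^esub> x = j"
    using cartesian_lift[OF l j'(1,3), of "PArr F k \<cdot>\<^bsub>V\<^esub> w"] e' A kl j' w' by auto
  obtain y where y: "y \<in> Arr (Tot F)" "Dom (Tot F) y = J" "Cod (Tot F) y = Dom (Tot F) k"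
      "PArr F y = w" "k \<cdot>\<^bsub>Tot F\<^esub> y = x"
    using cartesian_lift[OF k x(1), of w] x kl w' by auto
  show "\<exists>!v. v \<in> hom_set (Tot F) J (Dom (Tot F) (l \<cdot>\<^bsub>Tot F\<^esub> k)) \<and> PArr F v = w \<and>
      (l \<cdot>\<^bsub>Tot F\<^esub> k) \<cdot>\<^bsub>Tot F\<^esub> v = j"
  proof (rule ex1I[of _ y])
    show "y \<in> hom_set (Tot F) J (Dom (Tot F) (l \<cdot>\<^bsub>Tot F\<^esub> k)) \<and> PArr F y = w \<and>
      (l \<cdot>\<^bsub>Tot F\<^esub> k) \<cdot>\<^bsub>Tot F\<^esub> y = j"
      using x y A kl by (simp add: hom_set_def)
    fix v assume "v \<in> hom_set (Tot F) J (Dom (Tot F) (l \<cdot>\<^bsub>Tot F\<^esub> k)) \<and> PArr F v = w \<and>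
      (l \<cdot>\<^bsub>Tot F\<^esub> k) \<cdot>\<^bsub>Tot F\<^esub> v = j"
    then have v: "v \<in> Arr (Tot F)" "Dom (Tot F) v = J" "Cod (Tot F) v = Dom (Tot F) k"
      "PArr F v = w" "l \<cdot>\<^bsub>Tot F\<^esub> (k \<cdot>\<^bsub>Tot F\<^esub> v) = j"
      using A kl total.assoc[of v k l] by (auto simp: hom_set_def)
    have "k \<cdot>\<^bsub>Tot F\<^esub> v = x"
      using v x A kl by - (rule cartesian_cancel[OF l]; simp)
    then show "v = y"
      using v y by - (rule cartesian_cancel[OF k]; simp)
  qed
qed

text \<open>Together with \<open>cartesian_comp\<close> this makes pullback respect isomorphic fibre-objects: a lift of
  \<open>f\<close> to \<open>L\<close> followed by a vertical isomorphism \<open>L \<cong> L'\<close> is a cartesian morphism over \<open>f\<close> with target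
  \<open>L'\<close>.\<close>

lemma cartesian_iso:
  assumes "is_iso (Tot F) k"
  shows "cartesian V F k"
  unfolding cartesian_def
proof (intro conjI allI ballI impI)
  obtain b where b: "k \<in> Arr (Tot F)" "b \<in> Arr (Tot F)" "Dom (Tot F) b = Cod (Tot F) k"
    "Cod (Tot F) b = Dom (Tot F) k" "b \<cdot>\<^bsub>Tot F\<^esub> k = Ide (Tot F) (Dom (Tot F) k)"
    "k \<cdot>\<^bsub>Tot F\<^esub> b = Ide (Tot F) (Cod (Tot F) k)"
    using assms by (rule total.is_isoE)
  show "k \<in> Arr (Tot F)" by fact
  fix J j w
  assume j: "j \<in> hom_set (Tot F) J (Cod (Tot F) k)"
    and w: "w \<in> hom_set V (PObj F J) (PObj F (Dom (Tot F) k))"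
    and e: "PArr F j = PArr F k \<cdot>\<^bsub>V\<^esub> w"
  have j': "j \<in> Arr (Tot F)" "Dom (Tot F) j = J" "Cod (Tot F) j = Cod (Tot F) k"
    and w': "w \<in> Arr V" "Dom V w = PObj F J" "Cod V w = PObj F (Dom (Tot F) k)"
    using j w by (simp_all add: hom_set_def)
  have "PArr F b \<cdot>\<^bsub>V\<^esub> PArr F k = Ide V (PObj F (Dom (Tot F) k))"
    using PArr_comp[of k b] b by (simp add: proj_ide)
  then have "PArr F b \<cdot>\<^bsub>V\<^esub> PArr F j = w"
    using e b w' base.assoc[of w "PArr F k" "PArr F b"] by simp
  moreover have "k \<cdot>\<^bsub>Tot F\<^esub> (b \<cdot>\<^bsub>Tot F\<^esub> j) = j"
    using total.assoc[of j b k] b j' by simp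
  ultimately show "\<exists>!v. v \<in> hom_set (Tot F) J (Dom (Tot F) k) \<and> PArr F v = w \<and>
      k \<cdot>\<^bsub>Tot F\<^esub> v = j"
  proof (intro ex1I[of _ "b \<cdot>\<^bsub>Tot F\<^esub> j"])
    fix v assume "v \<in> hom_set (Tot F) J (Dom (Tot F) k) \<and> PArr F v = w \<and> k \<cdot>\<^bsub>Tot F\<^esub> v = j"
    then show "v = b \<cdot>\<^bsub>Tot F\<^esub> j"
      using b total.assoc[of v k b] by (auto simp: hom_set_def)
  qed (use b j' in \<open>simp_all add: hom_set_def\<close>)
qed

lemma Lift_simps:
  assumes "f \<in> Arr V" "L \<in> fibre_objs F (Cod V f)"
  shows "cartesian V F (Lift F f L)" "Lift F f L \<in> Arr (Tot F)" "Cod (Tot F) (Lift F f L) = L"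
    "PArr F (Lift F f L) = f" "Dom (Tot F) (Lift F f L) = pb F f L"
  using lift[of f L] assms cartesian_Arr by (auto simp: fibre_objs_def pb_def)

lemma pb_fibre_objs [simp]:
  assumes "f \<in> Arr V" "L \<in> fibre_objs F (Cod V f)"
  shows "pb F f L \<in> fibre_objs F (Dom V f)"
  using Lift_simps[OF assms] PArr_simps(2)[of "Lift F f L"] total.Dom_Cod_Obj[of "Lift F f L"]
  by (simp add: fibre_objs_def)

lemma fibre_iso_refl [simp]:
  assumes "L \<in> fibre_objs F X"
  shows "fibre_iso V F X L L"
  using assms by (auto simp: fibre_iso_def fibre_objs_def hom_set_def proj_ide
      intro!: exI[of _ "Ide (Tot F) L"])

lemma fibre_iso_sym:
  assumes "fibre_iso V F X L L'"
  shows "fibre_iso V F X L' L"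
proof -
  obtain k where L: "L \<in> fibre_objs F X" "L' \<in> fibre_objs F X"
    and k: "is_iso (Tot F) k" "Dom (Tot F) k = L" "Cod (Tot F) k = L'" "PArr F k = Ide V X"
    using assms by (auto simp: fibre_iso_def hom_set_def)
  obtain b where b: "is_iso (Tot F) b" "k \<in> Arr (Tot F)" "b \<in> Arr (Tot F)"
    "Dom (Tot F) b = Cod (Tot F) k"
    "Cod (Tot F) b = Dom (Tot F) k" "b \<cdot>\<^bsub>Tot F\<^esub> k = Ide (Tot F) (Dom (Tot F) k)"
    using k(1) by (rule total.is_isoE)
  have X: "PObj F L = X" "PObj F L' = X" "L \<in> Obj (Tot F)" using L by (auto simp: fibre_objs_def)
  have "PArr F b = Ide V X"
    using PArr_comp[of k b] b k X by (simp add: proj_ide)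
  then show ?thesis using L k b by (auto simp: fibre_iso_def hom_set_def intro!: bexI[of _ b])
qed

lemma fibre_iso_trans:
  assumes "fibre_iso V F X L L'" "fibre_iso V F X L' L''"
  shows "fibre_iso V F X L L''"
proof -
  obtain k where L: "L \<in> fibre_objs F X" "L' \<in> fibre_objs F X"
    and k: "k \<in> Arr (Tot F)" "is_iso (Tot F) k" "Dom (Tot F) k = L" "Cod (Tot F) k = L'"
      "PArr F k = Ide V X"
    using assms by (auto simp: fibre_iso_def hom_set_def)
  obtain l where L'': "L'' \<in> fibre_objs F X"
    and l: "l \<in> Arr (Tot F)" "is_iso (Tot F) l" "Dom (Tot F) l = L'" "Cod (Tot F) l = L''"
      "PArr F l = Ide V X"
    using assms by (auto simp: fibre_iso_def hom_set_def)
  have "X \<in> Obj V" using L proj_obj by (auto simp: fibre_objs_def)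
  then show ?thesis
    using L L'' k l total.is_iso_comp[OF k(2) l(2)]
    by (auto simp: fibre_iso_def hom_set_def intro!: exI[of _ "l \<cdot>\<^bsub>Tot F\<^esub> k"])
qed

lemma fibre_iso_pb:
  assumes f: "f \<in> Arr V" and L: "fibre_iso V F (Cod V f) L L'"
  shows "fibre_iso V F (Dom V f) (pb F f L) (pb F f L')"
proof -
  have L': "L \<in> fibre_objs F (Cod V f)" "L' \<in> fibre_objs F (Cod V f)"
    using L by (auto simp: fibre_iso_def)
  obtain k where k: "k \<in> Arr (Tot F)" "is_iso (Tot F) k" "Dom (Tot F) k = L"
      "Cod (Tot F) k = L'" "PArr F k = Ide V (Cod V f)"
    using L by (auto simp: fibre_iso_def hom_set_def)
  note P = Lift_simps[OF f L'(1)] and P' = Lift_simps[OF f L'(2)]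
  have "PObj F (pb F f L) = Dom V f" using pb_fibre_objs[OF f L'(1)] by (simp add: fibre_objs_def)
  moreover have "fibre_iso V F (PObj F (Dom (Tot F) (k \<cdot>\<^bsub>Tot F\<^esub> Lift F f L)))
      (Dom (Tot F) (k \<cdot>\<^bsub>Tot F\<^esub> Lift F f L)) (Dom (Tot F) (Lift F f L'))"
    by (rule cartesian_fibre_iso[OF cartesian_comp[OF P(1) cartesian_iso[OF k(2)]] P'(1)])
      (use P P' k f in simp_all)
  ultimately show ?thesis using P P' k by simp
qed

lemma fibre_iso_pb_ide:
  assumes "L \<in> fibre_objs F X"
  shows "fibre_iso V F X (pb F (Ide V X) L) L"
proof -
  have X: "X \<in> Obj V" "L \<in> Obj (Tot F)" "PObj F L = X"
    using assms proj_obj by (auto simp: fibre_objs_def)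
  then have L: "L \<in> fibre_objs F (Cod V (Ide V X))" using assms by simp
  note P = Lift_simps[OF base.ide_simps(1)[OF X(1)] L]
  have "PObj F (pb F (Ide V X) L) = X"
    using pb_fibre_objs[OF base.ide_simps(1)[OF X(1)] L] X by (simp add: fibre_objs_def)
  moreover have "fibre_iso V F (PObj F (Dom (Tot F) (Lift F (Ide V X) L)))
      (Dom (Tot F) (Lift F (Ide V X) L)) (Dom (Tot F) (Ide (Tot F) L))"
    by (rule cartesian_fibre_iso[OF P(1) cartesian_iso]) (use P X in \<open>simp_all add: proj_ide\<close>)
  ultimately show ?thesis using P X by simp
qed

lemma fibre_iso_pb_comp:
  assumes f: "f \<in> Arr V" and g: "g \<in> Arr V" "Cod V g = Dom V f"
    and L: "L \<in> fibre_objs F (Cod V f)"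
  shows "fibre_iso V F (Dom V g) (pb F g (pb F f L)) (pb F (f \<cdot>\<^bsub>V\<^esub> g) L)"
proof -
  have fg: "f \<cdot>\<^bsub>V\<^esub> g \<in> Arr V" and L': "L \<in> fibre_objs F (Cod V (f \<cdot>\<^bsub>V\<^esub> g))"
    and M: "pb F f L \<in> fibre_objs F (Cod V g)"
    using f g L pb_fibre_objs[OF f L] by simp_all
  note P = Lift_simps[OF f L] and Q = Lift_simps[OF g(1) M] and R = Lift_simps[OF fg L']
  have "PObj F (pb F g (pb F f L)) = Dom V g"
    using pb_fibre_objs[OF g(1) M] by (simp add: fibre_objs_def)
  moreover have "fibre_iso V F
      (PObj F (Dom (Tot F) (Lift F f L \<cdot>\<^bsub>Tot F\<^esub> Lift F g (pb F f L))))
      (Dom (Tot F) (Lift F f L \<cdot>\<^bsub>Tot F\<^esub> Lift F g (pb F f L)))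
      (Dom (Tot F) (Lift F (f \<cdot>\<^bsub>V\<^esub> g) L))"
    by (rule cartesian_fibre_iso[OF cartesian_comp[OF Q(1) P(1)] R(1)]) (use P Q R in simp_all)
  ultimately show ?thesis using P Q R by simp
qed

definition fibre_class :: "'l \<Rightarrow> 'l set" where
  "fibre_class L = {L'. fibre_iso V F (PObj F L) L L'}"

text \<open>An isomorphism of cycles permutes the fibre-objects and replaces them by isomorphic ones. The
  multiset of isomorphism classes is the invariant of the list under these changes.\<close>

definition fibre_classes :: "'l list \<Rightarrow> 'l set multiset" where
  "fibre_classes Ls = image_mset fibre_class (mset Ls)"

lemma fibre_class_eq_iff:
  assumes "L \<in> fibre_objs F X" "L' \<in> fibre_objs F X"
  shows "fibre_class L = fibre_class L' \<longleftrightarrow> fibre_iso V F X L L'"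
proof
  have X: "PObj F L = X" "PObj F L' = X" using assms by (auto simp: fibre_objs_def)
  show "fibre_iso V F X L L'" if "fibre_class L = fibre_class L'"
    using that fibre_iso_refl[OF assms(2)] X by (auto simp: fibre_class_def)
  show "fibre_class L = fibre_class L'" if "fibre_iso V F X L L'"
    using fibre_iso_trans[OF that] fibre_iso_trans[OF fibre_iso_sym[OF that]]
    by (auto simp: fibre_class_def X)
qed

lemma fibre_classes_append [simp]:
  "fibre_classes (Ls @ Ms) = fibre_classes Ls + fibre_classes Ms"
  by (simp add: fibre_classes_def)

lemma fibre_classes_Nil [simp]: "fibre_classes [] = {#}"
  by (simp add: fibre_classes_def)

lemma fibre_classes_Cons [simp]:
  "fibre_classes (L # Ls) = add_mset (fibre_class L) (fibre_classes Ls)"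
  by (simp add: fibre_classes_def)

lemma fibre_classes_map_cong:
  assumes "\<And>L. L \<in> set Ls \<Longrightarrow> fibre_iso V F X (a L) (b L)"
  shows "fibre_classes (map a Ls) = fibre_classes (map b Ls)"
proof -
  have "fibre_class (a L) = fibre_class (b L)" if "L \<in> set Ls" for L
    using assms[OF that] fibre_class_eq_iff by (auto simp: fibre_iso_def)
  then have "map fibre_class (map a Ls) = map fibre_class (map b Ls)" by simp
  then show ?thesis unfolding fibre_classes_def by (metis mset_map)
qed

lemma fibre_classes_pb_ide:
  assumes "set Ls \<subseteq> fibre_objs F X"
  shows "fibre_classes (map (pb F (Ide V X)) Ls) = fibre_classes Ls"
  using fibre_classes_map_cong[of Ls X "pb F (Ide V X)" "\<lambda>L. L"] fibre_iso_pb_ide assms by auto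

lemma fibre_classes_pb_comp:
  assumes "f \<in> Arr V" "g \<in> Arr V" "Cod V g = Dom V f" "set Ls \<subseteq> fibre_objs F (Cod V f)"
  shows "fibre_classes (map (pb F g) (map (pb F f) Ls)) = fibre_classes (map (pb F (f \<cdot>\<^bsub>V\<^esub> g)) Ls)"
  using fibre_classes_map_cong[of Ls "Dom V g" "\<lambda>L. pb F g (pb F f L)" "pb F (f \<cdot>\<^bsub>V\<^esub> g)"]
    fibre_iso_pb_comp[OF assms(1-3)] assms(4) by (auto simp: comp_def)

text \<open>This and \<open>fibre_classes_eqI\<close> replace the permutations in the definition of
  isomorphic cycles by equality of multisets, so that later proofs only have to rewrite.\<close>

lemma fibre_classes_eqE:
  assumes "fibre_classes Ls = fibre_classes Ms"
    "set Ls \<subseteq> fibre_objs F X" "set Ms \<subseteq> fibre_objs F X"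
  obtains \<sigma> where "length Ls = length Ms" "bij_betw \<sigma> {..<length Ls} {..<length Ls}"
    "\<And>i. i < length Ls \<Longrightarrow> fibre_iso V F X (Ls ! i) (Ms ! \<sigma> i)"
proof -
  have m: "mset (map fibre_class Ls) = mset (map fibre_class Ms)"
    using assms(1) by (simp add: fibre_classes_def)
  then have len: "length Ls = length Ms" by (metis length_map mset_eq_length)
  obtain \<sigma> where b: "bij_betw \<sigma> {..<length Ls} {..<length Ls}"
    and e: "\<And>i. i < length Ls \<Longrightarrow> map fibre_class Ls ! i = map fibre_class Ms ! \<sigma> i"
    using permutation_Ex_bij[OF m] len by auto
  have "fibre_iso V F X (Ls ! i) (Ms ! \<sigma> i)" if i: "i < length Ls" for i
  proof -
    have \<sigma>: "\<sigma> i < length Ms" using bij_betwE[OF b] i len by auto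
    then have "fibre_class (Ls ! i) = fibre_class (Ms ! \<sigma> i)" using e[OF i] i by simp
    moreover have "Ls ! i \<in> fibre_objs F X" "Ms ! \<sigma> i \<in> fibre_objs F X"
      using nth_mem[OF i] nth_mem[OF \<sigma>] assms(2,3) by auto
    ultimately show ?thesis using fibre_class_eq_iff by blast
  qed
  then show thesis using that len b by blast
qed

lemma fibre_classes_eqI:
  assumes len: "length Ls = length Ms" and b: "bij_betw \<sigma> {..<length Ls} {..<length Ls}"
    and iso: "\<And>i. i < length Ls \<Longrightarrow> fibre_iso V F X (Ls ! i) (Ms ! \<sigma> i)"
  shows "fibre_classes Ls = fibre_classes Ms"
proof -
  have cls: "fibre_classes Ns = image_mset (\<lambda>i. fibre_class (Ns ! i)) (mset_set {..<length Ns})"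
    for Ns :: "'l list"
  proof -
    have "mset Ns = image_mset (\<lambda>i. Ns ! i) (mset_set {..<length Ns})"
      by (metis map_nth mset_map mset_upt atLeast0LessThan)
    then have "image_mset fibre_class (mset Ns)
        = image_mset fibre_class (image_mset (\<lambda>i. Ns ! i) (mset_set {..<length Ns}))"
      by (rule arg_cong)
    then show ?thesis by (simp add: fibre_classes_def multiset.map_comp comp_def)
  qed
  have "fibre_classes Ls = image_mset (\<lambda>i. fibre_class (Ms ! \<sigma> i)) (mset_set {..<length Ls})"
    unfolding cls
  proof (rule image_mset_cong)
    fix i assume "i \<in># mset_set {..<length Ls}"
    then have "fibre_iso V F X (Ls ! i) (Ms ! \<sigma> i)" using iso by simp
    then show "fibre_class (Ls ! i) = fibre_class (Ms ! \<sigma> i)"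
      using fibre_class_eq_iff by (auto simp: fibre_iso_def)
  qed
  also have "\<dots> = image_mset (\<lambda>i. fibre_class (Ms ! i)) (image_mset \<sigma> (mset_set {..<length Ls}))"
    by (simp add: multiset.map_comp comp_def)
  also have "image_mset \<sigma> (mset_set {..<length Ls}) = mset_set {..<length Ms}"
    using image_mset_mset_set[of \<sigma> "{..<length Ls}"] b len by (auto simp: bij_betw_def)
  finally show ?thesis unfolding cls[of Ms] .
qed

lemma fibre_classes_pb_cong:
  assumes f: "f \<in> Arr V" and "fibre_classes Ls = fibre_classes Ms"
    "set Ls \<subseteq> fibre_objs F (Cod V f)" "set Ms \<subseteq> fibre_objs F (Cod V f)"
  shows "fibre_classes (map (pb F f) Ls) = fibre_classes (map (pb F f) Ms)"
proof -
  obtain \<sigma> where len: "length Ls = length Ms" and b: "bij_betw \<sigma> {..<length Ls} {..<length Ls}"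
    and iso: "\<And>i. i < length Ls \<Longrightarrow> fibre_iso V F (Cod V f) (Ls ! i) (Ms ! \<sigma> i)"
    using fibre_classes_eqE[OF assms(2-4)] by blast
  show ?thesis
  proof (rule fibre_classes_eqI)
    fix i assume i: "i < length (map (pb F f) Ls)"
    then have "\<sigma> i < length Ms" using bij_betwE[OF b] len by auto
    then show "fibre_iso V F (Dom V f) (map (pb F f) Ls ! i) (map (pb F f) Ms ! \<sigma> i)"
      using fibre_iso_pb[OF f iso] i by simp
  qed (use len b in simp_all)
qed

lemma pb_image_fibre_objs [simp]:
  assumes "f \<in> Arr V" "A \<subseteq> fibre_objs F (Cod V f)" "Dom V f = X"
  shows "pb F f ` A \<subseteq> fibre_objs F X"
  using pb_fibre_objs assms by blast

end


section \<open>Classes of cobordism cycles\<close>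

declare cycle_iso.simps [simp del]

context fibred_category
begin

lemma cycle_isoI:
  assumes "g \<in> Arr V" "Dom V g = Dom V h" "Cod V g = Dom V k" "is_iso V g" "k \<cdot>\<^bsub>V\<^esub> g = h"
    "set Ls \<subseteq> fibre_objs F (Dom V h)" "set Ms \<subseteq> fibre_objs F (Dom V k)"
    "fibre_classes Ls = fibre_classes (map (pb F g) Ms)"
  shows "cycle_iso V F (h, Ls) (k, Ms)"
proof -
  have "set (map (pb F g) Ms) \<subseteq> fibre_objs F (Dom V h)"
    using assms(1,2,3,7) by simp
  from fibre_classes_eqE[OF assms(8,6) this] obtain \<sigma> where \<sigma>: "length Ls = length Ms"
    "bij_betw \<sigma> {..<length Ls} {..<length Ls}"
    "\<And>i. i < length Ls \<Longrightarrow> fibre_iso V F (Dom V h) (Ls ! i) (map (pb F g) Ms ! \<sigma> i)"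
    by (metis length_map)
  have "fibre_iso V F (Dom V h) (Ls ! i) (pb F g (Ms ! \<sigma> i))" if "i < length Ls" for i
    using \<sigma>(3)[OF that] bij_betwE[OF \<sigma>(2)] that \<sigma>(1) by simp
  then show ?thesis
    using \<sigma>(1,2) assms(1-5) by (auto simp: cycle_iso.simps hom_set_def intro!: exI[of _ g] bexI[of _ g])
qed

lemma cycle_isoE:
  assumes "cycle_iso V F (h, Ls) (k, Ms)"
    "set Ls \<subseteq> fibre_objs F (Dom V h)" "set Ms \<subseteq> fibre_objs F (Dom V k)"
  obtains g where "g \<in> Arr V" "Dom V g = Dom V h" "Cod V g = Dom V k" "is_iso V g"
    "k \<cdot>\<^bsub>V\<^esub> g = h" "fibre_classes Ls = fibre_classes (map (pb F g) Ms)"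
proof -
  obtain g \<sigma> where g: "g \<in> Arr V" "Dom V g = Dom V h" "Cod V g = Dom V k" "is_iso V g"
    "k \<cdot>\<^bsub>V\<^esub> g = h" and \<sigma>: "length Ls = length Ms" "bij_betw \<sigma> {..<length Ls} {..<length Ls}"
    "\<And>i. i < length Ls \<Longrightarrow> fibre_iso V F (Dom V h) (Ls ! i) (pb F g (Ms ! \<sigma> i))"
    using assms(1) by (auto simp: cycle_iso.simps hom_set_def)
  have "fibre_classes Ls = fibre_classes (map (pb F g) Ms)"
  proof (rule fibre_classes_eqI[OF _ \<sigma>(2)])
    fix i assume "i < length Ls"
    then show "fibre_iso V F (Dom V h) (Ls ! i) (map (pb F g) Ms ! \<sigma> i)"
      using \<sigma> bij_betwE[OF \<sigma>(2)] by simp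
  qed (use \<sigma> in simp)
  with g show thesis using that by blast
qed

lemma cycle_iso_sym:
  assumes i: "cycle_iso V F (h, Ls) (k, Ms)"
    and k: "k \<in> Arr V" and L: "set Ls \<subseteq> fibre_objs F (Dom V h)" "set Ms \<subseteq> fibre_objs F (Dom V k)"
  shows "cycle_iso V F (k, Ms) (h, Ls)"
proof -
  obtain g where g: "g \<in> Arr V" "Dom V g = Dom V h" "Cod V g = Dom V k" "is_iso V g"
    "k \<cdot>\<^bsub>V\<^esub> g = h" "fibre_classes Ls = fibre_classes (map (pb F g) Ms)"
    using cycle_isoE[OF i L] .
  obtain b where b: "is_iso V b" "b \<in> Arr V" "Dom V b = Cod V g" "Cod V b = Dom V g"
    "b \<cdot>\<^bsub>V\<^esub> g = Ide V (Dom V g)" "g \<cdot>\<^bsub>V\<^esub> b = Ide V (Cod V g)"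
    using g(4) by (rule base.is_isoE)
  have "fibre_classes (map (pb F b) Ls) = fibre_classes (map (pb F b) (map (pb F g) Ms))"
    using b g L by (intro fibre_classes_pb_cong) simp_all
  also have "\<dots> = fibre_classes (map (pb F (Ide V (Dom V k))) Ms)"
    using fibre_classes_pb_comp[of g b Ms] b g L by simp
  also have "\<dots> = fibre_classes Ms"
    using fibre_classes_pb_ide L by simp
  finally have c: "fibre_classes Ms = fibre_classes (map (pb F b) Ls)" ..
  have "h \<cdot>\<^bsub>V\<^esub> b = k"
    using base.assoc[of b g k] b g k by simp
  then show ?thesis
    using b g L c by (intro cycle_isoI[of b]) simp_all
qed

lemma cycle_iso_trans:
  assumes i: "cycle_iso V F (h, Ls) (k, Ms)" and j: "cycle_iso V F (k, Ms) (l, Ns)"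
    and kl: "k \<in> Arr V" "l \<in> Arr V"
    and L: "set Ls \<subseteq> fibre_objs F (Dom V h)" "set Ms \<subseteq> fibre_objs F (Dom V k)"
      "set Ns \<subseteq> fibre_objs F (Dom V l)"
  shows "cycle_iso V F (h, Ls) (l, Ns)"
proof -
  obtain g where g: "g \<in> Arr V" "Dom V g = Dom V h" "Cod V g = Dom V k" "is_iso V g"
    "k \<cdot>\<^bsub>V\<^esub> g = h" "fibre_classes Ls = fibre_classes (map (pb F g) Ms)"
    using cycle_isoE[OF i L(1,2)] .
  obtain g' where g': "g' \<in> Arr V" "Dom V g' = Dom V k" "Cod V g' = Dom V l" "is_iso V g'"
    "l \<cdot>\<^bsub>V\<^esub> g' = k" "fibre_classes Ms = fibre_classes (map (pb F g') Ns)"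
    using cycle_isoE[OF j L(2,3)] .
  have "fibre_classes (map (pb F g) Ms) = fibre_classes (map (pb F g) (map (pb F g') Ns))"
    using g g' L by (intro fibre_classes_pb_cong) simp_all
  also have "\<dots> = fibre_classes (map (pb F (g' \<cdot>\<^bsub>V\<^esub> g)) Ns)"
    using g g' L by (intro fibre_classes_pb_comp) simp_all
  finally have "fibre_classes Ls = fibre_classes (map (pb F (g' \<cdot>\<^bsub>V\<^esub> g)) Ns)"
    using g(6) by simp
  moreover have "l \<cdot>\<^bsub>V\<^esub> (g' \<cdot>\<^bsub>V\<^esub> g) = h"
    using base.assoc[of g g' l] g g' kl by simp
  moreover have "is_iso V (g' \<cdot>\<^bsub>V\<^esub> g)"
    using g g' by (intro base.is_iso_comp) simp_all
  ultimately show ?thesis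
    using g g' L by (intro cycle_isoI[of "g' \<cdot>\<^bsub>V\<^esub> g"]) simp_all
qed

lemma cycle_class_eqI:
  assumes c: "is_cycle V F X c" "is_cycle V F X d" "cycle_iso V F c d"
  shows "cycle_class V F X c = cycle_class V F X d"
proof -
  obtain h Ls k Ms where [simp]: "c = (h, Ls)" "d = (k, Ms)" by (metis surj_pair)
  have "cycle_iso V F c e \<longleftrightarrow> cycle_iso V F d e" if "is_cycle V F X e" for e
  proof -
    obtain l Ns where e: "e = (l, Ns)" by (metis surj_pair)
    have "cycle_iso V F d c" using c cycle_iso_sym[of h Ls k Ms] by simp
    then show ?thesis
      using c that cycle_iso_trans[of h Ls k Ms l Ns] cycle_iso_trans[of k Ms h Ls l Ns]
      unfolding e by auto
  qed
  then show ?thesis unfolding cycle_class_def by blast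
qed

lemma cycle_class_cong:
  assumes "h \<in> Arr V" "Cod V h = X" "set Ls \<subseteq> fibre_objs F (Dom V h)"
    "set Ms \<subseteq> fibre_objs F (Dom V h)" "h = k" "fibre_classes Ls = fibre_classes Ms"
  shows "cycle_class V F X (h, Ls) = cycle_class V F X (k, Ms)"
  unfolding assms(5)[symmetric]
proof (rule cycle_class_eqI)
  show "cycle_iso V F (h, Ls) (h, Ms)"
    using assms by (intro cycle_isoI[of "Ide V (Dom V h)"]) (simp_all add: fibre_classes_pb_ide)
qed (use assms in simp_all)

lemma cycle_class_refl:
  assumes "h \<in> Arr V" "Cod V h = X" "set Ls \<subseteq> fibre_objs F (Dom V h)"
  shows "(h, Ls) \<in> cycle_class V F X (h, Ls)"
proof -
  have "cycle_iso V F (h, Ls) (h, Ls)"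
    using assms by (intro cycle_isoI[of "Ide V (Dom V h)"]) (simp_all add: fibre_classes_pb_ide)
  then show ?thesis using assms by (simp add: cycle_class_def)
qed

lemma cycle_class_memE:
  assumes "(k, Ms) \<in> cycle_class V F X (h, Ls)" "set Ls \<subseteq> fibre_objs F (Dom V h)"
  obtains g where "g \<in> Arr V" "Dom V g = Dom V h" "Cod V g = Dom V k" "is_iso V g"
    "k \<cdot>\<^bsub>V\<^esub> g = h" "fibre_classes Ls = fibre_classes (map (pb F g) Ms)"
    "k \<in> Arr V" "Cod V k = X" "set Ms \<subseteq> fibre_objs F (Dom V k)"
proof -
  have k: "k \<in> Arr V" "Cod V k = X" "set Ms \<subseteq> fibre_objs F (Dom V k)"
    and i: "cycle_iso V F (h, Ls) (k, Ms)"
    using assms(1) by (simp_all add: cycle_class_def)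
  show thesis using cycle_isoE[OF i assms(2) k(3)] that k by metis
qed

end

text \<open>The operations on classes are defined as unions over all choices. They are evaluated by showing
  that every choice gives the same class and that at least one choice exists.\<close>

lemma Union_eq_const:
  assumes "x \<in> \<A>" "\<And>A. A \<in> \<A> \<Longrightarrow> A = K"
  shows "\<Union> \<A> = K"
  using assms by blast


section \<open>The operations on classes\<close>

context bivariant_setting
begin

lemma fibre_product_exists:
  assumes "f \<in> Arr V" "g \<in> Arr V" "Cod V f = Cod V g"
  obtains g' f' where "fibre_square V f g g' f'"
  using fibre_products assms unfolding has_fibre_products_def by blast

lemma gen_ori_class:
  assumes h: "h \<in> Arr V" "Cod V h = Dom V f" and Ls: "set Ls \<subseteq> fibre_objs F (Dom V h)"
    and L: "L \<in> fibre_objs F (Dom V f)"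
  shows "gen_ori V F f L (cycle_class V F (Dom V f) (h, Ls))
    = cycle_class V F (Dom V f) (h, Ls @ [pb F h L])"
  unfolding gen_ori_def
proof (rule Union_eq_const)
  show "cycle_class V F (Dom V f) (h, Ls @ [pb F h L]) \<in>
    {cycle_class V F (Dom V f) (k, Ms @ [pb F k L]) |k Ms.
      (k, Ms) \<in> cycle_class V F (Dom V f) (h, Ls)}"
    using cycle_class_refl[OF h Ls] by blast
  fix A assume "A \<in> {cycle_class V F (Dom V f) (k, Ms @ [pb F k L]) |k Ms.
      (k, Ms) \<in> cycle_class V F (Dom V f) (h, Ls)}"
  then obtain k Ms where A: "A = cycle_class V F (Dom V f) (k, Ms @ [pb F k L])"
    and m: "(k, Ms) \<in> cycle_class V F (Dom V f) (h, Ls)" by blast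
  obtain g where g: "g \<in> Arr V" "Dom V g = Dom V h" "Cod V g = Dom V k" "is_iso V g"
    "k \<cdot>\<^bsub>V\<^esub> g = h" "fibre_classes Ls = fibre_classes (map (pb F g) Ms)"
    "k \<in> Arr V" "Cod V k = Dom V f" "set Ms \<subseteq> fibre_objs F (Dom V k)"
    using cycle_class_memE[OF m Ls] .
  have "fibre_classes (map (pb F g) (map (pb F k) [L])) = fibre_classes (map (pb F (k \<cdot>\<^bsub>V\<^esub> g)) [L])"
    using g L by (intro fibre_classes_pb_comp) simp_all
  then have "cycle_iso V F (h, Ls @ [pb F h L]) (k, Ms @ [pb F k L])"
    using g h Ls L by (intro cycle_isoI[of g]) simp_all
  then show "A = cycle_class V F (Dom V f) (h, Ls @ [pb F h L])"
    unfolding A using g h Ls L by (intro cycle_class_eqI[symmetric]) simp_all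
qed

lemma gen_push_class:
  assumes f: "f \<in> Arr V" and h: "h \<in> Arr V" "Cod V h = Dom V f"
    and Ls: "set Ls \<subseteq> fibre_objs F (Dom V h)"
  shows "gen_push V F f (cycle_class V F (Dom V f) (h, Ls))
    = cycle_class V F (Cod V f) (f \<cdot>\<^bsub>V\<^esub> h, Ls)"
  unfolding gen_push_def
proof (rule Union_eq_const)
  show "cycle_class V F (Cod V f) (f \<cdot>\<^bsub>V\<^esub> h, Ls) \<in>
    {cycle_class V F (Cod V f) (f \<cdot>\<^bsub>V\<^esub> k, Ms) |k Ms.
      (k, Ms) \<in> cycle_class V F (Dom V f) (h, Ls)}"
    using cycle_class_refl[OF h Ls] by blast
  fix A assume "A \<in> {cycle_class V F (Cod V f) (f \<cdot>\<^bsub>V\<^esub> k, Ms) |k Ms.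
      (k, Ms) \<in> cycle_class V F (Dom V f) (h, Ls)}"
  then obtain k Ms where A: "A = cycle_class V F (Cod V f) (f \<cdot>\<^bsub>V\<^esub> k, Ms)"
    and m: "(k, Ms) \<in> cycle_class V F (Dom V f) (h, Ls)" by blast
  obtain g where g: "g \<in> Arr V" "Dom V g = Dom V h" "Cod V g = Dom V k" "is_iso V g"
    "k \<cdot>\<^bsub>V\<^esub> g = h" "fibre_classes Ls = fibre_classes (map (pb F g) Ms)"
    "k \<in> Arr V" "Cod V k = Dom V f" "set Ms \<subseteq> fibre_objs F (Dom V k)"
    using cycle_class_memE[OF m Ls] .
  have "cycle_iso V F (f \<cdot>\<^bsub>V\<^esub> h, Ls) (f \<cdot>\<^bsub>V\<^esub> k, Ms)"
    using g h Ls f by (intro cycle_isoI[of g]) simp_all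
  then show "A = cycle_class V F (Cod V f) (f \<cdot>\<^bsub>V\<^esub> h, Ls)"
    unfolding A using g h Ls f by (intro cycle_class_eqI[symmetric]) simp_all
qed

text \<open>A representative differs from \<open>(h; L\<^sub>i)\<close> by an isomorphism, along which its fibre square is
  transported to one for \<open>h\<close>; two fibre squares for \<open>h\<close> differ by an isomorphism again.\<close>

lemma gen_pull_class:
  assumes S: "fibre_square V h g' g'' h'" and Ls: "set Ls \<subseteq> fibre_objs F (Dom V h)"
  shows "gen_pull V F g' (cycle_class V F (Cod V g') (h, Ls))
    = cycle_class V F (Dom V g') (h', map (pb F g'') Ls)"
  unfolding gen_pull_def
proof (rule Union_eq_const)
  note D = base.fibre_squareD[OF S]
  show "cycle_class V F (Dom V g') (h', map (pb F g'') Ls) \<in>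
    {cycle_class V F (Dom V g') (k', map (pb F k'') Ms) |k Ms k'' k'.
      (k, Ms) \<in> cycle_class V F (Cod V g') (h, Ls) \<and> fibre_square V k g' k'' k'}"
    using cycle_class_refl[of h "Cod V g'" Ls] D Ls S by auto
  fix A assume "A \<in> {cycle_class V F (Dom V g') (k', map (pb F k'') Ms) |k Ms k'' k'.
      (k, Ms) \<in> cycle_class V F (Cod V g') (h, Ls) \<and> fibre_square V k g' k'' k'}"
  then obtain k Ms k'' k' where A: "A = cycle_class V F (Dom V g') (k', map (pb F k'') Ms)"
    and m: "(k, Ms) \<in> cycle_class V F (Cod V g') (h, Ls)" and S': "fibre_square V k g' k'' k'"
    by blast
  note D' = base.fibre_squareD[OF S']
  obtain a where a: "a \<in> Arr V" "Dom V a = Dom V h" "Cod V a = Dom V k" "is_iso V a"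
    "k \<cdot>\<^bsub>V\<^esub> a = h" "fibre_classes Ls = fibre_classes (map (pb F a) Ms)"
    "k \<in> Arr V" "Cod V k = Cod V g'" "set Ms \<subseteq> fibre_objs F (Dom V k)"
    using cycle_class_memE[OF m Ls] .
  have "fibre_square V k g' (a \<cdot>\<^bsub>V\<^esub> g'') h'"
    using base.fibre_square_iso_right[of k a g' g'' h'] S a by simp
  then obtain u where u: "is_iso V u" "u \<in> Arr V" "Dom V u = Dom V (a \<cdot>\<^bsub>V\<^esub> g'')"
      "Cod V u = Dom V k''" "k'' \<cdot>\<^bsub>V\<^esub> u = a \<cdot>\<^bsub>V\<^esub> g''" "k' \<cdot>\<^bsub>V\<^esub> u = h'"
    using base.fibre_square_iso S' by metis
  have "fibre_classes (map (pb F g'') Ls) = fibre_classes (map (pb F g'') (map (pb F a) Ms))"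
    using a D Ls by (intro fibre_classes_pb_cong) simp_all
  also have "\<dots> = fibre_classes (map (pb F (k'' \<cdot>\<^bsub>V\<^esub> u)) Ms)"
    using fibre_classes_pb_comp[of a g'' Ms] a D u(5) by simp
  also have "\<dots> = fibre_classes (map (pb F u) (map (pb F k'') Ms))"
    using fibre_classes_pb_comp[of k'' u Ms] a D' u by simp
  finally have "cycle_iso V F (h', map (pb F g'') Ls) (k', map (pb F k'') Ms)"
    using u a D D' Ls by (intro cycle_isoI[of u]) simp_all
  then show "A = cycle_class V F (Dom V g') (h', map (pb F g'') Ls)"
    unfolding A using D D'(1-4,6-8) a Ls by (intro cycle_class_eqI[symmetric]) simp_all
qed

text \<open>The two fibre products in the definition of the product paste to one, so that the product of two
  cycles has as source the fibre product of their sources over the target of \<open>f\<close>.\<close>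

lemma gen_prod_class:
  assumes S: "fibre_square V (f \<cdot>\<^bsub>V\<^esub> h) k k'' p"
    and f: "f \<in> Arr V" and h: "h \<in> Arr V" "Cod V h = Dom V f" and Y: "Y = Cod V f"
    and Ls: "set Ls \<subseteq> fibre_objs F (Dom V h)" and Ms: "set Ms \<subseteq> fibre_objs F (Dom V k)"
  shows "gen_prod V F f (cycle_class V F (Dom V f) (h, Ls)) (cycle_class V F Y (k, Ms))
    = cycle_class V F (Dom V f) (h \<cdot>\<^bsub>V\<^esub> k'', map (pb F k'') Ls @ map (pb F p) Ms)"
  unfolding gen_prod_def
proof (rule Union_eq_const)
  have D: "k \<in> Arr V" "k'' \<in> Arr V" "p \<in> Arr V" "Cod V k = Y" "Dom V p = Dom V k''"
    "Cod V k'' = Dom V h" "Cod V p = Dom V k"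
    using base.fibre_squareD[OF S] f h Y by simp_all
  obtain k' f' where 1: "fibre_square V f k k' f'"
    using fibre_product_exists[of f k] f D Y by auto
  obtain h' where 2: "fibre_square V h k' k'' h'" "f' \<cdot>\<^bsub>V\<^esub> h' = p"
    using base.fibre_square_vcancel[OF 1 S h] .
  show "cycle_class V F (Dom V f) (h \<cdot>\<^bsub>V\<^esub> k'', map (pb F k'') Ls @ map (pb F p) Ms) \<in>
    {cycle_class V F (Dom V f)
       (h1 \<cdot>\<^bsub>V\<^esub> k1'', map (pb F k1'') Ls1 @ map (pb F (f1 \<cdot>\<^bsub>V\<^esub> h1')) Ms1) |
         h1 Ls1 k1 Ms1 k1' f1 k1'' h1'.
         (h1, Ls1) \<in> cycle_class V F (Dom V f) (h, Ls) \<and>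
         (k1, Ms1) \<in> cycle_class V F Y (k, Ms) \<and>
         fibre_square V f k1 k1' f1 \<and> fibre_square V h1 k1' k1'' h1'}"
    using cycle_class_refl[OF h Ls] cycle_class_refl[OF D(1,4) Ms] 1 2 by blast
  fix A assume "A \<in> {cycle_class V F (Dom V f)
       (h1 \<cdot>\<^bsub>V\<^esub> k1'', map (pb F k1'') Ls1 @ map (pb F (f1 \<cdot>\<^bsub>V\<^esub> h1')) Ms1) |
         h1 Ls1 k1 Ms1 k1' f1 k1'' h1'.
         (h1, Ls1) \<in> cycle_class V F (Dom V f) (h, Ls) \<and>
         (k1, Ms1) \<in> cycle_class V F Y (k, Ms) \<and>
         fibre_square V f k1 k1' f1 \<and> fibre_square V h1 k1' k1'' h1'}"
  then obtain h1 Ls1 k1 Ms1 k1' f1 k1'' h1' where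
    A: "A = cycle_class V F (Dom V f)
       (h1 \<cdot>\<^bsub>V\<^esub> k1'', map (pb F k1'') Ls1 @ map (pb F (f1 \<cdot>\<^bsub>V\<^esub> h1')) Ms1)"
    and m: "(h1, Ls1) \<in> cycle_class V F (Dom V f) (h, Ls)"
    and n: "(k1, Ms1) \<in> cycle_class V F Y (k, Ms)"
    and S1: "fibre_square V f k1 k1' f1" "fibre_square V h1 k1' k1'' h1'"
    by blast
  obtain a where a: "a \<in> Arr V" "Dom V a = Dom V h" "Cod V a = Dom V h1" "is_iso V a"
    "h1 \<cdot>\<^bsub>V\<^esub> a = h" "fibre_classes Ls = fibre_classes (map (pb F a) Ls1)"
    "h1 \<in> Arr V" "Cod V h1 = Dom V f" "set Ls1 \<subseteq> fibre_objs F (Dom V h1)"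
    using cycle_class_memE[OF m Ls] .
  obtain b where b: "b \<in> Arr V" "Dom V b = Dom V k" "Cod V b = Dom V k1" "is_iso V b"
    "k1 \<cdot>\<^bsub>V\<^esub> b = k" "fibre_classes Ms = fibre_classes (map (pb F b) Ms1)"
    "k1 \<in> Arr V" "Cod V k1 = Y" "set Ms1 \<subseteq> fibre_objs F (Dom V k1)"
    using cycle_class_memE[OF n Ms] .
  have SS: "fibre_square V (f \<cdot>\<^bsub>V\<^esub> h1) k1 k1'' (f1 \<cdot>\<^bsub>V\<^esub> h1')"
    using base.fibre_square_vpaste[OF S1] .
  \<comment> \<open>The chosen square for \<open>(h, k)\<close> is moved along \<open>a\<close> and \<open>b\<close> to one for \<open>(h1, k1)\<close>.\<close>
  define p1 where "p1 = f1 \<cdot>\<^bsub>V\<^esub> h1'"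
  have D1: "k1'' \<in> Arr V" "p1 \<in> Arr V" "Dom V p1 = Dom V k1''" "Cod V k1'' = Dom V h1"
    "Cod V p1 = Dom V k1"
    using base.fibre_squareD[OF SS] f a by (simp_all add: p1_def)
  have "fibre_square V ((f \<cdot>\<^bsub>V\<^esub> h1) \<cdot>\<^bsub>V\<^esub> a) (k1 \<cdot>\<^bsub>V\<^esub> b) k'' p"
    using S a b f by simp
  then have "fibre_square V (f \<cdot>\<^bsub>V\<^esub> h1) (k1 \<cdot>\<^bsub>V\<^esub> b) (a \<cdot>\<^bsub>V\<^esub> k'') p"
    using a f by (intro base.fibre_square_iso_right) simp_all
  then have "fibre_square V (f \<cdot>\<^bsub>V\<^esub> h1) k1 (a \<cdot>\<^bsub>V\<^esub> k'') (b \<cdot>\<^bsub>V\<^esub> p)"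
    using b by (intro base.fibre_square_iso_bottom) simp_all
  then obtain u where u: "is_iso V u" "u \<in> Arr V" "Dom V u = Dom V (a \<cdot>\<^bsub>V\<^esub> k'')"
      "Cod V u = Dom V k1''" "k1'' \<cdot>\<^bsub>V\<^esub> u = a \<cdot>\<^bsub>V\<^esub> k''" "p1 \<cdot>\<^bsub>V\<^esub> u = b \<cdot>\<^bsub>V\<^esub> p"
    using base.fibre_square_iso SS unfolding p1_def by metis
  have "fibre_classes (map (pb F k'') Ls) = fibre_classes (map (pb F k'') (map (pb F a) Ls1))"
    using a D Ls by (intro fibre_classes_pb_cong) simp_all
  also have "\<dots> = fibre_classes (map (pb F (k1'' \<cdot>\<^bsub>V\<^esub> u)) Ls1)"
    using fibre_classes_pb_comp[of a k'' Ls1] a D u(5) by simp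
  also have "\<dots> = fibre_classes (map (pb F u) (map (pb F k1'') Ls1))"
    using fibre_classes_pb_comp[of k1'' u Ls1] a D1 u by simp
  finally have c1: "fibre_classes (map (pb F k'') Ls)
    = fibre_classes (map (pb F u) (map (pb F k1'') Ls1))" .
  have "fibre_classes (map (pb F p) Ms) = fibre_classes (map (pb F p) (map (pb F b) Ms1))"
    using b D Ms by (intro fibre_classes_pb_cong) simp_all
  also have "\<dots> = fibre_classes (map (pb F (p1 \<cdot>\<^bsub>V\<^esub> u)) Ms1)"
    using fibre_classes_pb_comp[of b p Ms1] b D u(6) by simp
  also have "\<dots> = fibre_classes (map (pb F u) (map (pb F p1) Ms1))"
    using fibre_classes_pb_comp[of p1 u Ms1] b D1 u by simp
  finally have c2: "fibre_classes (map (pb F p) Ms)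
    = fibre_classes (map (pb F u) (map (pb F p1) Ms1))" .
  have ku: "(h1 \<cdot>\<^bsub>V\<^esub> k1'') \<cdot>\<^bsub>V\<^esub> u = h \<cdot>\<^bsub>V\<^esub> k''"
    using base.assoc[of k'' a h1] a D D1 u by simp
  have dom: "Dom V u = Dom V k''" using u a D by simp
  have cyc: "is_cycle V F (Dom V f) (h \<cdot>\<^bsub>V\<^esub> k'', map (pb F k'') Ls @ map (pb F p) Ms)"
    "is_cycle V F (Dom V f) (h1 \<cdot>\<^bsub>V\<^esub> k1'', map (pb F k1'') Ls1 @ map (pb F p1) Ms1)"
    using D D1 h a b Ls Ms by simp_all
  have "cycle_iso V F (h \<cdot>\<^bsub>V\<^esub> k'', map (pb F k'') Ls @ map (pb F p) Ms)
     (h1 \<cdot>\<^bsub>V\<^esub> k1'', map (pb F k1'') Ls1 @ map (pb F p1) Ms1)"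
    by (rule cycle_isoI[OF u(2) _ _ u(1) ku])
      (use D D1 u(4) dom h a b Ls Ms c1 c2 in \<open>simp_all del: map_map\<close>)
  then show "A = cycle_class V F (Dom V f) (h \<cdot>\<^bsub>V\<^esub> k'', map (pb F k'') Ls @ map (pb F p) Ms)"
    unfolding A p1_def[symmetric] by (rule cycle_class_eqI[OF cyc, symmetric])
qed

end


section \<open>The axioms of a bivariant theory on classes\<close>

context bivariant_setting
begin

lemma C_comp: "\<lbrakk>f \<in> C; g \<in> C; Cod V f = Dom V g\<rbrakk> \<Longrightarrow> g \<cdot>\<^bsub>V\<^esub> f \<in> C"
  and C_base_change: "\<lbrakk>f \<in> C; fibre_square V f g g' f'\<rbrakk> \<Longrightarrow> f' \<in> C"
  and C_ide: "X \<in> Obj V \<Longrightarrow> Ide V X \<in> C"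
  and C_iso: "is_iso V a \<Longrightarrow> a \<in> C"
  using confined base.stable_class_iso[OF confined] unfolding stable_class_def by blast+

lemma S_comp: "\<lbrakk>f \<in> S; g \<in> S; Cod V f = Dom V g\<rbrakk> \<Longrightarrow> g \<cdot>\<^bsub>V\<^esub> f \<in> S"
  and S_base_change: "\<lbrakk>f \<in> S; fibre_square V f g g' f'\<rbrakk> \<Longrightarrow> f' \<in> S"
  and S_ide: "X \<in> Obj V \<Longrightarrow> Ide V X \<in> S"
  and S_iso: "is_iso V a \<Longrightarrow> a \<in> S"
  and S_Arr: "f \<in> S \<Longrightarrow> f \<in> Arr V"
  using specialized base.stable_class_iso[OF specialized] unfolding stable_class_def by blast+

lemma Ind_fibre_square: "Ind f g g' f' \<Longrightarrow> fibre_square V f g g' f'"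
  and Ind_vpaste: "\<lbrakk>Ind g h h' g'; Ind f h' h'' f'\<rbrakk> \<Longrightarrow> Ind (g \<cdot>\<^bsub>V\<^esub> f) h h'' (g' \<cdot>\<^bsub>V\<^esub> f')"
  using independent unfolding independence_class_def by meson+

lemma Ind_ide:
  assumes "f \<in> Arr V" "Dom V f = X" "Cod V f = Y"
  shows "Ind f (Ide V Y) (Ide V X) f" "Ind (Ide V Y) f f (Ide V X)"
proof -
  have "f \<in> hom_set V X Y" using assms by (simp add: hom_set_def)
  then show "Ind f (Ide V Y) (Ide V X) f" "Ind (Ide V Y) f f (Ide V X)"
    using independent unfolding independence_class_def by meson+
qed

lemma OM_gensE:
  assumes "A \<in> OM_gens V F C S f" "Dom V f = X"
  obtains h Ls T where "A = cycle_class V F X (h, Ls)" "h \<in> Arr V" "Dom V h = T" "Cod V h = X"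
    "set Ls \<subseteq> fibre_objs F T" "h \<in> C" "f \<cdot>\<^bsub>V\<^esub> h \<in> S"
  using assms unfolding OM_gens_def by auto

lemma OM_gensI:
  assumes "h \<in> Arr V" "Cod V h = X" "Dom V f = X"
    "set Ls \<subseteq> fibre_objs F (Dom V h)" "h \<in> C" "f \<cdot>\<^bsub>V\<^esub> h \<in> S"
  shows "cycle_class V F X (h, Ls) \<in> OM_gens V F C S f"
  using assms unfolding OM_gens_def by auto

text \<open>A choice of fibre product with a variable for each corner, so that composability of the morphisms
  in a diagram is decided by rewriting.\<close>

lemma fibre_productE:
  assumes "f \<in> Arr V" "g \<in> Arr V" "Cod V f = Z" "Cod V g = Z" "Dom V f = X" "Dom V g = Y"
  obtains g' f' T where "fibre_square V f g g' f'" "g' \<in> Arr V" "f' \<in> Arr V" "Dom V g' = T"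
    "Dom V f' = T" "Cod V g' = X" "Cod V f' = Y" "f \<cdot>\<^bsub>V\<^esub> g' = g \<cdot>\<^bsub>V\<^esub> f'"
proof -
  obtain g' f' where S: "fibre_square V f g g' f'"
    using fibre_product_exists[of f g] assms by auto
  show thesis
    by (rule that[OF S]) (use base.fibre_squareD[OF S] assms in simp_all)
qed

lemma gen_ori_closed:
  assumes f: "f \<in> hom_set V X Y" and L: "L \<in> fibre_objs F X" and A: "A \<in> OM_gens V F C S f"
  shows "gen_ori V F f L A \<in> OM_gens V F C S f"
proof -
  have F: "f \<in> Arr V" "Dom V f = X" "Cod V f = Y" using f by (simp_all add: hom_set_def)
  obtain h Ls T where h: "A = cycle_class V F X (h, Ls)" "h \<in> Arr V" "Dom V h = T" "Cod V h = X"
    "set Ls \<subseteq> fibre_objs F T" "h \<in> C" "f \<cdot>\<^bsub>V\<^esub> h \<in> S"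
    using OM_gensE[OF A F(2)] .
  have "pb F h L \<in> fibre_objs F T" using pb_fibre_objs[of h L] h L by simp
  then show ?thesis
    using gen_ori_class[of h f Ls L] h L F by (simp add: OM_gensI)
qed

lemma gen_push_closed:
  assumes f: "f \<in> hom_set V X Y" and g: "g \<in> hom_set V Y Z" and fC: "f \<in> C"
    and A: "A \<in> OM_gens V F C S (g \<cdot>\<^bsub>V\<^esub> f)"
  shows "gen_push V F f A \<in> OM_gens V F C S g"
proof -
  have F: "f \<in> Arr V" "Dom V f = X" "Cod V f = Y" "g \<in> Arr V" "Dom V g = Y" "Cod V g = Z"
    using f g by (simp_all add: hom_set_def)
  obtain h Ls T where h: "A = cycle_class V F X (h, Ls)" "h \<in> Arr V" "Dom V h = T" "Cod V h = X"
    "set Ls \<subseteq> fibre_objs F T" "h \<in> C" "(g \<cdot>\<^bsub>V\<^esub> f) \<cdot>\<^bsub>V\<^esub> h \<in> S"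
    using OM_gensE[OF A, of X] F by auto
  have "gen_push V F f A = cycle_class V F Y (f \<cdot>\<^bsub>V\<^esub> h, Ls)"
    using gen_push_class[of f h Ls] F h by simp
  moreover have "f \<cdot>\<^bsub>V\<^esub> h \<in> C" using C_comp h fC F by simp
  ultimately show ?thesis using F h by (simp add: OM_gensI)
qed

lemma gen_pull_closed:
  assumes S: "fibre_square V f g g' f'" and A: "A \<in> OM_gens V F C S f"
  shows "gen_pull V F g' A \<in> OM_gens V F C S f'"
proof -
  define X Y X' Y' where "X = Dom V f" and "Y = Cod V f" and "X' = Dom V g'" and "Y' = Dom V g"
  have F: "f \<in> Arr V" "Dom V f = X" "Cod V f = Y" "g' \<in> Arr V" "Dom V g' = X'" "Cod V g' = X"
    "f' \<in> Arr V" "Dom V f' = X'" "Cod V f' = Y'"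
    using base.fibre_squareD[OF S] unfolding X_def Y_def X'_def Y'_def by simp_all
  obtain h Ls T where h: "A = cycle_class V F X (h, Ls)" "h \<in> Arr V" "Dom V h = T" "Cod V h = X"
    "set Ls \<subseteq> fibre_objs F T" "h \<in> C" "f \<cdot>\<^bsub>V\<^esub> h \<in> S"
    using OM_gensE[OF A F(2)] .
  obtain a h' T' where a: "fibre_square V h g' a h'" "a \<in> Arr V" "h' \<in> Arr V" "Dom V a = T'"
    "Dom V h' = T'" "Cod V a = T" "Cod V h' = X'"
    using fibre_productE[OF h(2) F(4) h(4) F(6) h(3) F(5)] .
  have "gen_pull V F g' A = cycle_class V F X' (h', map (pb F a) Ls)"
    using gen_pull_class[OF a(1), of Ls] h F by simp
  moreover have "h' \<in> C" using C_base_change[OF h(6) a(1)] .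
  moreover have "f' \<cdot>\<^bsub>V\<^esub> h' \<in> S" using S_base_change[OF h(7) base.fibre_square_vpaste[OF S a(1)]] .
  ultimately show ?thesis using F h a by (simp add: OM_gensI)
qed

text \<open>On the fibre product, \<open>g \<circ> f \<circ> v \<circ> k = (g \<circ> w) \<circ> p\<close>, where \<open>p\<close> is a base change of the
  specialized \<open>f \<circ> v\<close>, while \<open>k\<close> is a base change of the confined \<open>w\<close>.\<close>

lemma gen_prod_closed:
  assumes f: "f \<in> hom_set V X Y" and g: "g \<in> hom_set V Y Z"
    and A: "A \<in> OM_gens V F C S f" and A': "A' \<in> OM_gens V F C S g"
  shows "gen_prod V F f A A' \<in> OM_gens V F C S (g \<cdot>\<^bsub>V\<^esub> f)"
proof -
  have F: "f \<in> Arr V" "Dom V f = X" "Cod V f = Y" "g \<in> Arr V" "Dom V g = Y" "Cod V g = Z"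
    using f g by (simp_all add: hom_set_def)
  obtain v Ls T where v: "A = cycle_class V F X (v, Ls)" "v \<in> Arr V" "Dom V v = T" "Cod V v = X"
    "set Ls \<subseteq> fibre_objs F T" "v \<in> C" "f \<cdot>\<^bsub>V\<^esub> v \<in> S"
    using OM_gensE[OF A F(2)] .
  obtain w Ms U where w: "A' = cycle_class V F Y (w, Ms)" "w \<in> Arr V" "Dom V w = U" "Cod V w = Y"
    "set Ms \<subseteq> fibre_objs F U" "w \<in> C" "g \<cdot>\<^bsub>V\<^esub> w \<in> S"
    using OM_gensE[OF A' F(5)] .
  obtain k p P where k: "fibre_square V (f \<cdot>\<^bsub>V\<^esub> v) w k p" "k \<in> Arr V" "p \<in> Arr V" "Dom V k = P"
    "Dom V p = P" "Cod V k = T" "Cod V p = U" "(f \<cdot>\<^bsub>V\<^esub> v) \<cdot>\<^bsub>V\<^esub> k = w \<cdot>\<^bsub>V\<^esub> p"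
    by (rule fibre_productE[of "f \<cdot>\<^bsub>V\<^esub> v" w Y T U]) (use F v w in simp_all)
  have "gen_prod V F f A A'
    = cycle_class V F X (v \<cdot>\<^bsub>V\<^esub> k, map (pb F k) Ls @ map (pb F p) Ms)"
    using gen_prod_class[OF k(1), of Y Ls Ms] F v w by simp
  moreover have "v \<cdot>\<^bsub>V\<^esub> k \<in> C"
    using C_base_change[OF w(6) base.fibre_square_transpose[OF k(1)]] v k by - (rule C_comp; simp)
  moreover have "(g \<cdot>\<^bsub>V\<^esub> f) \<cdot>\<^bsub>V\<^esub> (v \<cdot>\<^bsub>V\<^esub> k) \<in> S"
  proof -
    have "(g \<cdot>\<^bsub>V\<^esub> w) \<cdot>\<^bsub>V\<^esub> p \<in> S"
      using S_base_change[OF v(7) k(1)] w k F by - (rule S_comp; simp)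
    then show ?thesis using F v w k by simp
  qed
  ultimately show ?thesis using F v w k by (simp add: OM_gensI)
qed

lemma one_closed_gen:
  assumes "X \<in> Obj V"
  shows "cycle_class V F X (Ide V X, []) \<in> OM_gens V F C S (Ide V X)"
  using assms C_ide[OF assms] S_ide[OF assms] by (intro OM_gensI) simp_all

text \<open>Write \<open>P\<close> and \<open>Q\<close> for the fibre products of the first two and of the last two sources \<open>T, U\<close> and
  \<open>U, R\<close>. Both sides are represented by \<open>P \<times>\<^sub>U Q\<close>, once as \<open>P \<times>\<^sub>Z R\<close> and once as \<open>T \<times>\<^sub>Y Q\<close>.\<close>

lemma gen_prod_assoc:
  assumes fgh: "f \<in> hom_set V X Y" "g \<in> hom_set V Y Z" "h \<in> hom_set V Z W"
    and A: "A \<in> OM_gens V F C S f" and A': "A' \<in> OM_gens V F C S g" and A'': "A'' \<in> OM_gens V F C S h"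
  shows "gen_prod V F (g \<cdot>\<^bsub>V\<^esub> f) (gen_prod V F f A A') A''
    = gen_prod V F f A (gen_prod V F g A' A'')"
proof -
  have F: "f \<in> Arr V" "Dom V f = X" "Cod V f = Y" "g \<in> Arr V" "Dom V g = Y" "Cod V g = Z"
    "h \<in> Arr V" "Dom V h = Z" "Cod V h = W"
    using fgh by (simp_all add: hom_set_def)
  obtain v Ls T where v: "A = cycle_class V F X (v, Ls)" "v \<in> Arr V" "Dom V v = T" "Cod V v = X"
    "set Ls \<subseteq> fibre_objs F T"
    using OM_gensE[OF A F(2)] by metis
  obtain w Ms U where w: "A' = cycle_class V F Y (w, Ms)" "w \<in> Arr V" "Dom V w = U" "Cod V w = Y"
    "set Ms \<subseteq> fibre_objs F U"
    using OM_gensE[OF A' F(5)] by metis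
  obtain u Ns R where u: "A'' = cycle_class V F Z (u, Ns)" "u \<in> Arr V" "Dom V u = R" "Cod V u = Z"
    "set Ns \<subseteq> fibre_objs F R"
    using OM_gensE[OF A'' F(8)] by metis
  obtain k p P where k: "fibre_square V (f \<cdot>\<^bsub>V\<^esub> v) w k p" "k \<in> Arr V" "p \<in> Arr V" "Dom V k = P"
    "Dom V p = P" "Cod V k = T" "Cod V p = U" "(f \<cdot>\<^bsub>V\<^esub> v) \<cdot>\<^bsub>V\<^esub> k = w \<cdot>\<^bsub>V\<^esub> p"
    by (rule fibre_productE[of "f \<cdot>\<^bsub>V\<^esub> v" w Y T U]) (use F v w in simp_all)
  obtain l q Q where l: "fibre_square V (g \<cdot>\<^bsub>V\<^esub> w) u l q" "l \<in> Arr V" "q \<in> Arr V" "Dom V l = Q"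
    "Dom V q = Q" "Cod V l = U" "Cod V q = R" "(g \<cdot>\<^bsub>V\<^esub> w) \<cdot>\<^bsub>V\<^esub> l = u \<cdot>\<^bsub>V\<^esub> q"
    by (rule fibre_productE[of "g \<cdot>\<^bsub>V\<^esub> w" u Z U R]) (use F u w in simp_all)
  obtain m n M where m: "fibre_square V p l m n" "m \<in> Arr V" "n \<in> Arr V" "Dom V m = M"
    "Dom V n = M" "Cod V m = P" "Cod V n = Q" "p \<cdot>\<^bsub>V\<^esub> m = l \<cdot>\<^bsub>V\<^esub> n"
    using fibre_productE[OF k(3) l(2) k(7) l(6) k(5) l(4)] .
  have "fibre_square V ((g \<cdot>\<^bsub>V\<^esub> w) \<cdot>\<^bsub>V\<^esub> p) u m (q \<cdot>\<^bsub>V\<^esub> n)"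
    using base.fibre_square_vpaste[OF l(1) m(1)] .
  moreover have "(g \<cdot>\<^bsub>V\<^esub> w) \<cdot>\<^bsub>V\<^esub> p = (g \<cdot>\<^bsub>V\<^esub> f) \<cdot>\<^bsub>V\<^esub> (v \<cdot>\<^bsub>V\<^esub> k)"
    using F v w k by simp
  ultimately have L: "fibre_square V ((g \<cdot>\<^bsub>V\<^esub> f) \<cdot>\<^bsub>V\<^esub> (v \<cdot>\<^bsub>V\<^esub> k)) u m (q \<cdot>\<^bsub>V\<^esub> n)"
    by simp
  have R: "fibre_square V (f \<cdot>\<^bsub>V\<^esub> v) (w \<cdot>\<^bsub>V\<^esub> l) (k \<cdot>\<^bsub>V\<^esub> m) n"
    using base.fibre_square_hpaste[OF k(1) m(1)] .
  have "gen_prod V F f A A' = cycle_class V F X (v \<cdot>\<^bsub>V\<^esub> k, map (pb F k) Ls @ map (pb F p) Ms)"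
    using gen_prod_class[OF k(1), of Y Ls Ms] F v w by simp
  then have "gen_prod V F (g \<cdot>\<^bsub>V\<^esub> f) (gen_prod V F f A A') A'' = cycle_class V F X
      ((v \<cdot>\<^bsub>V\<^esub> k) \<cdot>\<^bsub>V\<^esub> m, map (pb F m) (map (pb F k) Ls @ map (pb F p) Ms) @ map (pb F (q \<cdot>\<^bsub>V\<^esub> n)) Ns)"
    using gen_prod_class[OF L, of Z "map (pb F k) Ls @ map (pb F p) Ms" Ns] F v w u k by simp
  also have "\<dots> = cycle_class V F X (v \<cdot>\<^bsub>V\<^esub> (k \<cdot>\<^bsub>V\<^esub> m),
      map (pb F (k \<cdot>\<^bsub>V\<^esub> m)) Ls @ map (pb F n) (map (pb F l) Ms @ map (pb F q) Ns))"
    by (rule cycle_class_cong)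
      (use v w u k l m in \<open>simp_all add: fibre_classes_pb_comp del: map_map\<close>)
  also have "\<dots> = gen_prod V F f A (gen_prod V F g A' A'')"
    using gen_prod_class[OF R, of Y Ls "map (pb F l) Ms @ map (pb F q) Ns"]
      gen_prod_class[OF l(1), of Z Ms Ns] F v w u l by simp
  finally show ?thesis .
qed

lemma gen_push_ide:
  assumes f: "f \<in> hom_set V X Y" and A: "A \<in> OM_gens V F C S f"
  shows "gen_push V F (Ide V X) A = A"
proof -
  have F: "f \<in> Arr V" "Dom V f = X" "X \<in> Obj V" using f by (auto simp: hom_set_def)
  obtain h Ls T where h: "A = cycle_class V F X (h, Ls)" "h \<in> Arr V" "Dom V h = T" "Cod V h = X"
    "set Ls \<subseteq> fibre_objs F T"
    using OM_gensE[OF A F(2)] by metis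
  then show ?thesis using gen_push_class[of "Ide V X" h Ls] F by simp
qed

lemma gen_push_comp:
  assumes fgh: "f \<in> hom_set V X Y" "g \<in> hom_set V Y Z" "h \<in> hom_set V Z W"
    and A: "A \<in> OM_gens V F C S (h \<cdot>\<^bsub>V\<^esub> (g \<cdot>\<^bsub>V\<^esub> f))"
  shows "gen_push V F (g \<cdot>\<^bsub>V\<^esub> f) A = gen_push V F g (gen_push V F f A)"
proof -
  have F: "f \<in> Arr V" "Dom V f = X" "Cod V f = Y" "g \<in> Arr V" "Dom V g = Y" "Cod V g = Z"
    "h \<in> Arr V" "Dom V h = Z" "Cod V h = W" "Dom V (h \<cdot>\<^bsub>V\<^esub> (g \<cdot>\<^bsub>V\<^esub> f)) = X"
    using fgh by (simp_all add: hom_set_def)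
  obtain v Ls T where v: "A = cycle_class V F X (v, Ls)" "v \<in> Arr V" "Dom V v = T" "Cod V v = X"
    "set Ls \<subseteq> fibre_objs F T"
    using OM_gensE[OF A F(10)] by metis
  have "gen_push V F (g \<cdot>\<^bsub>V\<^esub> f) A = cycle_class V F Z (g \<cdot>\<^bsub>V\<^esub> (f \<cdot>\<^bsub>V\<^esub> v), Ls)"
    using gen_push_class[of "g \<cdot>\<^bsub>V\<^esub> f" v Ls] F v by simp
  also have "\<dots> = gen_push V F g (gen_push V F f A)"
    using gen_push_class[of f v Ls] gen_push_class[of g "f \<cdot>\<^bsub>V\<^esub> v" Ls] F v by simp
  finally show ?thesis .
qed

lemma gen_pull_ide:
  assumes f: "f \<in> hom_set V X Y" and A: "A \<in> OM_gens V F C S f"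
  shows "gen_pull V F (Ide V X) A = A"
proof -
  have F: "f \<in> Arr V" "Dom V f = X" "X \<in> Obj V" using f by (auto simp: hom_set_def)
  obtain h Ls T where h: "A = cycle_class V F X (h, Ls)" "h \<in> Arr V" "Dom V h = T" "Cod V h = X"
    "set Ls \<subseteq> fibre_objs F T"
    using OM_gensE[OF A F(2)] by metis
  have T: "T \<in> Obj V" using h by auto
  have "gen_pull V F (Ide V X) A = cycle_class V F X (h, map (pb F (Ide V T)) Ls)"
    using gen_pull_class[OF base.fibre_square_ide(1)[OF h(2,3,4)], of Ls] F h by simp
  also have "\<dots> = A"
    unfolding h(1) using h T by (intro cycle_class_cong) (simp_all add: fibre_classes_pb_ide)
  finally show ?thesis .
qed

lemma gen_pull_comp:
  assumes S: "fibre_square V f g g' f'" and S': "fibre_square V f' h h' f''"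
    and A: "A \<in> OM_gens V F C S f"
  shows "gen_pull V F (g' \<cdot>\<^bsub>V\<^esub> h') A = gen_pull V F h' (gen_pull V F g' A)"
proof -
  define X X' X'' where "X = Dom V f" and "X' = Dom V g'" and "X'' = Dom V h'"
  have F: "Dom V f = X" "g' \<in> Arr V" "Dom V g' = X'" "Cod V g' = X"
    "h' \<in> Arr V" "Dom V h' = X''" "Cod V h' = X'"
    using base.fibre_squareD[OF S] base.fibre_squareD[OF S']
    unfolding X_def X'_def X''_def by simp_all
  obtain v Ls T where v: "A = cycle_class V F X (v, Ls)" "v \<in> Arr V" "Dom V v = T" "Cod V v = X"
    "set Ls \<subseteq> fibre_objs F T"
    using OM_gensE[OF A F(1)] by metis
  obtain a v' T' where a: "fibre_square V v g' a v'" "a \<in> Arr V" "v' \<in> Arr V" "Dom V a = T'"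
    "Dom V v' = T'" "Cod V a = T" "Cod V v' = X'"
    using fibre_productE[OF v(2) F(2) v(4) F(4) v(3) F(3)] .
  obtain b v'' T'' where b: "fibre_square V v' h' b v''" "b \<in> Arr V" "v'' \<in> Arr V"
    "Dom V b = T''" "Dom V v'' = T''" "Cod V b = T'" "Cod V v'' = X''"
    using fibre_productE[OF a(3) F(5) a(7) F(7) a(5) F(6)] .
  have "gen_pull V F (g' \<cdot>\<^bsub>V\<^esub> h') A = cycle_class V F X'' (v'', map (pb F (a \<cdot>\<^bsub>V\<^esub> b)) Ls)"
    using gen_pull_class[OF base.fibre_square_hpaste[OF a(1) b(1)], of Ls] F v by simp
  also have "\<dots> = cycle_class V F X'' (v'', map (pb F b) (map (pb F a) Ls))"
    by (rule cycle_class_cong) (use v a b in \<open>simp_all add: fibre_classes_pb_comp del: map_map\<close>)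
  also have "\<dots> = gen_pull V F h' (gen_pull V F g' A)"
    using gen_pull_class[OF a(1), of Ls] gen_pull_class[OF b(1), of "map (pb F a) Ls"] F v a
    by (simp del: map_map)
  finally show ?thesis .
qed

lemma gen_push_prod:
  assumes fgh: "f \<in> hom_set V X Y" "g \<in> hom_set V Y Z" "h \<in> hom_set V Z W"
    and A: "A \<in> OM_gens V F C S (g \<cdot>\<^bsub>V\<^esub> f)" and A': "A' \<in> OM_gens V F C S h"
  shows "gen_push V F f (gen_prod V F (g \<cdot>\<^bsub>V\<^esub> f) A A') = gen_prod V F g (gen_push V F f A) A'"
proof -
  have F: "f \<in> Arr V" "Dom V f = X" "Cod V f = Y" "g \<in> Arr V" "Dom V g = Y" "Cod V g = Z"
    "h \<in> Arr V" "Dom V h = Z" "Cod V h = W" "Dom V (g \<cdot>\<^bsub>V\<^esub> f) = X"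
    using fgh by (simp_all add: hom_set_def)
  obtain v Ls T where v: "A = cycle_class V F X (v, Ls)" "v \<in> Arr V" "Dom V v = T" "Cod V v = X"
    "set Ls \<subseteq> fibre_objs F T"
    using OM_gensE[OF A F(10)] by metis
  obtain w Ms U where w: "A' = cycle_class V F Z (w, Ms)" "w \<in> Arr V" "Dom V w = U" "Cod V w = Z"
    "set Ms \<subseteq> fibre_objs F U"
    using OM_gensE[OF A' F(8)] by metis
  obtain k p P where k: "fibre_square V ((g \<cdot>\<^bsub>V\<^esub> f) \<cdot>\<^bsub>V\<^esub> v) w k p" "k \<in> Arr V" "p \<in> Arr V"
    "Dom V k = P" "Dom V p = P" "Cod V k = T" "Cod V p = U"
    by (rule fibre_productE[of "(g \<cdot>\<^bsub>V\<^esub> f) \<cdot>\<^bsub>V\<^esub> v" w Z T U]) (use F v w in simp_all)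
  have k': "fibre_square V (g \<cdot>\<^bsub>V\<^esub> (f \<cdot>\<^bsub>V\<^esub> v)) w k p" using k(1) F v by simp
  have "gen_prod V F (g \<cdot>\<^bsub>V\<^esub> f) A A' = cycle_class V F X (v \<cdot>\<^bsub>V\<^esub> k, map (pb F k) Ls @ map (pb F p) Ms)"
    using gen_prod_class[OF k(1), of Z Ls Ms] F v w by simp
  then have "gen_push V F f (gen_prod V F (g \<cdot>\<^bsub>V\<^esub> f) A A')
      = cycle_class V F Y ((f \<cdot>\<^bsub>V\<^esub> v) \<cdot>\<^bsub>V\<^esub> k, map (pb F k) Ls @ map (pb F p) Ms)"
    using gen_push_class[of f "v \<cdot>\<^bsub>V\<^esub> k" "map (pb F k) Ls @ map (pb F p) Ms"] F v w k by simp
  also have "\<dots> = gen_prod V F g (gen_push V F f A) A'"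
    using gen_prod_class[OF k', of Z Ls Ms] gen_push_class[of f v Ls] F v w by simp
  finally show ?thesis .
qed

text \<open>Let \<open>T\<close>, \<open>U\<close> be the sources of the two cycles and \<open>T' = T \<times>\<^sub>X X'\<close>, \<open>U' = U \<times>\<^sub>Y Y'\<close>,
  \<open>P = T \<times>\<^sub>Y U\<close>. The pullback of the product has source \<open>P' = P \<times>\<^sub>T T'\<close>. Pasting exhibits \<open>P'\<close> as a
  fibre product of \<open>T'\<close> and \<open>U\<close> over \<open>Y\<close>; as \<open>T'\<close> maps to \<open>Y\<close> through \<open>Y'\<close>, cancelling the square of
  \<open>U'\<close> leaves \<open>P' = T' \<times>\<^bsub>Y'\<^esub> U'\<close>.\<close>

lemma gen_pull_prod:
  assumes S1: "fibre_square V g h h' g'" and S2: "fibre_square V f h' h'' f'"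
    and A: "A \<in> OM_gens V F C S f" and A': "A' \<in> OM_gens V F C S g"
  shows "gen_pull V F h'' (gen_prod V F f A A')
    = gen_prod V F f' (gen_pull V F h'' A) (gen_pull V F h' A')"
proof -
  define X Y X' Y' where "X = Dom V f" and "Y = Dom V g" and "X' = Dom V h''" and "Y' = Dom V h'"
  have F: "f \<in> Arr V" "Dom V f = X" "Cod V f = Y" "Dom V g = Y"
    "h' \<in> Arr V" "Dom V h' = Y'" "Cod V h' = Y" "h'' \<in> Arr V" "Dom V h'' = X'" "Cod V h'' = X"
    "f' \<in> Arr V" "Dom V f' = X'" "Cod V f' = Y'" "f \<cdot>\<^bsub>V\<^esub> h'' = h' \<cdot>\<^bsub>V\<^esub> f'"
    using base.fibre_squareD[OF S1] base.fibre_squareD[OF S2]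
    unfolding X_def Y_def X'_def Y'_def by simp_all
  obtain v Ls T where v: "A = cycle_class V F X (v, Ls)" "v \<in> Arr V" "Dom V v = T" "Cod V v = X"
    "set Ls \<subseteq> fibre_objs F T"
    using OM_gensE[OF A F(2)] by metis
  obtain w Ms U where w: "A' = cycle_class V F Y (w, Ms)" "w \<in> Arr V" "Dom V w = U" "Cod V w = Y"
    "set Ms \<subseteq> fibre_objs F U"
    using OM_gensE[OF A' F(4)] by metis
  obtain a v' T' where a: "fibre_square V v h'' a v'" "a \<in> Arr V" "v' \<in> Arr V" "Dom V a = T'"
    "Dom V v' = T'" "Cod V a = T" "Cod V v' = X'" "v \<cdot>\<^bsub>V\<^esub> a = h'' \<cdot>\<^bsub>V\<^esub> v'"
    using fibre_productE[OF v(2) F(8) v(4) F(10) v(3) F(9)] .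
  obtain b w' U' where b: "fibre_square V w h' b w'" "b \<in> Arr V" "w' \<in> Arr V" "Dom V b = U'"
    "Dom V w' = U'" "Cod V b = U" "Cod V w' = Y'"
    using fibre_productE[OF w(2) F(5) w(4) F(7) w(3) F(6)] .
  obtain k p P where k: "fibre_square V (f \<cdot>\<^bsub>V\<^esub> v) w k p" "k \<in> Arr V" "p \<in> Arr V" "Dom V k = P"
    "Dom V p = P" "Cod V k = T" "Cod V p = U" "(f \<cdot>\<^bsub>V\<^esub> v) \<cdot>\<^bsub>V\<^esub> k = w \<cdot>\<^bsub>V\<^esub> p"
    by (rule fibre_productE[of "f \<cdot>\<^bsub>V\<^esub> v" w Y T U]) (use F v w in simp_all)
  obtain e c P' where e: "fibre_square V k a e c" "e \<in> Arr V" "c \<in> Arr V" "Dom V e = P'"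
    "Dom V c = P'" "Cod V e = P" "Cod V c = T'" "k \<cdot>\<^bsub>V\<^esub> e = a \<cdot>\<^bsub>V\<^esub> c"
    using fibre_productE[OF k(2) a(2) k(6) a(6) k(4) a(4)] .
  have L: "fibre_square V (v \<cdot>\<^bsub>V\<^esub> k) h'' e (v' \<cdot>\<^bsub>V\<^esub> c)"
    using base.fibre_square_vpaste[OF a(1) e(1)] .
  have "fibre_square V w ((f \<cdot>\<^bsub>V\<^esub> v) \<cdot>\<^bsub>V\<^esub> a) (p \<cdot>\<^bsub>V\<^esub> e) c"
    using base.fibre_square_hpaste base.fibre_square_transpose k(1) e(1) by blast
  moreover have "(f \<cdot>\<^bsub>V\<^esub> v) \<cdot>\<^bsub>V\<^esub> a = h' \<cdot>\<^bsub>V\<^esub> (f' \<cdot>\<^bsub>V\<^esub> v')"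
    using base.fibre_square_comp[OF S2, of v'] a v F by simp
  ultimately have "fibre_square V w (h' \<cdot>\<^bsub>V\<^esub> (f' \<cdot>\<^bsub>V\<^esub> v')) (p \<cdot>\<^bsub>V\<^esub> e) c" by simp
  \<comment> \<open>The map \<open>P' \<rightarrow> U'\<close> comes from cancelling the square of \<open>U'\<close>.\<close>
  then obtain q where q: "fibre_square V w' (f' \<cdot>\<^bsub>V\<^esub> v') q c" "b \<cdot>\<^bsub>V\<^esub> q = p \<cdot>\<^bsub>V\<^esub> e"
    using base.fibre_square_hcancel[OF b(1)] a F by (metis base.comp_simps(1,3))
  have R: "fibre_square V (f' \<cdot>\<^bsub>V\<^esub> v') w' c q"
    using base.fibre_square_transpose[OF q(1)] .
  have q': "q \<in> Arr V" "Dom V q = P'" "Cod V q = U'"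
    using base.fibre_squareD[OF R] e b by simp_all
  have "gen_prod V F f A A' = cycle_class V F X (v \<cdot>\<^bsub>V\<^esub> k, map (pb F k) Ls @ map (pb F p) Ms)"
    using gen_prod_class[OF k(1), of Y Ls Ms] F v w by simp
  then have "gen_pull V F h'' (gen_prod V F f A A')
    = cycle_class V F X' (v' \<cdot>\<^bsub>V\<^esub> c, map (pb F e) (map (pb F k) Ls @ map (pb F p) Ms))"
    using gen_pull_class[OF L, of "map (pb F k) Ls @ map (pb F p) Ms"] F v w k by simp
  also have "\<dots> = cycle_class V F X' (v' \<cdot>\<^bsub>V\<^esub> c,
      map (pb F c) (map (pb F a) Ls) @ map (pb F q) (map (pb F b) Ms))"
    by (rule cycle_class_cong)
      (use v w a b k e q(2) q' in \<open>simp_all add: fibre_classes_pb_comp del: map_map\<close>)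
  also have "\<dots> = gen_prod V F f' (gen_pull V F h'' A) (gen_pull V F h' A')"
    using gen_pull_class[OF a(1), of Ls] gen_pull_class[OF b(1), of Ms]
      gen_prod_class[OF R, of Y' "map (pb F a) Ls" "map (pb F b) Ms"] F v w a b
    by (simp del: map_map)
  finally show ?thesis .
qed

lemma gen_pull_push:
  assumes S1: "fibre_square V g h h' g'" and S2: "fibre_square V f h' h'' f'"
    and A: "A \<in> OM_gens V F C S (g \<cdot>\<^bsub>V\<^esub> f)"
  shows "gen_push V F f' (gen_pull V F h'' A) = gen_pull V F h' (gen_push V F f A)"
proof -
  define X Y X' Y' where "X = Dom V f" and "Y = Dom V g" and "X' = Dom V h''" and "Y' = Dom V h'"
  have F: "f \<in> Arr V" "Dom V f = X" "Cod V f = Y" "g \<in> Arr V" "Dom V g = Y"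
    "h' \<in> Arr V" "Dom V h' = Y'" "Cod V h' = Y" "h'' \<in> Arr V" "Dom V h'' = X'" "Cod V h'' = X"
    "f' \<in> Arr V" "Dom V f' = X'" "Cod V f' = Y'"
    using base.fibre_squareD[OF S1] base.fibre_squareD[OF S2]
    unfolding X_def Y_def X'_def Y'_def by simp_all
  have gf: "Dom V (g \<cdot>\<^bsub>V\<^esub> f) = X" using F by simp
  obtain v Ls T where v: "A = cycle_class V F X (v, Ls)" "v \<in> Arr V" "Dom V v = T" "Cod V v = X"
    "set Ls \<subseteq> fibre_objs F T"
    using OM_gensE[OF A gf] by metis
  obtain a v' T' where a: "fibre_square V v h'' a v'" "a \<in> Arr V" "v' \<in> Arr V" "Dom V a = T'"
    "Dom V v' = T'" "Cod V a = T" "Cod V v' = X'"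
    using fibre_productE[OF v(2) F(9) v(4) F(11) v(3) F(10)] .
  have "gen_push V F f' (gen_pull V F h'' A) = cycle_class V F Y' (f' \<cdot>\<^bsub>V\<^esub> v', map (pb F a) Ls)"
    using gen_pull_class[OF a(1), of Ls] gen_push_class[of f' v' "map (pb F a) Ls"] F v a by simp
  also have "\<dots> = gen_pull V F h' (gen_push V F f A)"
    using gen_pull_class[OF base.fibre_square_vpaste[OF S2 a(1)], of Ls] gen_push_class[of f v Ls]
      F v by simp
  finally show ?thesis .
qed

text \<open>Projection formula: the source \<open>(T \<times>\<^sub>X X') \<times>\<^bsub>Y'\<^esub> U\<close> of the left side is \<open>T \<times>\<^sub>Y U\<close> by horizontal
  pasting, where \<open>U\<close> maps to \<open>Y\<close> through \<open>g\<close>.\<close>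

lemma gen_projection:
  assumes S1: "fibre_square V f g g' f'" and h: "h \<in> hom_set V (Cod V g) Z"
    and A: "A \<in> OM_gens V F C S f" and A': "A' \<in> OM_gens V F C S (h \<cdot>\<^bsub>V\<^esub> g)"
  shows "gen_push V F g' (gen_prod V F f' (gen_pull V F g' A) A')
    = gen_prod V F f A (gen_push V F g A')"
proof -
  define X Y X' Y' where "X = Dom V f" and "Y = Cod V f" and "X' = Dom V g'" and "Y' = Dom V g"
  have F: "f \<in> Arr V" "Dom V f = X" "Cod V f = Y" "g \<in> Arr V" "Dom V g = Y'" "Cod V g = Y"
    "g' \<in> Arr V" "Dom V g' = X'" "Cod V g' = X" "f' \<in> Arr V" "Dom V f' = X'" "Cod V f' = Y'"
    using base.fibre_squareD[OF S1] unfolding X_def Y_def X'_def Y'_def by simp_all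
  have h': "h \<in> Arr V" "Dom V h = Y" using h F by (simp_all add: hom_set_def)
  have hg: "Dom V (h \<cdot>\<^bsub>V\<^esub> g) = Y'" using F h' by simp
  obtain v Ls T where v: "A = cycle_class V F X (v, Ls)" "v \<in> Arr V" "Dom V v = T" "Cod V v = X"
    "set Ls \<subseteq> fibre_objs F T"
    using OM_gensE[OF A F(2)] by metis
  obtain w Ms U where w: "A' = cycle_class V F Y' (w, Ms)" "w \<in> Arr V" "Dom V w = U"
    "Cod V w = Y'" "set Ms \<subseteq> fibre_objs F U"
    using OM_gensE[OF A' hg] by metis
  obtain a v' T' where a: "fibre_square V v g' a v'" "a \<in> Arr V" "v' \<in> Arr V" "Dom V a = T'"
    "Dom V v' = T'" "Cod V a = T" "Cod V v' = X'" "v \<cdot>\<^bsub>V\<^esub> a = g' \<cdot>\<^bsub>V\<^esub> v'"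
    using fibre_productE[OF v(2) F(7) v(4) F(9) v(3) F(8)] .
  obtain c q P where c: "fibre_square V (f' \<cdot>\<^bsub>V\<^esub> v') w c q" "c \<in> Arr V" "q \<in> Arr V" "Dom V c = P"
    "Dom V q = P" "Cod V c = T'" "Cod V q = U"
    by (rule fibre_productE[of "f' \<cdot>\<^bsub>V\<^esub> v'" w Y' T' U]) (use F a w in simp_all)
  have R: "fibre_square V (f \<cdot>\<^bsub>V\<^esub> v) (g \<cdot>\<^bsub>V\<^esub> w) (a \<cdot>\<^bsub>V\<^esub> c) q"
    using base.fibre_square_hpaste[OF base.fibre_square_vpaste[OF S1 a(1)] c(1)] .
  have vac: "g' \<cdot>\<^bsub>V\<^esub> (v' \<cdot>\<^bsub>V\<^esub> c) = v \<cdot>\<^bsub>V\<^esub> (a \<cdot>\<^bsub>V\<^esub> c)"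
    using base.fibre_square_comp[OF a(1), of c] c a by simp
  have "gen_prod V F f' (gen_pull V F g' A) A'
    = cycle_class V F X' (v' \<cdot>\<^bsub>V\<^esub> c, map (pb F c) (map (pb F a) Ls) @ map (pb F q) Ms)"
    using gen_pull_class[OF a(1), of Ls] gen_prod_class[OF c(1), of Y' "map (pb F a) Ls" Ms] F v w a
    by (simp del: map_map)
  then have "gen_push V F g' (gen_prod V F f' (gen_pull V F g' A) A')
    = cycle_class V F X (v \<cdot>\<^bsub>V\<^esub> (a \<cdot>\<^bsub>V\<^esub> c), map (pb F c) (map (pb F a) Ls) @ map (pb F q) Ms)"
    using gen_push_class[of g' "v' \<cdot>\<^bsub>V\<^esub> c" "map (pb F c) (map (pb F a) Ls) @ map (pb F q) Ms"]
      F v w a c vac by (simp del: map_map)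
  also have "\<dots> = cycle_class V F X (v \<cdot>\<^bsub>V\<^esub> (a \<cdot>\<^bsub>V\<^esub> c),
      map (pb F (a \<cdot>\<^bsub>V\<^esub> c)) Ls @ map (pb F q) Ms)"
    by (rule cycle_class_cong)
      (use v w a(2-7) c in \<open>simp_all add: fibre_classes_pb_comp del: map_map\<close>)
  also have "\<dots> = gen_prod V F f A (gen_push V F g A')"
    using gen_push_class[of g w Ms] gen_prod_class[OF R, of Y Ls Ms] F v w by simp
  finally show ?thesis .
qed

lemma gen_prod_one_right:
  assumes f: "f \<in> hom_set V X Y" and A: "A \<in> OM_gens V F C S f"
  shows "gen_prod V F f A (cycle_class V F Y (Ide V Y, [])) = A"
proof -
  have F: "f \<in> Arr V" "Dom V f = X" "Cod V f = Y" using f by (simp_all add: hom_set_def)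
  have Y: "Y \<in> Obj V" using F by auto
  obtain v Ls T where v: "A = cycle_class V F X (v, Ls)" "v \<in> Arr V" "Dom V v = T" "Cod V v = X"
    "set Ls \<subseteq> fibre_objs F T"
    using OM_gensE[OF A F(2)] by metis
  have T: "T \<in> Obj V" using v by auto
  have R: "fibre_square V (f \<cdot>\<^bsub>V\<^esub> v) (Ide V Y) (Ide V T) (f \<cdot>\<^bsub>V\<^esub> v)"
    using F v by (intro base.fibre_square_ide) simp_all
  have "gen_prod V F f A (cycle_class V F Y (Ide V Y, []))
    = cycle_class V F X (v \<cdot>\<^bsub>V\<^esub> Ide V T, map (pb F (Ide V T)) Ls)"
    using gen_prod_class[OF R, of Y Ls "[]"] F v by simp
  also have "\<dots> = A"
    unfolding v(1) by (rule cycle_class_cong) (use v T in \<open>simp_all add: fibre_classes_pb_ide\<close>)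
  finally show ?thesis .
qed

lemma gen_prod_one_left:
  assumes f: "f \<in> hom_set V X Y" and A: "A \<in> OM_gens V F C S f"
  shows "gen_prod V F (Ide V X) (cycle_class V F X (Ide V X, [])) A = A"
proof -
  have F: "f \<in> Arr V" "Dom V f = X" "Cod V f = Y" using f by (simp_all add: hom_set_def)
  have X: "X \<in> Obj V" using F by auto
  obtain v Ls T where v: "A = cycle_class V F X (v, Ls)" "v \<in> Arr V" "Dom V v = T" "Cod V v = X"
    "set Ls \<subseteq> fibre_objs F T"
    using OM_gensE[OF A F(2)] by metis
  have T: "T \<in> Obj V" using v by auto
  have R: "fibre_square V (Ide V X \<cdot>\<^bsub>V\<^esub> Ide V X) v v (Ide V T)"
    using base.fibre_square_ide(2)[OF v(2,3,4)] X by simp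
  have "gen_prod V F (Ide V X) (cycle_class V F X (Ide V X, [])) A
    = cycle_class V F X (Ide V X \<cdot>\<^bsub>V\<^esub> v, map (pb F (Ide V T)) Ls)"
    using gen_prod_class[OF R, of X "[]" Ls] X v by simp
  also have "\<dots> = A"
    unfolding v(1) by (rule cycle_class_cong) (use v T X in \<open>simp_all add: fibre_classes_pb_ide\<close>)
  finally show ?thesis .
qed

lemma gen_pull_one:
  assumes g: "g \<in> hom_set V X' X"
  shows "gen_pull V F g (cycle_class V F X (Ide V X, [])) = cycle_class V F X' (Ide V X', [])"
proof -
  have G: "g \<in> Arr V" "Dom V g = X'" "Cod V g = X" using g by (simp_all add: hom_set_def)
  show ?thesis
    using gen_pull_class[OF base.fibre_square_ide(2)[OF G], of "[]"] G by simp
qed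

text \<open>Both products are represented by \<open>T' \<times>\<^bsub>X'\<^esub> U'\<close>, where \<open>T'\<close> and \<open>U'\<close> are the pullbacks to
  \<open>X'\<close> of the sources of the two cycles.\<close>

lemma gen_prod_commute:
  assumes S1: "fibre_square V f g g' f'"
    and A: "A \<in> OM_gens V F C S f" and A': "A' \<in> OM_gens V F C S g"
  shows "gen_prod V F f' (gen_pull V F g' A) A' = gen_prod V F g' (gen_pull V F f' A') A"
proof -
  define X Y X' Y' where "X = Dom V f" and "Y = Cod V f" and "X' = Dom V g'" and "Y' = Dom V g"
  have F: "f \<in> Arr V" "Dom V f = X" "Cod V f = Y" "g \<in> Arr V" "Dom V g = Y'" "Cod V g = Y"
    "g' \<in> Arr V" "Dom V g' = X'" "Cod V g' = X" "f' \<in> Arr V" "Dom V f' = X'" "Cod V f' = Y'"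
    using base.fibre_squareD[OF S1] unfolding X_def Y_def X'_def Y'_def by simp_all
  obtain v Ls T where v: "A = cycle_class V F X (v, Ls)" "v \<in> Arr V" "Dom V v = T" "Cod V v = X"
    "set Ls \<subseteq> fibre_objs F T"
    using OM_gensE[OF A F(2)] by metis
  obtain w Ms U where w: "A' = cycle_class V F Y' (w, Ms)" "w \<in> Arr V" "Dom V w = U"
    "Cod V w = Y'" "set Ms \<subseteq> fibre_objs F U"
    using OM_gensE[OF A' F(5)] by metis
  obtain a v' T' where a: "fibre_square V v g' a v'" "a \<in> Arr V" "v' \<in> Arr V" "Dom V a = T'"
    "Dom V v' = T'" "Cod V a = T" "Cod V v' = X'"
    using fibre_productE[OF v(2) F(7) v(4) F(9) v(3) F(8)] .
  obtain b w' U' where b: "fibre_square V w f' b w'" "b \<in> Arr V" "w' \<in> Arr V" "Dom V b = U'"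
    "Dom V w' = U'" "Cod V b = U" "Cod V w' = X'"
    using fibre_productE[OF w(2) F(10) w(4) F(12) w(3) F(11)] .
  obtain c t P where c: "fibre_square V v' w' c t" "c \<in> Arr V" "t \<in> Arr V" "Dom V c = P"
    "Dom V t = P" "Cod V c = T'" "Cod V t = U'" "v' \<cdot>\<^bsub>V\<^esub> c = w' \<cdot>\<^bsub>V\<^esub> t"
    using fibre_productE[OF a(3) b(3) a(7) b(7) a(5) b(5)] .
  have L: "fibre_square V (f' \<cdot>\<^bsub>V\<^esub> v') w c (b \<cdot>\<^bsub>V\<^esub> t)"
    using base.fibre_square_vpaste[OF base.fibre_square_transpose[OF b(1)] c(1)] .
  have R: "fibre_square V (g' \<cdot>\<^bsub>V\<^esub> w') v t (a \<cdot>\<^bsub>V\<^esub> c)"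
    using base.fibre_square_vpaste[OF base.fibre_square_transpose[OF a(1)]
        base.fibre_square_transpose[OF c(1)]] .
  have "gen_prod V F f' (gen_pull V F g' A) A' = cycle_class V F X'
      (v' \<cdot>\<^bsub>V\<^esub> c, map (pb F c) (map (pb F a) Ls) @ map (pb F (b \<cdot>\<^bsub>V\<^esub> t)) Ms)"
    using gen_pull_class[OF a(1), of Ls] gen_prod_class[OF L, of Y' "map (pb F a) Ls" Ms] F v w a
    by (simp del: map_map)
  also have "\<dots> = cycle_class V F X'
      (w' \<cdot>\<^bsub>V\<^esub> t, map (pb F t) (map (pb F b) Ms) @ map (pb F (a \<cdot>\<^bsub>V\<^esub> c)) Ls)"
    by (rule cycle_class_cong)
      (use v w a b c in \<open>simp_all add: fibre_classes_pb_comp del: map_map\<close>)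
  also have "\<dots> = gen_prod V F g' (gen_pull V F f' A') A"
    using gen_pull_class[OF b(1), of Ms] gen_prod_class[OF R, of X "map (pb F b) Ms" Ls] F v w b
    by (simp del: map_map)
  finally show ?thesis .
qed

section \<open>The axioms of an orientation on classes\<close>

lemma gen_ori_cong:
  assumes f: "f \<in> hom_set V X Y" and L: "fibre_iso V F X L L'" and A: "A \<in> OM_gens V F C S f"
  shows "gen_ori V F f L A = gen_ori V F f L' A"
proof -
  have F: "f \<in> Arr V" "Dom V f = X" using f by (simp_all add: hom_set_def)
  have L': "L \<in> fibre_objs F X" "L' \<in> fibre_objs F X" using L by (auto simp: fibre_iso_def)
  obtain v Ls T where v: "A = cycle_class V F X (v, Ls)" "v \<in> Arr V" "Dom V v = T" "Cod V v = X"
    "set Ls \<subseteq> fibre_objs F T"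
    using OM_gensE[OF A F(2)] by metis
  have "fibre_iso V F T (pb F v L) (pb F v L')" using fibre_iso_pb[of v L L'] v L by simp
  then have "fibre_classes [pb F v L] = fibre_classes [pb F v L']"
    and "pb F v L \<in> fibre_objs F T" "pb F v L' \<in> fibre_objs F T"
    using fibre_classes_map_cong[of "[L]" T "pb F v" "\<lambda>_. pb F v L'"]
    by (auto simp: fibre_iso_def)
  then have "cycle_class V F X (v, Ls @ [pb F v L]) = cycle_class V F X (v, Ls @ [pb F v L'])"
    using v by (intro cycle_class_cong) simp_all
  then show ?thesis using gen_ori_class[of v f Ls] v L' F by simp
qed

lemma gen_ori_commute:
  assumes f: "f \<in> hom_set V X Y" and L: "L \<in> fibre_objs F X" "L' \<in> fibre_objs F X"
    and A: "A \<in> OM_gens V F C S f"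
  shows "gen_ori V F f L (gen_ori V F f L' A) = gen_ori V F f L' (gen_ori V F f L A)"
proof -
  have F: "f \<in> Arr V" "Dom V f = X" using f by (simp_all add: hom_set_def)
  obtain v Ls T where v: "A = cycle_class V F X (v, Ls)" "v \<in> Arr V" "Dom V v = T" "Cod V v = X"
    "set Ls \<subseteq> fibre_objs F T"
    using OM_gensE[OF A F(2)] by metis
  have p: "pb F v L \<in> fibre_objs F T" "pb F v L' \<in> fibre_objs F T"
    using pb_fibre_objs[of v L] pb_fibre_objs[of v L'] v L by simp_all
  have "cycle_class V F X (v, (Ls @ [pb F v L']) @ [pb F v L])
    = cycle_class V F X (v, (Ls @ [pb F v L]) @ [pb F v L'])"
    using v p by (intro cycle_class_cong) (simp_all add: fibre_classes_def)
  then show ?thesis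
    using gen_ori_class[of v f Ls] gen_ori_class[of v f "Ls @ [pb F v L']" L]
      gen_ori_class[of v f "Ls @ [pb F v L]" L'] v p L F by simp
qed

lemma gen_ori_prod_left:
  assumes fg: "f \<in> hom_set V X Y" "g \<in> hom_set V Y Z" and L: "L \<in> fibre_objs F X"
    and A: "A \<in> OM_gens V F C S f" and A': "A' \<in> OM_gens V F C S g"
  shows "gen_ori V F (g \<cdot>\<^bsub>V\<^esub> f) L (gen_prod V F f A A') = gen_prod V F f (gen_ori V F f L A) A'"
proof -
  have F: "f \<in> Arr V" "Dom V f = X" "Cod V f = Y" "g \<in> Arr V" "Dom V g = Y" "Cod V g = Z"
    using fg by (simp_all add: hom_set_def)
  obtain v Ls T where v: "A = cycle_class V F X (v, Ls)" "v \<in> Arr V" "Dom V v = T" "Cod V v = X"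
    "set Ls \<subseteq> fibre_objs F T"
    using OM_gensE[OF A F(2)] by metis
  obtain w Ms U where w: "A' = cycle_class V F Y (w, Ms)" "w \<in> Arr V" "Dom V w = U"
    "Cod V w = Y" "set Ms \<subseteq> fibre_objs F U"
    using OM_gensE[OF A' F(5)] by metis
  obtain k p P where k: "fibre_square V (f \<cdot>\<^bsub>V\<^esub> v) w k p" "k \<in> Arr V" "p \<in> Arr V" "Dom V k = P"
    "Dom V p = P" "Cod V k = T" "Cod V p = U"
    by (rule fibre_productE[of "f \<cdot>\<^bsub>V\<^esub> v" w Y T U]) (use F v w in simp_all)
  have vL: "pb F v L \<in> fibre_objs F T" using pb_fibre_objs[of v L] v L by simp
  have vkL: "pb F k (pb F v L) \<in> fibre_objs F P" "pb F (v \<cdot>\<^bsub>V\<^esub> k) L \<in> fibre_objs F P"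
    using pb_fibre_objs[of k "pb F v L"] pb_fibre_objs[of "v \<cdot>\<^bsub>V\<^esub> k" L] v k L vL by simp_all
  have c: "fibre_classes [pb F k (pb F v L)] = fibre_classes [pb F (v \<cdot>\<^bsub>V\<^esub> k) L]"
    using fibre_classes_pb_comp[of v k "[L]"] v k L by simp
  have "gen_ori V F (g \<cdot>\<^bsub>V\<^esub> f) L (gen_prod V F f A A') = cycle_class V F X
      (v \<cdot>\<^bsub>V\<^esub> k, (map (pb F k) Ls @ map (pb F p) Ms) @ [pb F (v \<cdot>\<^bsub>V\<^esub> k) L])"
    using gen_ori_class[of "v \<cdot>\<^bsub>V\<^esub> k" "g \<cdot>\<^bsub>V\<^esub> f" "map (pb F k) Ls @ map (pb F p) Ms" L]
      gen_prod_class[OF k(1), of Y Ls Ms] F v w k L by simp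
  also have "\<dots> = cycle_class V F X
      (v \<cdot>\<^bsub>V\<^esub> k, map (pb F k) (Ls @ [pb F v L]) @ map (pb F p) Ms)"
    by (rule cycle_class_cong) (use v w k vkL c in simp_all)
  also have "\<dots> = gen_prod V F f (gen_ori V F f L A) A'"
    using gen_ori_class[of v f Ls L] gen_prod_class[OF k(1), of Y "Ls @ [pb F v L]" Ms]
      F v w L vL by simp
  finally show ?thesis .
qed

lemma gen_ori_prod_right:
  assumes fg: "f \<in> hom_set V X Y" "g \<in> hom_set V Y Z" and M: "M \<in> fibre_objs F Y"
    and A: "A \<in> OM_gens V F C S f" and A': "A' \<in> OM_gens V F C S g"
  shows "gen_ori V F (g \<cdot>\<^bsub>V\<^esub> f) (pb F f M) (gen_prod V F f A A')
    = gen_prod V F f A (gen_ori V F g M A')"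
proof -
  have F: "f \<in> Arr V" "Dom V f = X" "Cod V f = Y" "g \<in> Arr V" "Dom V g = Y" "Cod V g = Z"
    using fg by (simp_all add: hom_set_def)
  obtain v Ls T where v: "A = cycle_class V F X (v, Ls)" "v \<in> Arr V" "Dom V v = T" "Cod V v = X"
    "set Ls \<subseteq> fibre_objs F T"
    using OM_gensE[OF A F(2)] by metis
  obtain w Ms U where w: "A' = cycle_class V F Y (w, Ms)" "w \<in> Arr V" "Dom V w = U"
    "Cod V w = Y" "set Ms \<subseteq> fibre_objs F U"
    using OM_gensE[OF A' F(5)] by metis
  obtain k p P where k: "fibre_square V (f \<cdot>\<^bsub>V\<^esub> v) w k p" "k \<in> Arr V" "p \<in> Arr V" "Dom V k = P"
    "Dom V p = P" "Cod V k = T" "Cod V p = U" "(f \<cdot>\<^bsub>V\<^esub> v) \<cdot>\<^bsub>V\<^esub> k = w \<cdot>\<^bsub>V\<^esub> p"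
    by (rule fibre_productE[of "f \<cdot>\<^bsub>V\<^esub> v" w Y T U]) (use F v w in simp_all)
  have fM: "pb F f M \<in> fibre_objs F X" and wM: "pb F w M \<in> fibre_objs F U"
    using pb_fibre_objs[of f M] pb_fibre_objs[of w M] F w M by simp_all
  have o: "pb F (v \<cdot>\<^bsub>V\<^esub> k) (pb F f M) \<in> fibre_objs F P" "pb F p (pb F w M) \<in> fibre_objs F P"
    using pb_fibre_objs[of "v \<cdot>\<^bsub>V\<^esub> k" "pb F f M"] pb_fibre_objs[of p "pb F w M"] v k fM wM
    by simp_all
  have "fibre_classes (map (pb F (v \<cdot>\<^bsub>V\<^esub> k)) (map (pb F f) [M]))
      = fibre_classes (map (pb F p) (map (pb F w) [M]))"
    using fibre_classes_pb_comp[of f "v \<cdot>\<^bsub>V\<^esub> k" "[M]"] fibre_classes_pb_comp[of w p "[M]"] F v w k M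
    by simp
  then have c: "fibre_classes [pb F (v \<cdot>\<^bsub>V\<^esub> k) (pb F f M)] = fibre_classes [pb F p (pb F w M)]"
    by simp
  have "gen_ori V F (g \<cdot>\<^bsub>V\<^esub> f) (pb F f M) (gen_prod V F f A A') = cycle_class V F X
      (v \<cdot>\<^bsub>V\<^esub> k, (map (pb F k) Ls @ map (pb F p) Ms) @ [pb F (v \<cdot>\<^bsub>V\<^esub> k) (pb F f M)])"
    using gen_ori_class[of "v \<cdot>\<^bsub>V\<^esub> k" "g \<cdot>\<^bsub>V\<^esub> f" "map (pb F k) Ls @ map (pb F p) Ms" "pb F f M"]
      gen_prod_class[OF k(1), of Y Ls Ms] F v w k fM by simp
  also have "\<dots> = cycle_class V F X
      (v \<cdot>\<^bsub>V\<^esub> k, map (pb F k) Ls @ map (pb F p) (Ms @ [pb F w M]))"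
    by (rule cycle_class_cong) (use v w k o c in simp_all)
  also have "\<dots> = gen_prod V F f A (gen_ori V F g M A')"
    using gen_ori_class[of w g Ms M] gen_prod_class[OF k(1), of Y Ls "Ms @ [pb F w M]"]
      F v w M wM by simp
  finally show ?thesis .
qed

lemma gen_ori_push:
  assumes fg: "f \<in> hom_set V X Y" "g \<in> hom_set V Y Z" and M: "M \<in> fibre_objs F Y"
    and A: "A \<in> OM_gens V F C S (g \<cdot>\<^bsub>V\<^esub> f)"
  shows "gen_push V F f (gen_ori V F (g \<cdot>\<^bsub>V\<^esub> f) (pb F f M) A) = gen_ori V F g M (gen_push V F f A)"
proof -
  have F: "f \<in> Arr V" "Dom V f = X" "Cod V f = Y" "g \<in> Arr V" "Dom V g = Y" "Cod V g = Z"
    "Dom V (g \<cdot>\<^bsub>V\<^esub> f) = X"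
    using fg by (simp_all add: hom_set_def)
  obtain v Ls T where v: "A = cycle_class V F X (v, Ls)" "v \<in> Arr V" "Dom V v = T" "Cod V v = X"
    "set Ls \<subseteq> fibre_objs F T"
    using OM_gensE[OF A F(7)] by metis
  have fM: "pb F f M \<in> fibre_objs F X" using pb_fibre_objs[of f M] F M by simp
  have o: "pb F v (pb F f M) \<in> fibre_objs F T" "pb F (f \<cdot>\<^bsub>V\<^esub> v) M \<in> fibre_objs F T"
    using pb_fibre_objs[of v "pb F f M"] pb_fibre_objs[of "f \<cdot>\<^bsub>V\<^esub> v" M] F v M fM by simp_all
  have c: "fibre_classes [pb F v (pb F f M)] = fibre_classes [pb F (f \<cdot>\<^bsub>V\<^esub> v) M]"
    using fibre_classes_pb_comp[of f v "[M]"] F v M by simp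
  have "gen_push V F f (gen_ori V F (g \<cdot>\<^bsub>V\<^esub> f) (pb F f M) A)
    = cycle_class V F Y (f \<cdot>\<^bsub>V\<^esub> v, Ls @ [pb F v (pb F f M)])"
    using gen_ori_class[of v "g \<cdot>\<^bsub>V\<^esub> f" Ls "pb F f M"]
      gen_push_class[of f v "Ls @ [pb F v (pb F f M)]"] F v fM o by simp
  also have "\<dots> = cycle_class V F Y (f \<cdot>\<^bsub>V\<^esub> v, Ls @ [pb F (f \<cdot>\<^bsub>V\<^esub> v) M])"
    by (rule cycle_class_cong) (use F v o c in simp_all)
  also have "\<dots> = gen_ori V F g M (gen_push V F f A)"
    using gen_ori_class[of "f \<cdot>\<^bsub>V\<^esub> v" g Ls M] gen_push_class[of f v Ls] F v M by simp
  finally show ?thesis .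
qed

lemma gen_ori_pull:
  assumes S1: "fibre_square V f g g' f'" and L: "L \<in> fibre_objs F (Dom V f)"
    and A: "A \<in> OM_gens V F C S f"
  shows "gen_pull V F g' (gen_ori V F f L A) = gen_ori V F f' (pb F g' L) (gen_pull V F g' A)"
proof -
  define X Y X' Y' where "X = Dom V f" and "Y = Cod V f" and "X' = Dom V g'" and "Y' = Dom V g"
  have F: "f \<in> Arr V" "Dom V f = X" "Cod V f = Y"
    "g' \<in> Arr V" "Dom V g' = X'" "Cod V g' = X" "f' \<in> Arr V" "Dom V f' = X'" "Cod V f' = Y'"
    using base.fibre_squareD[OF S1] unfolding X_def Y_def X'_def Y'_def by simp_all
  have L: "L \<in> fibre_objs F X" using L F by simp
  obtain v Ls T where v: "A = cycle_class V F X (v, Ls)" "v \<in> Arr V" "Dom V v = T" "Cod V v = X"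
    "set Ls \<subseteq> fibre_objs F T"
    using OM_gensE[OF A F(2)] by metis
  obtain a v' T' where a: "fibre_square V v g' a v'" "a \<in> Arr V" "v' \<in> Arr V" "Dom V a = T'"
    "Dom V v' = T'" "Cod V a = T" "Cod V v' = X'" "v \<cdot>\<^bsub>V\<^esub> a = g' \<cdot>\<^bsub>V\<^esub> v'"
    using fibre_productE[OF v(2) F(4) v(4) F(6) v(3) F(5)] .
  have o: "pb F v L \<in> fibre_objs F T" "pb F g' L \<in> fibre_objs F X'"
    using pb_fibre_objs[of v L] pb_fibre_objs[of g' L] F v L by simp_all
  have o': "pb F a (pb F v L) \<in> fibre_objs F T'" "pb F v' (pb F g' L) \<in> fibre_objs F T'"
    using pb_fibre_objs[of a "pb F v L"] pb_fibre_objs[of v' "pb F g' L"] a o by simp_all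
  have "fibre_classes (map (pb F a) (map (pb F v) [L]))
      = fibre_classes (map (pb F v') (map (pb F g') [L]))"
    using fibre_classes_pb_comp[of v a "[L]"] fibre_classes_pb_comp[of g' v' "[L]"] F v a L
    by simp
  then have c: "fibre_classes [pb F a (pb F v L)] = fibre_classes [pb F v' (pb F g' L)]" by simp
  have "gen_pull V F g' (gen_ori V F f L A)
    = cycle_class V F X' (v', map (pb F a) (Ls @ [pb F v L]))"
    using gen_ori_class[of v f Ls L] gen_pull_class[OF a(1), of "Ls @ [pb F v L]"] F v L o
    by simp
  also have "\<dots> = cycle_class V F X' (v', map (pb F a) Ls @ [pb F v' (pb F g' L)])"
    by (rule cycle_class_cong) (use v a o' c in simp_all)
  also have "\<dots> = gen_ori V F f' (pb F g' L) (gen_pull V F g' A)"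
    using gen_ori_class[of v' f' "map (pb F a) Ls" "pb F g' L"] gen_pull_class[OF a(1), of Ls]
      F v a o by simp
  finally show ?thesis .
qed

end


section \<open>Linear extension\<close>

lemma frag_extend_zero_fun: "frag_extend (\<lambda>A. 0) x = 0"
  by (simp add: frag_extend_eq_0)

lemma frag_extend_diff_fun:
  "frag_extend (\<lambda>A. b A - c A) x = frag_extend b x - frag_extend c x"
proof -
  have "Poly_Mapping.keys x \<subseteq> UNIV" by simp
  then show ?thesis
    by (induction x rule: frag_induction) (simp_all add: frag_extend_diff)
qed

lemma frag_extend_add_fun:
  "frag_extend (\<lambda>A. b A + c A) x = frag_extend b x + frag_extend c x"
  using frag_extend_diff_fun[of "\<lambda>A. b A + c A" c x] by (simp add: algebra_simps)

lemma keys_diff_subset: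
  "\<lbrakk>Poly_Mapping.keys a \<subseteq> G; Poly_Mapping.keys b \<subseteq> G\<rbrakk> \<Longrightarrow> Poly_Mapping.keys (a - b) \<subseteq> G"
  using keys_diff[of a b] by blast

lemma hom_free_Abelian_groupI:
  assumes add: "\<And>x y. P (x + y) = P x + P y" and diff: "\<And>x y. P (x - y) = P x - P y"
    and zero: "P 0 = 0"
    and gens: "\<And>A. A \<in> G \<Longrightarrow> Poly_Mapping.keys (P (frag_of A)) \<subseteq> H"
  shows "P \<in> hom (free_Abelian_group G) (free_Abelian_group H)"
proof (rule homI)
  fix x assume "x \<in> carrier (free_Abelian_group G)"
  then have "Poly_Mapping.keys x \<subseteq> G" by simp
  then have "Poly_Mapping.keys (P x) \<subseteq> H"
    by (induction x rule: frag_induction) (simp_all add: zero gens diff keys_diff_subset)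
  then show "P x \<in> carrier (free_Abelian_group H)" by simp
qed (use add in simp)

context bivariant_setting
begin

abbreviation "\<M> \<equiv> OM V F C S"

lemma Grp_OM [simp]: "Grp \<M> f = free_Abelian_group (OM_gens V F C S f)"
  by (simp add: OM_def)

lemma Bone_OM [simp]: "Bone \<M> X = frag_of (cycle_class V F X (Ide V X, []))"
  by (simp add: OM_def)

lemma Bprod_OM [simp]:
  "Bprod \<M> f g (frag_of A) (frag_of A') = frag_of (gen_prod V F f A A')"
  "Bprod \<M> f g 0 \<beta> = 0" "Bprod \<M> f g \<alpha> 0 = 0"
  "Bprod \<M> f g (\<alpha> - \<alpha>') \<beta> = Bprod \<M> f g \<alpha> \<beta> - Bprod \<M> f g \<alpha>' \<beta>"
  "Bprod \<M> f g (\<alpha> + \<alpha>') \<beta> = Bprod \<M> f g \<alpha> \<beta> + Bprod \<M> f g \<alpha>' \<beta>"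
  "Bprod \<M> f g \<alpha> (\<beta> - \<beta>') = Bprod \<M> f g \<alpha> \<beta> - Bprod \<M> f g \<alpha> \<beta>'"
  "Bprod \<M> f g \<alpha> (\<beta> + \<beta>') = Bprod \<M> f g \<alpha> \<beta> + Bprod \<M> f g \<alpha> \<beta>'"
  by (simp_all add: OM_def frag_extend_diff frag_extend_add frag_extend_zero_fun
      frag_extend_diff_fun frag_extend_add_fun)

lemma Push_OM [simp]:
  "Push \<M> f g (frag_of A) = frag_of (gen_push V F f A)"
  "Push \<M> f g 0 = 0"
  "Push \<M> f g (\<alpha> - \<alpha>') = Push \<M> f g \<alpha> - Push \<M> f g \<alpha>'"
  "Push \<M> f g (\<alpha> + \<alpha>') = Push \<M> f g \<alpha> + Push \<M> f g \<alpha>'"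
  by (simp_all add: OM_def frag_extend_diff frag_extend_add)

lemma Pull_OM [simp]:
  "Pull \<M> f g g' f' (frag_of A) = frag_of (gen_pull V F g' A)"
  "Pull \<M> f g g' f' 0 = 0"
  "Pull \<M> f g g' f' (\<alpha> - \<alpha>') = Pull \<M> f g g' f' \<alpha> - Pull \<M> f g g' f' \<alpha>'"
  "Pull \<M> f g g' f' (\<alpha> + \<alpha>') = Pull \<M> f g g' f' \<alpha> + Pull \<M> f g g' f' \<alpha>'"
  by (simp_all add: OM_def frag_extend_diff frag_extend_add)

lemma Ori_OM [simp]:
  "Ori \<M> f L (frag_of A) = frag_of (gen_ori V F f L A)"
  "Ori \<M> f L 0 = 0"
  "Ori \<M> f L (\<alpha> - \<alpha>') = Ori \<M> f L \<alpha> - Ori \<M> f L \<alpha>'"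
  "Ori \<M> f L (\<alpha> + \<alpha>') = Ori \<M> f L \<alpha> + Ori \<M> f L \<alpha>'"
  by (simp_all add: OM_def frag_extend_diff frag_extend_add)

lemma carrier_OM [simp]:
  "\<alpha> \<in> carrier (Grp \<M> f) \<longleftrightarrow> Poly_Mapping.keys \<alpha> \<subseteq> OM_gens V F C S f"
  by simp

lemma OM_induct1:
  assumes "\<alpha> \<in> carrier (Grp \<M> f)"
    and "P 0" "\<And>A. A \<in> OM_gens V F C S f \<Longrightarrow> P (frag_of A)"
    and "\<And>a b. \<lbrakk>P a; P b\<rbrakk> \<Longrightarrow> P (a - b)"
  shows "P \<alpha>"
  using assms(1)[unfolded carrier_OM] by (rule frag_induction) (use assms(2-) in blast)+

text \<open>An identity that is additive in two variables needs to be checked only on pairs of generators.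
  The groups are generated by differences, which is why subtraction occurs in the last two premises.\<close>

lemma OM_induct2:
  assumes a: "\<alpha> \<in> carrier (Grp \<M> f)" and b: "\<beta> \<in> carrier (Grp \<M> g)"
    and 0: "\<And>\<beta>. P 0 \<beta>" "\<And>\<alpha>. P \<alpha> 0"
    and of: "\<And>A A'. \<lbrakk>A \<in> OM_gens V F C S f; A' \<in> OM_gens V F C S g\<rbrakk>
      \<Longrightarrow> P (frag_of A) (frag_of A')"
    and diff: "\<And>a a' b. \<lbrakk>P a b; P a' b\<rbrakk> \<Longrightarrow> P (a - a') b"
      "\<And>a b b'. \<lbrakk>P a b; P a b'\<rbrakk> \<Longrightarrow> P a (b - b')"
  shows "P \<alpha> \<beta>"
  using a by (rule OM_induct1) (use 0 diff(1) OM_induct1[OF b, of "P (frag_of _)"] of diff(2) in blast)+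

theorem OM_oriented_bivariant_theory: "oriented_bivariant_theory V F C Ind \<M>"
proof (intro oriented_bivariant_theory.intro bivariant_theory.intro
    oriented_bivariant_theory_axioms.intro)
  fix f assume "f \<in> Arr V"
  show "comm_group (Grp \<M> f)" by (simp add: abelian_free_Abelian_group)
next
  fix f g X Y Z \<alpha>
  assume fg: "f \<in> hom_set V X Y" "g \<in> hom_set V Y Z" and \<alpha>: "\<alpha> \<in> carrier (Grp \<M> f)"
  have "Poly_Mapping.keys (Bprod \<M> f g \<alpha> (frag_of A')) \<subseteq> OM_gens V F C S (g \<cdot>\<^bsub>V\<^esub> f)"
    if "A' \<in> OM_gens V F C S g" for A'
    using \<alpha> by (rule OM_induct1)
      (simp_all add: gen_prod_closed[OF fg _ that] keys_diff_subset)
  then show "Bprod \<M> f g \<alpha> \<in> hom (Grp \<M> g) (Grp \<M> (g \<cdot>\<^bsub>V\<^esub> f))"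
    unfolding Grp_OM by (intro hom_free_Abelian_groupI) simp_all
next
  fix f g X Y Z \<beta>
  assume fg: "f \<in> hom_set V X Y" "g \<in> hom_set V Y Z" and \<beta>: "\<beta> \<in> carrier (Grp \<M> g)"
  have "Poly_Mapping.keys (Bprod \<M> f g (frag_of A) \<beta>) \<subseteq> OM_gens V F C S (g \<cdot>\<^bsub>V\<^esub> f)"
    if "A \<in> OM_gens V F C S f" for A
    using \<beta> by (rule OM_induct1)
      (simp_all add: gen_prod_closed[OF fg that] keys_diff_subset)
  then show "(\<lambda>\<alpha>. Bprod \<M> f g \<alpha> \<beta>) \<in> hom (Grp \<M> f) (Grp \<M> (g \<cdot>\<^bsub>V\<^esub> f))"
    unfolding Grp_OM by (intro hom_free_Abelian_groupI) simp_all
next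
  fix f g X Y Z
  assume "f \<in> hom_set V X Y" "g \<in> hom_set V Y Z" "f \<in> C"
  from gen_push_closed[OF this] show "Push \<M> f g \<in> hom (Grp \<M> (g \<cdot>\<^bsub>V\<^esub> f)) (Grp \<M> g)"
    unfolding Grp_OM by (intro hom_free_Abelian_groupI) simp_all
next
  fix f g g' f'
  assume "Ind f g g' f'"
  from gen_pull_closed[OF Ind_fibre_square[OF this]]
  show "Pull \<M> f g g' f' \<in> hom (Grp \<M> f) (Grp \<M> f')"
    unfolding Grp_OM by (intro hom_free_Abelian_groupI) simp_all
next
  fix f X Y L
  assume "f \<in> hom_set V X Y" "L \<in> fibre_objs F X"
  from gen_ori_closed[OF this] show "Ori \<M> f L \<in> hom (Grp \<M> f) (Grp \<M> f)"
    unfolding Grp_OM by (intro hom_free_Abelian_groupI) simp_all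
next
  fix X assume "X \<in> Obj V"
  then show "Bone \<M> X \<in> carrier (Grp \<M> (Ide V X))" using one_closed_gen by simp
next
  fix f g h X Y Z W \<alpha> \<beta> \<delta>
  assume fgh: "f \<in> hom_set V X Y" "g \<in> hom_set V Y Z" "h \<in> hom_set V Z W"
    and \<alpha>: "\<alpha> \<in> carrier (Grp \<M> f)" and \<beta>: "\<beta> \<in> carrier (Grp \<M> g)" and \<delta>: "\<delta> \<in> carrier (Grp \<M> h)"
  show "Bprod \<M> (g \<cdot>\<^bsub>V\<^esub> f) h (Bprod \<M> f g \<alpha> \<beta>) \<delta> = Bprod \<M> f (h \<cdot>\<^bsub>V\<^esub> g) \<alpha> (Bprod \<M> g h \<beta> \<delta>)"
    using \<alpha> \<beta>
  proof (rule OM_induct2)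
    fix A A' assume "A \<in> OM_gens V F C S f" "A' \<in> OM_gens V F C S g"
    then show "Bprod \<M> (g \<cdot>\<^bsub>V\<^esub> f) h (Bprod \<M> f g (frag_of A) (frag_of A')) \<delta>
      = Bprod \<M> f (h \<cdot>\<^bsub>V\<^esub> g) (frag_of A) (Bprod \<M> g h (frag_of A') \<delta>)"
      using OM_induct1[OF \<delta>, of "\<lambda>\<delta>. Bprod \<M> (g \<cdot>\<^bsub>V\<^esub> f) h (Bprod \<M> f g (frag_of A) (frag_of A')) \<delta>
        = Bprod \<M> f (h \<cdot>\<^bsub>V\<^esub> g) (frag_of A) (Bprod \<M> g h (frag_of A') \<delta>)"]
      by (simp add: gen_prod_assoc[OF fgh])
  qed simp_all
next
  fix f X Y \<alpha> assume f: "f \<in> hom_set V X Y" and \<alpha>: "\<alpha> \<in> carrier (Grp \<M> f)"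
  show "Push \<M> (Ide V X) f \<alpha> = \<alpha>"
    using \<alpha> by (rule OM_induct1) (simp_all add: gen_push_ide[OF f])
  show "Pull \<M> f (Ide V Y) (Ide V X) f \<alpha> = \<alpha>"
    using \<alpha> by (rule OM_induct1) (simp_all add: gen_pull_ide[OF f])
  show "Bprod \<M> f (Ide V Y) \<alpha> (Bone \<M> Y) = \<alpha>"
    using \<alpha> by (rule OM_induct1) (simp_all add: gen_prod_one_right[OF f])
  show "Bprod \<M> (Ide V X) f (Bone \<M> X) \<alpha> = \<alpha>"
    using \<alpha> by (rule OM_induct1) (simp_all add: gen_prod_one_left[OF f])
next
  fix f g h X Y Z W \<alpha>
  assume fgh: "f \<in> hom_set V X Y" "g \<in> hom_set V Y Z" "h \<in> hom_set V Z W"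
    and \<alpha>: "\<alpha> \<in> carrier (Grp \<M> (h \<cdot>\<^bsub>V\<^esub> (g \<cdot>\<^bsub>V\<^esub> f)))"
  show "Push \<M> (g \<cdot>\<^bsub>V\<^esub> f) h \<alpha> = Push \<M> g h (Push \<M> f (h \<cdot>\<^bsub>V\<^esub> g) \<alpha>)"
    using \<alpha> by (rule OM_induct1) (simp_all add: gen_push_comp[OF fgh])
next
  fix f g g' f' h h' f'' \<alpha>
  assume S: "Ind f g g' f'" "Ind f' h h' f''" and \<alpha>: "\<alpha> \<in> carrier (Grp \<M> f)"
  show "Pull \<M> f (g \<cdot>\<^bsub>V\<^esub> h) (g' \<cdot>\<^bsub>V\<^esub> h') f'' \<alpha> = Pull \<M> f' h h' f'' (Pull \<M> f g g' f' \<alpha>)"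
    using \<alpha> by (rule OM_induct1) (simp_all add: gen_pull_comp[OF S[THEN Ind_fibre_square]])
next
  fix f g h X Y Z W \<alpha> \<beta>
  assume fgh: "f \<in> hom_set V X Y" "g \<in> hom_set V Y Z" "h \<in> hom_set V Z W"
    and \<alpha>: "\<alpha> \<in> carrier (Grp \<M> (g \<cdot>\<^bsub>V\<^esub> f))" and \<beta>: "\<beta> \<in> carrier (Grp \<M> h)"
  show "Push \<M> f (h \<cdot>\<^bsub>V\<^esub> g) (Bprod \<M> (g \<cdot>\<^bsub>V\<^esub> f) h \<alpha> \<beta>) = Bprod \<M> g h (Push \<M> f g \<alpha>) \<beta>"
    using \<alpha> \<beta> by (rule OM_induct2) (simp_all add: gen_push_prod[OF fgh])
next
  fix f g h h' h'' g' f' \<alpha> \<beta>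
  assume S: "Ind g h h' g'" "Ind f h' h'' f'"
    and \<alpha>: "\<alpha> \<in> carrier (Grp \<M> f)" and \<beta>: "\<beta> \<in> carrier (Grp \<M> g)"
  show "Pull \<M> (g \<cdot>\<^bsub>V\<^esub> f) h h'' (g' \<cdot>\<^bsub>V\<^esub> f') (Bprod \<M> f g \<alpha> \<beta>)
    = Bprod \<M> f' g' (Pull \<M> f h' h'' f' \<alpha>) (Pull \<M> g h h' g' \<beta>)"
    using \<alpha> \<beta> by (rule OM_induct2) (simp_all add: gen_pull_prod[OF S[THEN Ind_fibre_square]])
next
  fix f g h h' h'' g' f' \<alpha>
  assume S: "Ind g h h' g'" "Ind f h' h'' f'" and \<alpha>: "\<alpha> \<in> carrier (Grp \<M> (g \<cdot>\<^bsub>V\<^esub> f))"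
  show "Push \<M> f' g' (Pull \<M> (g \<cdot>\<^bsub>V\<^esub> f) h h'' (g' \<cdot>\<^bsub>V\<^esub> f') \<alpha>) = Pull \<M> g h h' g' (Push \<M> f g \<alpha>)"
    using \<alpha> by (rule OM_induct1) (simp_all add: gen_pull_push[OF S[THEN Ind_fibre_square]])
next
  fix f g g' f' h Z \<alpha> \<beta>
  assume S: "Ind f g g' f'" and h: "h \<in> hom_set V (Cod V g) Z"
    and \<alpha>: "\<alpha> \<in> carrier (Grp \<M> f)" and \<beta>: "\<beta> \<in> carrier (Grp \<M> (h \<cdot>\<^bsub>V\<^esub> g))"
  show "Push \<M> g' (h \<cdot>\<^bsub>V\<^esub> f) (Bprod \<M> f' (h \<cdot>\<^bsub>V\<^esub> g) (Pull \<M> f g g' f' \<alpha>) \<beta>)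
    = Bprod \<M> f h \<alpha> (Push \<M> g h \<beta>)"
    using \<alpha> \<beta> by (rule OM_induct2) (simp_all add: gen_projection[OF Ind_fibre_square[OF S] h])
next
  fix g X X' assume "g \<in> hom_set V X' X"
  then show "Pull \<M> (Ide V X) g g (Ide V X') (Bone \<M> X) = Bone \<M> X'"
    by (simp add: gen_pull_one)
next
  fix f g g' f' \<alpha> \<beta>
  assume S: "Ind f g g' f'" and \<alpha>: "\<alpha> \<in> carrier (Grp \<M> f)" and \<beta>: "\<beta> \<in> carrier (Grp \<M> g)"
  show "Bprod \<M> f' g (Pull \<M> f g g' f' \<alpha>) \<beta> = Bprod \<M> g' f (Pull \<M> g f f' g' \<beta>) \<alpha>"
    using \<alpha> \<beta> by (rule OM_induct2) (simp_all add: gen_prod_commute[OF Ind_fibre_square[OF S]])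
next
  fix f X Y L L' \<alpha>
  assume f: "f \<in> hom_set V X Y" and L: "fibre_iso V F X L L'" and \<alpha>: "\<alpha> \<in> carrier (Grp \<M> f)"
  show "Ori \<M> f L \<alpha> = Ori \<M> f L' \<alpha>"
    using \<alpha> by (rule OM_induct1) (simp_all add: gen_ori_cong[OF f L])
next
  fix f X Y L L' \<alpha>
  assume f: "f \<in> hom_set V X Y" and L: "L \<in> fibre_objs F X" "L' \<in> fibre_objs F X"
    and \<alpha>: "\<alpha> \<in> carrier (Grp \<M> f)"
  show "Ori \<M> f L (Ori \<M> f L' \<alpha>) = Ori \<M> f L' (Ori \<M> f L \<alpha>)"
    using \<alpha> by (rule OM_induct1) (simp_all add: gen_ori_commute[OF f L])
next
  fix f g X Y Z L \<alpha> \<beta>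
  assume fg: "f \<in> hom_set V X Y" "g \<in> hom_set V Y Z" and L: "L \<in> fibre_objs F X"
    and \<alpha>: "\<alpha> \<in> carrier (Grp \<M> f)" and \<beta>: "\<beta> \<in> carrier (Grp \<M> g)"
  show "Ori \<M> (g \<cdot>\<^bsub>V\<^esub> f) L (Bprod \<M> f g \<alpha> \<beta>) = Bprod \<M> f g (Ori \<M> f L \<alpha>) \<beta>"
    using \<alpha> \<beta> by (rule OM_induct2) (simp_all add: gen_ori_prod_left[OF fg L])
next
  fix f g X Y Z N \<alpha> \<beta>
  assume fg: "f \<in> hom_set V X Y" "g \<in> hom_set V Y Z" and N: "N \<in> fibre_objs F Y"
    and \<alpha>: "\<alpha> \<in> carrier (Grp \<M> f)" and \<beta>: "\<beta> \<in> carrier (Grp \<M> g)"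
  show "Ori \<M> (g \<cdot>\<^bsub>V\<^esub> f) (pb F f N) (Bprod \<M> f g \<alpha> \<beta>) = Bprod \<M> f g \<alpha> (Ori \<M> g N \<beta>)"
    using \<alpha> \<beta> by (rule OM_induct2) (simp_all add: gen_ori_prod_right[OF fg N])
next
  fix f g X Y Z N \<alpha>
  assume fg: "f \<in> hom_set V X Y" "g \<in> hom_set V Y Z" and N: "N \<in> fibre_objs F Y"
    and \<alpha>: "\<alpha> \<in> carrier (Grp \<M> (g \<cdot>\<^bsub>V\<^esub> f))"
  show "Push \<M> f g (Ori \<M> (g \<cdot>\<^bsub>V\<^esub> f) (pb F f N) \<alpha>) = Ori \<M> g N (Push \<M> f g \<alpha>)"
    using \<alpha> by (rule OM_induct1) (simp_all add: gen_ori_push[OF fg N])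
next
  fix f g g' f' L \<alpha>
  assume S: "Ind f g g' f'" and L: "L \<in> fibre_objs F (Dom V f)" and \<alpha>: "\<alpha> \<in> carrier (Grp \<M> f)"
  show "Pull \<M> f g g' f' (Ori \<M> f L \<alpha>) = Ori \<M> f' (pb F g' L) (Pull \<M> f g g' f' \<alpha>)"
    using \<alpha> by (rule OM_induct1) (simp_all add: gen_ori_pull[OF Ind_fibre_square[OF S] L])
qed

end


section \<open>Transformations into an oriented theory\<close>

lemma hom_free_Abelian_group_diff:
  assumes u: "u \<in> hom (free_Abelian_group G) H" and H: "group H"
    and ab: "Poly_Mapping.keys a \<subseteq> G" "Poly_Mapping.keys b \<subseteq> G"
  shows "u (a - b) = u a \<otimes>\<^bsub>H\<^esub> inv\<^bsub>H\<^esub> u b"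
proof -
  interpret group_hom "free_Abelian_group G" H u
    using u H by (simp add: group_hom_def group_hom_axioms_def)
  show ?thesis using hom_mult[of a "- b"] hom_inv[of b] ab by simp
qed

lemma hom_eq_on_generators:
  assumes u: "u \<in> hom (free_Abelian_group G) H" and v: "v \<in> hom (free_Abelian_group G) H"
    and H: "group H" and eq: "\<And>A. A \<in> G \<Longrightarrow> u (frag_of A) = v (frag_of A)"
    and x: "Poly_Mapping.keys x \<subseteq> G"
  shows "u x = v x"
proof -
  have "Poly_Mapping.keys x \<subseteq> G \<and> u x = v x"
    using x
  proof (induction x rule: frag_induction)
    case zero
    have "u 0 = v 0"
      using hom_one[OF u group_free_Abelian_group H] hom_one[OF v group_free_Abelian_group H]
      by simp
    then show ?case by simp
  next
    case (diff a b)
    then show ?case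
      using hom_free_Abelian_group_diff[OF u H] hom_free_Abelian_group_diff[OF v H]
        keys_diff_subset by metis
  qed (use eq in simp)
  then show ?thesis by simp
qed

lemma oriented_grothendieck_transformationD:
  assumes "oriented_grothendieck_transformation V F C Ind B B' \<gamma>"
  shows "f \<in> Arr V \<Longrightarrow> \<gamma> f \<in> hom (Grp B f) (Grp B' f)"
    and "\<lbrakk>f \<in> hom_set V X Y; g \<in> hom_set V Y Z; f \<in> C; \<alpha> \<in> carrier (Grp B (g \<cdot>\<^bsub>V\<^esub> f))\<rbrakk>
      \<Longrightarrow> \<gamma> g (Push B f g \<alpha>) = Push B' f g (\<gamma> (g \<cdot>\<^bsub>V\<^esub> f) \<alpha>)"
proof -
  have G: "grothendieck_transformation V C Ind B B' \<gamma>"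
    using assms unfolding oriented_grothendieck_transformation_def by (rule conjunct1)
  show "f \<in> Arr V \<Longrightarrow> \<gamma> f \<in> hom (Grp B f) (Grp B' f)"
    using G unfolding grothendieck_transformation_def by meson
  show "\<lbrakk>f \<in> hom_set V X Y; g \<in> hom_set V Y Z; f \<in> C; \<alpha> \<in> carrier (Grp B (g \<cdot>\<^bsub>V\<^esub> f))\<rbrakk>
      \<Longrightarrow> \<gamma> g (Push B f g \<alpha>) = Push B' f g (\<gamma> (g \<cdot>\<^bsub>V\<^esub> f) \<alpha>)"
    using G unfolding grothendieck_transformation_def by meson
qed

locale oriented_target =
  bivariant_setting V F C Ind S + OB: oriented_bivariant_theory V F C Ind B
  for V :: "('o, 'm) cat" and F :: "('o, 'm, 'l, 'k) fibred" and C :: "'m set"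
    and Ind :: "'m \<Rightarrow> 'm \<Rightarrow> 'm \<Rightarrow> 'm \<Rightarrow> bool" and S :: "'m set"
    and B :: "('o, 'm, 'b, 'l) oriented_bivariant" +
  fixes \<theta> :: "'m \<Rightarrow> 'b"
  assumes nice: "nice_canonical_orientation V Ind S B \<theta>"
begin

lemma theta_closed: "f \<in> S \<Longrightarrow> \<theta> f \<in> carrier (Grp B f)"
  and theta_comp: "\<lbrakk>f \<in> S; g \<in> S; Cod V f = Dom V g\<rbrakk> \<Longrightarrow> \<theta> (g \<cdot>\<^bsub>V\<^esub> f) = Bprod B f g (\<theta> f) (\<theta> g)"
  and theta_pull: "\<lbrakk>f \<in> S; Ind f g g' f'\<rbrakk> \<Longrightarrow> \<theta> f' = Pull B f g g' f' (\<theta> f)"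
  using nice unfolding nice_canonical_orientation_def by meson+

lemma ori_list_closed:
  assumes "f \<in> hom_set V X Y" "set Ls \<subseteq> fibre_objs F X" "\<alpha> \<in> carrier (Grp B f)"
  shows "foldr (Ori B f) Ls \<alpha> \<in> carrier (Grp B f)"
  using assms(2)
proof (induction Ls)
  case (Cons L Ls)
  then show ?case using OB.ori_hom[OF assms(1), of L] by (auto simp: hom_def)
qed (use assms in simp)

lemma ori_list_commute:
  assumes f: "f \<in> hom_set V X Y" and \<alpha>: "\<alpha> \<in> carrier (Grp B f)"
    and L: "L \<in> fibre_objs F X" and Ls: "set Ls \<subseteq> fibre_objs F X"
  shows "foldr (Ori B f) Ls (Ori B f L \<alpha>) = Ori B f L (foldr (Ori B f) Ls \<alpha>)"
  using Ls
proof (induction Ls)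
  case (Cons L' Ls)
  then show ?case using OB.O2[OF f _ L, of L'] ori_list_closed[OF f _ \<alpha>, of Ls] by simp
qed simp

text \<open>As the operators commute and agree on isomorphic fibre-objects, the composite along a list
  depends only on the multiset of isomorphism classes.\<close>

lemma ori_list_cong:
  assumes f: "f \<in> hom_set V X Y" and \<alpha>: "\<alpha> \<in> carrier (Grp B f)"
    and "set Ls \<subseteq> fibre_objs F X" "set Ms \<subseteq> fibre_objs F X" "fibre_classes Ls = fibre_classes Ms"
  shows "foldr (Ori B f) Ls \<alpha> = foldr (Ori B f) Ms \<alpha>"
  using assms(3-5)
proof (induction Ls arbitrary: Ms)
  case Nil
  then show ?case by (simp add: fibre_classes_def)
next
  case (Cons L Ls)
  have "fibre_class L \<in># fibre_classes Ms"
    using Cons.prems(3) by (metis fibre_classes_Cons union_single_eq_member)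
  then obtain M where M: "M \<in> set Ms" "fibre_class M = fibre_class L"
    by (auto simp: fibre_classes_def)
  obtain Ms1 Ms2 where Ms: "Ms = Ms1 @ M # Ms2" using split_list[OF M(1)] by blast
  have "fibre_classes Ls = fibre_classes (Ms1 @ Ms2)"
    using Cons.prems(3) M(2) by (simp add: Ms)
  then have IH: "foldr (Ori B f) Ls \<alpha> = foldr (Ori B f) (Ms1 @ Ms2) \<alpha>"
    using Cons.IH[of "Ms1 @ Ms2"] Cons.prems by (simp add: Ms)
  have sub: "set Ls \<subseteq> fibre_objs F X" "L \<in> fibre_objs F X" "M \<in> fibre_objs F X"
    "set Ms1 \<subseteq> fibre_objs F X" "set Ms2 \<subseteq> fibre_objs F X"
    using Cons.prems by (simp_all add: Ms)
  have "fibre_iso V F X L M" using M(2) fibre_class_eq_iff sub by metis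
  then have "foldr (Ori B f) (L # Ls) \<alpha> = Ori B f M (foldr (Ori B f) (Ms1 @ Ms2) \<alpha>)"
    using OB.O1[OF f _ ori_list_closed[OF f sub(1) \<alpha>]] IH by simp
  also have "\<dots> = foldr (Ori B f) Ms \<alpha>"
    using ori_list_commute[OF f ori_list_closed[OF f sub(5) \<alpha>] sub(3,4)] by (simp add: Ms)
  finally show ?case .
qed

lemma ori_list_prod_left:
  assumes fg: "f \<in> hom_set V X Y" "g \<in> hom_set V Y Z" and Ls: "set Ls \<subseteq> fibre_objs F X"
    and \<alpha>: "\<alpha> \<in> carrier (Grp B f)" and \<beta>: "\<beta> \<in> carrier (Grp B g)"
  shows "foldr (Ori B (g \<cdot>\<^bsub>V\<^esub> f)) Ls (Bprod B f g \<alpha> \<beta>) = Bprod B f g (foldr (Ori B f) Ls \<alpha>) \<beta>"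
  using Ls
proof (induction Ls)
  case (Cons L Ls)
  then show ?case
    using OB.O3_left[OF fg _ ori_list_closed[OF fg(1) _ \<alpha>] \<beta>, of L Ls] by simp
qed simp

lemma ori_list_prod_right:
  assumes fg: "f \<in> hom_set V X Y" "g \<in> hom_set V Y Z" and Ms: "set Ms \<subseteq> fibre_objs F Y"
    and \<alpha>: "\<alpha> \<in> carrier (Grp B f)" and \<beta>: "\<beta> \<in> carrier (Grp B g)"
  shows "foldr (Ori B (g \<cdot>\<^bsub>V\<^esub> f)) (map (pb F f) Ms) (Bprod B f g \<alpha> \<beta>)
    = Bprod B f g \<alpha> (foldr (Ori B g) Ms \<beta>)"
  using Ms
proof (induction Ms)
  case (Cons L Ls)
  then show ?case
    using OB.O3_right[OF fg _ \<alpha> ori_list_closed[OF fg(2) _ \<beta>], of L Ls] by simp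
qed simp

lemma ori_list_push:
  assumes fg: "f \<in> hom_set V X Y" "g \<in> hom_set V Y Z" "f \<in> C" and Ms: "set Ms \<subseteq> fibre_objs F Y"
    and \<alpha>: "\<alpha> \<in> carrier (Grp B (g \<cdot>\<^bsub>V\<^esub> f))"
  shows "Push B f g (foldr (Ori B (g \<cdot>\<^bsub>V\<^esub> f)) (map (pb F f) Ms) \<alpha>)
    = foldr (Ori B g) Ms (Push B f g \<alpha>)"
  using Ms
proof (induction Ms)
  case (Cons L Ls)
  have F: "f \<in> Arr V" "Dom V f = X" "Cod V f = Y" using fg by (simp_all add: hom_set_def)
  have "set (map (pb F f) Ls) \<subseteq> fibre_objs F X" using Cons.prems F by simp
  then have "foldr (Ori B (g \<cdot>\<^bsub>V\<^esub> f)) (map (pb F f) Ls) \<alpha> \<in> carrier (Grp B (g \<cdot>\<^bsub>V\<^esub> f))"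
    using ori_list_closed[OF base.comp[OF fg(1,2)] _ \<alpha>] by blast
  from OB.O4[OF fg _ this, of L] Cons show ?case by simp
qed simp

lemma ori_list_pull:
  assumes I: "Ind f g g' f'" and Ls: "set Ls \<subseteq> fibre_objs F (Dom V f)"
    and \<alpha>: "\<alpha> \<in> carrier (Grp B f)"
  shows "Pull B f g g' f' (foldr (Ori B f) Ls \<alpha>)
    = foldr (Ori B f') (map (pb F g') Ls) (Pull B f g g' f' \<alpha>)"
  using Ls
proof (induction Ls)
  case (Cons L Ls)
  have "f \<in> hom_set V (Dom V f) (Cod V f)"
    using base.fibre_squareD[OF Ind_fibre_square[OF I]] by (simp add: hom_set_def)
  then show ?case
    using OB.O5[OF I _ ori_list_closed[OF _ _ \<alpha>], of L "Dom V f" "Cod V f" Ls] Cons by simp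
qed simp

text \<open>The value that normalization and compatibility with pushforward and orientation force on a
  cycle: \<open>[h; L\<^sub>1, \<dots>, L\<^sub>r]\<close> over \<open>f\<close> is the pushforward along \<open>h\<close> of \<open>[id; L\<^sub>1, \<dots>, L\<^sub>r]\<close>
  over \<open>f \<circ> h\<close>.\<close>

definition cycle_value :: "'m \<Rightarrow> ('m, 'l) cycle \<Rightarrow> 'b" where
  "cycle_value f c = Push B (fst c) f
     (foldr (Ori B (f \<cdot>\<^bsub>V\<^esub> fst c)) (snd c) (\<theta> (f \<cdot>\<^bsub>V\<^esub> fst c)))"

lemma transformation_cycle_value:
  assumes T: "oriented_grothendieck_transformation V F C Ind \<M> B \<gamma>"
    and N: "normalized V F S B \<theta> \<gamma>"
    and f: "f \<in> Arr V" and h: "h \<in> Arr V" "Cod V h = Dom V f" "h \<in> C" "f \<cdot>\<^bsub>V\<^esub> h \<in> S"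
    and Ls: "set Ls \<subseteq> fibre_objs F (Dom V h)"
  shows "\<gamma> f (frag_of (cycle_class V F (Dom V f) (h, Ls))) = cycle_value f (h, Ls)"
proof -
  define T where "T = Dom V h"
  have T: "Dom V h = T" "T \<in> Obj V" using h by (simp_all add: T_def)
  let ?A = "cycle_class V F T (Ide V T, Ls)"
  have fh: "f \<in> hom_set V (Dom V f) (Cod V f)" "h \<in> hom_set V T (Dom V f)"
    "f \<cdot>\<^bsub>V\<^esub> h \<in> hom_set V T (Cod V f) \<inter> S"
    using f h T by (simp_all add: hom_set_def)
  have "gen_push V F h ?A = cycle_class V F (Dom V f) (h, Ls)"
    using gen_push_class[of h "Ide V T" Ls] h T Ls by simp
  moreover have "frag_of ?A \<in> carrier (Grp \<M> (f \<cdot>\<^bsub>V\<^esub> h))"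
    using OM_gensI[of "Ide V T" T "f \<cdot>\<^bsub>V\<^esub> h" Ls] f h T Ls C_ide by simp
  ultimately have "\<gamma> f (frag_of (cycle_class V F (Dom V f) (h, Ls)))
      = Push B h f (\<gamma> (f \<cdot>\<^bsub>V\<^esub> h) (frag_of ?A))"
    using oriented_grothendieck_transformationD(2)[OF assms(1) fh(2,1) h(3), of "frag_of ?A"] by simp
  moreover have "\<gamma> (f \<cdot>\<^bsub>V\<^esub> h) (frag_of ?A) = foldr (Ori B (f \<cdot>\<^bsub>V\<^esub> h)) Ls (\<theta> (f \<cdot>\<^bsub>V\<^esub> h))"
    using N fh(3) Ls T unfolding normalized_def by blast
  ultimately show ?thesis by (simp add: cycle_value_def)
qed

theorem transformation_unique:
  assumes \<gamma>: "oriented_grothendieck_transformation V F C Ind \<M> B \<gamma>" "normalized V F S B \<theta> \<gamma>"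
    and \<gamma>': "oriented_grothendieck_transformation V F C Ind \<M> B \<gamma>'" "normalized V F S B \<theta> \<gamma>'"
    and f: "f \<in> Arr V" and x: "x \<in> carrier (Grp \<M> f)"
  shows "\<gamma> f x = \<gamma>' f x"
proof (rule hom_eq_on_generators)
  show "\<gamma> f \<in> hom (free_Abelian_group (OM_gens V F C S f)) (Grp B f)"
    "\<gamma>' f \<in> hom (free_Abelian_group (OM_gens V F C S f)) (Grp B f)"
    using oriented_grothendieck_transformationD(1)[OF \<gamma>(1) f]
      oriented_grothendieck_transformationD(1)[OF \<gamma>'(1) f] by simp_all
  show "group (Grp B f)" using OB.grp[OF f] by (simp add: comm_group_def)
  show "Poly_Mapping.keys x \<subseteq> OM_gens V F C S f" using x by simp
  fix A assume "A \<in> OM_gens V F C S f"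
  then obtain h Ls T where h: "A = cycle_class V F (Dom V f) (h, Ls)" "h \<in> Arr V" "Dom V h = T"
    "Cod V h = Dom V f" "set Ls \<subseteq> fibre_objs F T" "h \<in> C" "f \<cdot>\<^bsub>V\<^esub> h \<in> S"
    using OM_gensE[OF _ refl] by metis
  then show "\<gamma> f (frag_of A) = \<gamma>' f (frag_of A)"
    using transformation_cycle_value[OF \<gamma> f h(2,4,6,7)]
      transformation_cycle_value[OF \<gamma>' f h(2,4,6,7)] by simp
qed

end

section \<open>Existence of the transformation\<close>

locale independent_target = oriented_target V F C Ind S B \<theta>
  for V :: "('o, 'm) cat" and F :: "('o, 'm, 'l, 'k) fibred" and C :: "'m set"
    and Ind :: "'m \<Rightarrow> 'm \<Rightarrow> 'm \<Rightarrow> 'm \<Rightarrow> bool" and S :: "'m set"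
    and B :: "('o, 'm, 'b, 'l) oriented_bivariant" and \<theta> :: "'m \<Rightarrow> 'b" +
  assumes squares: "cycle_squares_independent V C Ind S"
begin

lemma Ind_pull_square:
  "\<lbrakk>Ind f g g' f'; h \<in> C; Cod V h = Dom V f; f \<cdot>\<^bsub>V\<^esub> h \<in> S; fibre_square V h g' g'' h'\<rbrakk>
    \<Longrightarrow> Ind h g' g'' h'"
  using squares unfolding cycle_squares_independent_def by meson

lemma Ind_prod_square:
  "\<lbrakk>f \<in> Arr V; g \<in> Arr V; Cod V f = Dom V g; h \<in> C; Cod V h = Dom V f; f \<cdot>\<^bsub>V\<^esub> h \<in> S;
    k \<in> C; Cod V k = Dom V g; g \<cdot>\<^bsub>V\<^esub> k \<in> S; fibre_square V (f \<cdot>\<^bsub>V\<^esub> h) k k'' p\<rbrakk>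
    \<Longrightarrow> Ind (f \<cdot>\<^bsub>V\<^esub> h) k k'' p"
  using squares unfolding cycle_squares_independent_def by meson

text \<open>Let \<open>b\<close> be the inverse of \<open>a\<close>. The fibre square with right side \<open>a\<close>, top \<open>b\<close> and identities at the
  bottom and on the left is one of the squares formed from cycles, as \<open>a\<close> is confined and
  specialized, so it is independent. Base change of the pushforward along it turns \<open>a\<^sub>*\<close> into a
  pullback, under which \<open>\<theta>\<close> is stable.\<close>

lemma push_iso_theta:
  assumes s: "s \<in> S" and a: "is_iso V a" "Cod V a = Dom V s"
  shows "Push B a s (\<theta> (s \<cdot>\<^bsub>V\<^esub> a)) = \<theta> s"
proof -
  define W Y where "W = Dom V s" and "Y = Cod V s"
  have sF: "s \<in> Arr V" "Dom V s = W" "Cod V s = Y" "W \<in> Obj V"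
    using S_Arr[OF s] by (simp_all add: W_def Y_def)
  obtain b where b: "is_iso V b" "a \<in> Arr V" "b \<in> Arr V" "Dom V b = Cod V a" "Cod V b = Dom V a"
    "b \<cdot>\<^bsub>V\<^esub> a = Ide V (Dom V a)" "a \<cdot>\<^bsub>V\<^esub> b = Ide V (Cod V a)"
    using a(1) by (rule base.is_isoE)
  have aW: "Cod V a = W" using a sF by simp
  have sa: "s \<cdot>\<^bsub>V\<^esub> a \<in> S" using S_comp[OF S_iso[OF a(1)] s a(2)] .
  have "fibre_square V (a \<cdot>\<^bsub>V\<^esub> b) (Ide V W) (Ide V W) (Ide V W)"
    using base.fibre_square_ide(1)[of "Ide V W" W W] b(7) aW sF by simp
  then have "fibre_square V a (Ide V W) (b \<cdot>\<^bsub>V\<^esub> Ide V W) (Ide V W)"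
    using b(2,5) by (intro base.fibre_square_iso_right[OF _ b(1)]) simp_all
  then have "fibre_square V (Ide V W \<cdot>\<^bsub>V\<^esub> a) (Ide V W) b (Ide V W)"
    using b(2-4) aW by simp
  then have "Ind (Ide V W \<cdot>\<^bsub>V\<^esub> a) (Ide V W) b (Ide V W)"
    using sF b(2) aW C_iso[OF a(1)] S_iso[OF a(1)] C_ide S_ide
    by (intro Ind_prod_square[of "Ide V W" "Ide V W"]) simp_all
  then have I: "Ind a (Ide V W) b (Ide V W)" using b(2) aW by simp
  have I': "Ind s (Ide V Y) (Ide V W) s" using Ind_ide(1)[OF sF(1-3)] .
  have hs: "s \<in> hom_set V W Y" "a \<in> hom_set V (Dom V a) W"
    using sF b(2) aW by (simp_all add: hom_set_def)
  have "\<theta> (s \<cdot>\<^bsub>V\<^esub> Ide V W) = Pull B (s \<cdot>\<^bsub>V\<^esub> a) (Ide V Y) b (s \<cdot>\<^bsub>V\<^esub> Ide V W) (\<theta> (s \<cdot>\<^bsub>V\<^esub> a))"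
    using theta_pull[OF sa Ind_vpaste[OF I' I]] .
  then have "Push B (Ide V W) s (\<theta> s) = Pull B s (Ide V Y) (Ide V W) s (Push B a s (\<theta> (s \<cdot>\<^bsub>V\<^esub> a)))"
    using OB.B6[OF I' I C_iso[OF a(1)] theta_closed[OF sa]] sF by simp
  moreover have "Push B a s (\<theta> (s \<cdot>\<^bsub>V\<^esub> a)) \<in> carrier (Grp B s)"
    using OB.push_hom[OF hs(2,1) C_iso[OF a(1)]] theta_closed[OF sa] by (auto simp: hom_def)
  ultimately show ?thesis
    using OB.B2_ide[OF hs(1) theta_closed[OF s]] OB.B3_ide[OF hs(1)] by simp
qed

text \<open>Pushing forward along \<open>h = k \<circ> g\<close> is pushing forward along the isomorphism \<open>g\<close> and then along \<open>k\<close>.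
  The first step takes the operators of \<open>g\<^sup>* M\<^sub>j\<close> to those of \<open>M\<^sub>j\<close> and \<open>\<theta>(f \<circ> k \<circ> g)\<close> to \<open>\<theta>(f \<circ> k)\<close>.\<close>

lemma cycle_value_iso:
  assumes f: "f \<in> Arr V" and k: "k \<in> Arr V" "Cod V k = Dom V f" "k \<in> C" "f \<cdot>\<^bsub>V\<^esub> k \<in> S"
    and Ms: "set Ms \<subseteq> fibre_objs F (Dom V k)" and Ls: "set Ls \<subseteq> fibre_objs F (Dom V h)"
    and g: "g \<in> Arr V" "Dom V g = Dom V h" "Cod V g = Dom V k" "is_iso V g" "k \<cdot>\<^bsub>V\<^esub> g = h"
    and cl: "fibre_classes Ls = fibre_classes (map (pb F g) Ms)"
  shows "cycle_value f (h, Ls) = cycle_value f (k, Ms)"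
proof -
  have hs: "g \<in> hom_set V (Dom V h) (Dom V k)" "k \<in> hom_set V (Dom V k) (Dom V f)"
    "f \<in> hom_set V (Dom V f) (Cod V f)" "f \<cdot>\<^bsub>V\<^esub> k \<in> hom_set V (Dom V k) (Cod V f)"
    using f g k by (simp_all add: hom_set_def)
  let ?s = "(f \<cdot>\<^bsub>V\<^esub> k) \<cdot>\<^bsub>V\<^esub> g"
  have gC: "g \<in> C" using C_iso[OF g(4)] .
  have sS: "?s \<in> S" using S_comp[OF S_iso[OF g(4)] k(4)] g k f by simp
  have s: "?s = f \<cdot>\<^bsub>V\<^esub> h" "?s = f \<cdot>\<^bsub>V\<^esub> (k \<cdot>\<^bsub>V\<^esub> g)" using base.assoc[of g k f] f g k by simp_all
  have s_hom: "?s \<in> hom_set V (Dom V h) (Cod V f)" using base.comp[OF hs(1,4)] .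
  have "foldr (Ori B ?s) Ls (\<theta> ?s) = foldr (Ori B ?s) (map (pb F g) Ms) (\<theta> ?s)"
    by (rule ori_list_cong[OF s_hom theta_closed[OF sS] Ls _ cl]) (use g Ms in simp)
  moreover have "foldr (Ori B ?s) Ls (\<theta> ?s) \<in> carrier (Grp B ?s)"
    using ori_list_closed[OF s_hom Ls theta_closed[OF sS]] .
  ultimately have "cycle_value f (h, Ls)
      = Push B k f (Push B g (f \<cdot>\<^bsub>V\<^esub> k) (foldr (Ori B ?s) (map (pb F g) Ms) (\<theta> ?s)))"
    using OB.B2_comp[OF hs(1-3) gC k(3), of "foldr (Ori B ?s) Ls (\<theta> ?s)"] g(5) s
    by (simp add: cycle_value_def)
  also have "\<dots> = Push B k f (foldr (Ori B (f \<cdot>\<^bsub>V\<^esub> k)) Ms (Push B g (f \<cdot>\<^bsub>V\<^esub> k) (\<theta> ?s)))"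
    using ori_list_push[OF hs(1,4) gC Ms theta_closed[OF sS]] by simp
  also have "Push B g (f \<cdot>\<^bsub>V\<^esub> k) (\<theta> ?s) = \<theta> (f \<cdot>\<^bsub>V\<^esub> k)"
    using push_iso_theta[OF k(4) g(4)] f g k by simp
  finally show ?thesis by (simp add: cycle_value_def)
qed

text \<open>The representative is chosen arbitrarily; by \<open>cycle_value_iso\<close> the choice does not matter.\<close>

definition class_value :: "'m \<Rightarrow> ('m, 'l) cycle set \<Rightarrow> 'b" where
  "class_value f A = cycle_value f (SOME c. c \<in> A)"

lemma class_value:
  assumes f: "f \<in> Arr V" and h: "h \<in> Arr V" "Cod V h = Dom V f" "h \<in> C" "f \<cdot>\<^bsub>V\<^esub> h \<in> S"
    and Ls: "set Ls \<subseteq> fibre_objs F (Dom V h)"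
  shows "class_value f (cycle_class V F (Dom V f) (h, Ls)) = cycle_value f (h, Ls)"
proof -
  obtain k Ms where c: "(SOME c. c \<in> cycle_class V F (Dom V f) (h, Ls)) = (k, Ms)"
    by (metis surj_pair)
  have "(k, Ms) \<in> cycle_class V F (Dom V f) (h, Ls)"
    using someI[of "\<lambda>c. c \<in> cycle_class V F (Dom V f) (h, Ls)", OF cycle_class_refl[OF h(1,2) Ls]]
    unfolding c .
  then obtain g where g: "g \<in> Arr V" "Dom V g = Dom V h" "Cod V g = Dom V k" "is_iso V g"
    "k \<cdot>\<^bsub>V\<^esub> g = h" "fibre_classes Ls = fibre_classes (map (pb F g) Ms)"
    "k \<in> Arr V" "Cod V k = Dom V f" "set Ms \<subseteq> fibre_objs F (Dom V k)"
    using Ls by (rule cycle_class_memE)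
  obtain b where b: "is_iso V b" "b \<in> Arr V" "Dom V b = Cod V g" "Cod V b = Dom V g"
    "g \<cdot>\<^bsub>V\<^esub> b = Ide V (Cod V g)"
    using g(4) by (rule base.is_isoE)
  have k: "k = h \<cdot>\<^bsub>V\<^esub> b" using base.assoc[of b g k] b g by simp
  have "k \<in> C" unfolding k using C_comp[OF C_iso[OF b(1)] h(3)] b g by simp
  moreover have "f \<cdot>\<^bsub>V\<^esub> k \<in> S"
    using S_comp[OF S_iso[OF b(1)] h(4)] b g(1-3) h f unfolding k by simp
  ultimately show ?thesis
    using cycle_value_iso[OF f g(7,8) _ _ g(9) Ls g(1-6)] by (simp add: class_value_def c)
qed

definition transformation :: "'m \<Rightarrow> (('m, 'l) cycle set \<Rightarrow>\<^sub>0 int) \<Rightarrow> 'b" where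
  "transformation f = (SOME u. u \<in> hom (free_Abelian_group (OM_gens V F C S f)) (Grp B f) \<and>
     (\<forall>A \<in> OM_gens V F C S f. u (frag_of A) = class_value f A))"

lemma cycle_value_closed:
  assumes f: "f \<in> Arr V" and h: "h \<in> Arr V" "Cod V h = Dom V f" "h \<in> C" "f \<cdot>\<^bsub>V\<^esub> h \<in> S"
    and Ls: "set Ls \<subseteq> fibre_objs F (Dom V h)"
  shows "cycle_value f (h, Ls) \<in> carrier (Grp B f)"
    "foldr (Ori B (f \<cdot>\<^bsub>V\<^esub> h)) Ls (\<theta> (f \<cdot>\<^bsub>V\<^esub> h)) \<in> carrier (Grp B (f \<cdot>\<^bsub>V\<^esub> h))"
proof -
  have hs: "h \<in> hom_set V (Dom V h) (Dom V f)" "f \<in> hom_set V (Dom V f) (Cod V f)"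
    using f h by (simp_all add: hom_set_def)
  show "foldr (Ori B (f \<cdot>\<^bsub>V\<^esub> h)) Ls (\<theta> (f \<cdot>\<^bsub>V\<^esub> h)) \<in> carrier (Grp B (f \<cdot>\<^bsub>V\<^esub> h))"
    using ori_list_closed[OF base.comp[OF hs] Ls theta_closed[OF h(4)]] .
  then show "cycle_value f (h, Ls) \<in> carrier (Grp B f)"
    using OB.push_hom[OF hs h(3)] by (auto simp: cycle_value_def hom_def)
qed

lemma transformation:
  assumes f: "f \<in> Arr V"
  shows "transformation f \<in> hom (Grp \<M> f) (Grp B f)"
    and "A \<in> OM_gens V F C S f \<Longrightarrow> transformation f (frag_of A) = class_value f A"
proof -
  interpret G: comm_group "Grp B f" using OB.grp[OF f] .
  have "class_value f A \<in> carrier (Grp B f)" if A: "A \<in> OM_gens V F C S f" for A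
  proof -
    obtain h Ls T where h: "A = cycle_class V F (Dom V f) (h, Ls)" "h \<in> Arr V" "Dom V h = T"
      "Cod V h = Dom V f" "set Ls \<subseteq> fibre_objs F T" "h \<in> C" "f \<cdot>\<^bsub>V\<^esub> h \<in> S"
      using OM_gensE[OF A refl] .
    then show ?thesis
      using class_value[OF f, of h Ls] cycle_value_closed(1)[OF f, of h Ls] by simp
  qed
  then have "class_value f ` OM_gens V F C S f \<subseteq> carrier (Grp B f)" by blast
  then have "\<exists>u. u \<in> hom (free_Abelian_group (OM_gens V F C S f)) (Grp B f) \<and>
     (\<forall>A \<in> OM_gens V F C S f. u (frag_of A) = class_value f A)"
    using G.free_Abelian_group_universal by metis
  from someI_ex[OF this] show "transformation f \<in> hom (Grp \<M> f) (Grp B f)"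
    "A \<in> OM_gens V F C S f \<Longrightarrow> transformation f (frag_of A) = class_value f A"
    unfolding transformation_def Grp_OM by simp_all
qed

lemma transformation_class:
  assumes f: "f \<in> Arr V" and h: "h \<in> Arr V" "Cod V h = X" "h \<in> C" "f \<cdot>\<^bsub>V\<^esub> h \<in> S"
    and Ls: "set Ls \<subseteq> fibre_objs F (Dom V h)" and X: "Dom V f = X"
  shows "transformation f (frag_of (cycle_class V F X (h, Ls))) = cycle_value f (h, Ls)"
  using transformation(2)[OF f OM_gensI[OF h(1,2) X Ls h(3,4)]] class_value[OF f, of h Ls] h Ls X
  by simp

lemma transformation_closed:
  assumes "f \<in> Arr V" "\<alpha> \<in> carrier (Grp \<M> f)"
  shows "transformation f \<alpha> \<in> carrier (Grp B f)"
  using hom_in_carrier[OF transformation(1)[OF assms(1)] assms(2)] .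

lemma OM_hom_eqI:
  assumes "u \<in> hom (Grp \<M> f) (Grp B g)" "v \<in> hom (Grp \<M> f) (Grp B g)" "g \<in> Arr V"
    "\<alpha> \<in> carrier (Grp \<M> f)" "\<And>A. A \<in> OM_gens V F C S f \<Longrightarrow> u (frag_of A) = v (frag_of A)"
  shows "u \<alpha> = v \<alpha>"
proof (rule hom_eq_on_generators)
  show "group (Grp B g)" using OB.grp[OF assms(3)] by (simp add: comm_group_def)
qed (use assms in simp_all)

text \<open>By the projection formula and compatibility of pushforward with products,
  \<open>v\<^sub>* x \<bullet> w\<^sub>* y = (v k)\<^sub>* (w\<^sup>* x \<bullet> y)\<close> for the independent square \<open>f v, w, k, p\<close>. For \<open>x\<close> and \<open>y\<close> the decorated orientation classes of \<open>f v\<close> and \<open>g w\<close>, the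
  class \<open>w\<^sup>* x \<bullet> y\<close> is the decorated orientation class of \<open>g w p = g f v k\<close>, because \<open>\<theta>\<close> is stable
  under \<open>w\<^sup>*\<close> and multiplicative.\<close>

lemma transformation_prod_gens:
  assumes fg: "f \<in> hom_set V X Y" "g \<in> hom_set V Y Z"
    and A: "A \<in> OM_gens V F C S f" and A': "A' \<in> OM_gens V F C S g"
  shows "transformation (g \<cdot>\<^bsub>V\<^esub> f) (frag_of (gen_prod V F f A A'))
    = Bprod B f g (transformation f (frag_of A)) (transformation g (frag_of A'))"
proof -
  have F: "f \<in> Arr V" "Dom V f = X" "Cod V f = Y" "g \<in> Arr V" "Dom V g = Y" "Cod V g = Z"
    using fg by (simp_all add: hom_set_def)
  obtain v Ls T where v: "A = cycle_class V F X (v, Ls)" "v \<in> Arr V" "Dom V v = T" "Cod V v = X"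
    "set Ls \<subseteq> fibre_objs F T" "v \<in> C" "f \<cdot>\<^bsub>V\<^esub> v \<in> S"
    using OM_gensE[OF A F(2)] .
  obtain w Ms U where w: "A' = cycle_class V F Y (w, Ms)" "w \<in> Arr V" "Dom V w = U" "Cod V w = Y"
    "set Ms \<subseteq> fibre_objs F U" "w \<in> C" "g \<cdot>\<^bsub>V\<^esub> w \<in> S"
    using OM_gensE[OF A' F(5)] .
  obtain k p P where k: "fibre_square V (f \<cdot>\<^bsub>V\<^esub> v) w k p" "k \<in> Arr V" "p \<in> Arr V" "Dom V k = P"
    "Dom V p = P" "Cod V k = T" "Cod V p = U" "(f \<cdot>\<^bsub>V\<^esub> v) \<cdot>\<^bsub>V\<^esub> k = w \<cdot>\<^bsub>V\<^esub> p"
    by (rule fibre_productE[of "f \<cdot>\<^bsub>V\<^esub> v" w Y T U]) (use F v w in simp_all)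
  have I: "Ind (f \<cdot>\<^bsub>V\<^esub> v) w k p"
    by (rule Ind_prod_square[of f g]) (use F v w k in simp_all)
  have kC: "k \<in> C" using C_base_change[OF w(6) base.fibre_square_transpose[OF k(1)]] .
  have vkC: "v \<cdot>\<^bsub>V\<^esub> k \<in> C" using C_comp[OF kC v(6)] k v by simp
  have pS: "p \<in> S" using S_base_change[OF v(7) k(1)] .
  have gwpS: "(g \<cdot>\<^bsub>V\<^esub> w) \<cdot>\<^bsub>V\<^esub> p \<in> S" using S_comp[OF pS w(7)] k w F by simp
  have fgvk: "(g \<cdot>\<^bsub>V\<^esub> f) \<cdot>\<^bsub>V\<^esub> (v \<cdot>\<^bsub>V\<^esub> k) = (g \<cdot>\<^bsub>V\<^esub> w) \<cdot>\<^bsub>V\<^esub> p"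
    "(g \<cdot>\<^bsub>V\<^esub> (f \<cdot>\<^bsub>V\<^esub> v)) \<cdot>\<^bsub>V\<^esub> k = (g \<cdot>\<^bsub>V\<^esub> w) \<cdot>\<^bsub>V\<^esub> p"
    using F v w k by simp_all
  have hs: "v \<in> hom_set V T X" "f \<cdot>\<^bsub>V\<^esub> v \<in> hom_set V T Y" "w \<in> hom_set V U Y"
    "g \<cdot>\<^bsub>V\<^esub> w \<in> hom_set V U Z" "k \<in> hom_set V P T" "p \<in> hom_set V P U"
    "(g \<cdot>\<^bsub>V\<^esub> w) \<cdot>\<^bsub>V\<^esub> p \<in> hom_set V P Z" "g \<cdot>\<^bsub>V\<^esub> f \<in> hom_set V X Z"
    using F v w k by (simp_all add: hom_set_def)
  define x where "x = foldr (Ori B (f \<cdot>\<^bsub>V\<^esub> v)) Ls (\<theta> (f \<cdot>\<^bsub>V\<^esub> v))"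
  define y where "y = foldr (Ori B (g \<cdot>\<^bsub>V\<^esub> w)) Ms (\<theta> (g \<cdot>\<^bsub>V\<^esub> w))"
  have x: "x \<in> carrier (Grp B (f \<cdot>\<^bsub>V\<^esub> v))" "transformation f (frag_of A) = Push B v f x"
    using ori_list_closed[OF hs(2) v(5) theta_closed[OF v(7)]]
      transformation_class[OF F(1) v(2,4,6,7), of Ls] v F by (simp_all add: x_def cycle_value_def)
  have y: "y \<in> carrier (Grp B (g \<cdot>\<^bsub>V\<^esub> w))" "transformation g (frag_of A') = Push B w g y"
    using ori_list_closed[OF hs(4) w(5) theta_closed[OF w(7)]]
      transformation_class[OF F(4) w(2,4,6,7), of Ms] w F by (simp_all add: y_def cycle_value_def)
  have wy: "Push B w g y \<in> carrier (Grp B g)"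
    using hom_in_carrier[OF OB.push_hom[OF hs(3) fg(2) w(6)] y(1)] .
  have px: "Pull B (f \<cdot>\<^bsub>V\<^esub> v) w k p x = foldr (Ori B p) (map (pb F k) Ls) (\<theta> p)"
    using ori_list_pull[OF I _ theta_closed[OF v(7)], of Ls] theta_pull[OF v(7) I] v F
    by (simp add: x_def)
  have px_closed: "Pull B (f \<cdot>\<^bsub>V\<^esub> v) w k p x \<in> carrier (Grp B p)"
    using hom_in_carrier[OF OB.pull_hom[OF I] x(1)] .
  let ?s = "(g \<cdot>\<^bsub>V\<^esub> w) \<cdot>\<^bsub>V\<^esub> p"
  have kL: "set (map (pb F k) Ls) \<subseteq> fibre_objs F P" and pM: "set (map (pb F p) Ms) \<subseteq> fibre_objs F P"
    using k v w by simp_all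
  have cls: "gen_prod V F f A A' = cycle_class V F X (v \<cdot>\<^bsub>V\<^esub> k, map (pb F k) Ls @ map (pb F p) Ms)"
    using gen_prod_class[OF k(1), of Y Ls Ms] F v w by simp
  define z where "z = foldr (Ori B ?s) (map (pb F k) Ls @ map (pb F p) Ms) (\<theta> ?s)"
  have z: "z \<in> carrier (Grp B ?s)"
    unfolding z_def using kL pM by (intro ori_list_closed[OF hs(7) _ theta_closed[OF gwpS]]) simp
  have "foldr (Ori B ?s) (map (pb F p) Ms) (\<theta> ?s) = Bprod B p (g \<cdot>\<^bsub>V\<^esub> w) (\<theta> p) y"
    using ori_list_prod_right[OF hs(6,4) w(5) theta_closed[OF pS] theta_closed[OF w(7)]]
      theta_comp[OF pS w(7)] k w F by (simp add: y_def)
  then have zxy: "z = Bprod B p (g \<cdot>\<^bsub>V\<^esub> w) (Pull B (f \<cdot>\<^bsub>V\<^esub> v) w k p x) y"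
    using ori_list_prod_left[OF hs(6,4) kL theta_closed[OF pS] y(1)] px by (simp add: z_def)
  have "transformation (g \<cdot>\<^bsub>V\<^esub> f) (frag_of (gen_prod V F f A A'))
    = cycle_value (g \<cdot>\<^bsub>V\<^esub> f) (v \<cdot>\<^bsub>V\<^esub> k, map (pb F k) Ls @ map (pb F p) Ms)"
    unfolding cls
    by (rule transformation_class) (use F v k vkC gwpS fgvk kL pM in \<open>simp_all only:
        base.comp_simps set_append Un_subset_iff\<close>)
  also have "\<dots> = Push B (v \<cdot>\<^bsub>V\<^esub> k) (g \<cdot>\<^bsub>V\<^esub> f) z"
    by (simp only: cycle_value_def fst_conv snd_conv fgvk z_def)
  also have "\<dots> = Push B v (g \<cdot>\<^bsub>V\<^esub> f) (Push B k ((g \<cdot>\<^bsub>V\<^esub> f) \<cdot>\<^bsub>V\<^esub> v) z)"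
    using OB.B2_comp[OF hs(5,1,8) kC v(6)] z fgvk(1) by simp
  also have "(g \<cdot>\<^bsub>V\<^esub> f) \<cdot>\<^bsub>V\<^esub> v = g \<cdot>\<^bsub>V\<^esub> (f \<cdot>\<^bsub>V\<^esub> v)" using F v by simp
  also have "Push B k (g \<cdot>\<^bsub>V\<^esub> (f \<cdot>\<^bsub>V\<^esub> v)) z = Bprod B (f \<cdot>\<^bsub>V\<^esub> v) g x (Push B w g y)"
    unfolding zxy using fg(2) F w by (intro OB.B7[OF I w(6) _ x(1) y(1)]) simp
  also have "Push B v (g \<cdot>\<^bsub>V\<^esub> f) \<dots> = Bprod B f g (Push B v f x) (Push B w g y)"
    using OB.B4[OF hs(1) fg v(6) x(1) wy] .
  finally show ?thesis using x y by simp
qed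

lemma transformation_push_gens:
  assumes fg: "f \<in> hom_set V X Y" "g \<in> hom_set V Y Z" and fC: "f \<in> C"
    and A: "A \<in> OM_gens V F C S (g \<cdot>\<^bsub>V\<^esub> f)"
  shows "transformation g (frag_of (gen_push V F f A))
    = Push B f g (transformation (g \<cdot>\<^bsub>V\<^esub> f) (frag_of A))"
proof -
  have F: "f \<in> Arr V" "Dom V f = X" "Cod V f = Y" "g \<in> Arr V" "Dom V g = Y" "Cod V g = Z"
    "g \<cdot>\<^bsub>V\<^esub> f \<in> Arr V" "Dom V (g \<cdot>\<^bsub>V\<^esub> f) = X"
    using fg by (simp_all add: hom_set_def)
  obtain v Ls T where v: "A = cycle_class V F X (v, Ls)" "v \<in> Arr V" "Dom V v = T" "Cod V v = X"
    "set Ls \<subseteq> fibre_objs F T" "v \<in> C" "(g \<cdot>\<^bsub>V\<^esub> f) \<cdot>\<^bsub>V\<^esub> v \<in> S"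
    using OM_gensE[OF A F(8)] .
  have vh: "v \<in> hom_set V T X" using v by (simp add: hom_set_def)
  have gfv: "(g \<cdot>\<^bsub>V\<^esub> f) \<cdot>\<^bsub>V\<^esub> v = g \<cdot>\<^bsub>V\<^esub> (f \<cdot>\<^bsub>V\<^esub> v)" using F v by simp
  have fvC: "f \<cdot>\<^bsub>V\<^esub> v \<in> C" using C_comp[OF v(6) fC] F v by simp
  define x where "x = foldr (Ori B (g \<cdot>\<^bsub>V\<^esub> (f \<cdot>\<^bsub>V\<^esub> v))) Ls (\<theta> (g \<cdot>\<^bsub>V\<^esub> (f \<cdot>\<^bsub>V\<^esub> v)))"
  have x: "x \<in> carrier (Grp B (g \<cdot>\<^bsub>V\<^esub> (f \<cdot>\<^bsub>V\<^esub> v)))"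
    using cycle_value_closed(2)[OF F(7) v(2) _ v(6,7), of Ls] v F gfv by (simp add: x_def)
  have "transformation g (frag_of (gen_push V F f A)) = Push B (f \<cdot>\<^bsub>V\<^esub> v) g x"
    using gen_push_class[of f v Ls] transformation_class[of g "f \<cdot>\<^bsub>V\<^esub> v" Y Ls] F v fvC gfv
    by (simp add: x_def cycle_value_def)
  also have "\<dots> = Push B f g (Push B v (g \<cdot>\<^bsub>V\<^esub> f) x)"
    using OB.B2_comp[OF vh fg v(6) fC x] .
  also have "Push B v (g \<cdot>\<^bsub>V\<^esub> f) x = transformation (g \<cdot>\<^bsub>V\<^esub> f) (frag_of A)"
    using transformation_class[OF F(7) v(2,4,6,7), of Ls] F v gfv by (simp add: x_def cycle_value_def)
  finally show ?thesis .
qed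

text \<open>The square pulling \<open>v\<close> back along \<open>g'\<close> is independent, so base change gives
  \<open>g\<^sup>* v\<^sub>* = v'\<^sub>* g\<^sup>*\<close>, and \<open>g\<^sup>* \<theta>(f \<circ> v) = \<theta>(f' \<circ> v')\<close> along the composite square.\<close>

lemma transformation_pull_gens:
  assumes I: "Ind f g g' f'" and A: "A \<in> OM_gens V F C S f"
  shows "transformation f' (frag_of (gen_pull V F g' A))
    = Pull B f g g' f' (transformation f (frag_of A))"
proof -
  define X Y X' Y' where "X = Dom V f" and "Y = Cod V f" and "X' = Dom V g'" and "Y' = Dom V g"
  note S1 = Ind_fibre_square[OF I]
  have F: "f \<in> Arr V" "Dom V f = X" "Cod V f = Y"
    "g' \<in> Arr V" "Dom V g' = X'" "Cod V g' = X" "f' \<in> Arr V" "Dom V f' = X'" "Cod V f' = Y'"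
    using base.fibre_squareD[OF S1] unfolding X_def Y_def X'_def Y'_def by simp_all
  obtain v Ls T where v: "A = cycle_class V F X (v, Ls)" "v \<in> Arr V" "Dom V v = T" "Cod V v = X"
    "set Ls \<subseteq> fibre_objs F T" "v \<in> C" "f \<cdot>\<^bsub>V\<^esub> v \<in> S"
    using OM_gensE[OF A F(2)] .
  obtain a v' T' where a: "fibre_square V v g' a v'" "a \<in> Arr V" "v' \<in> Arr V" "Dom V a = T'"
    "Dom V v' = T'" "Cod V a = T" "Cod V v' = X'"
    using fibre_productE[OF v(2) F(4) v(4) F(6) v(3) F(5)] .
  have I': "Ind v g' a v'" using Ind_pull_square[OF I v(6) _ v(7) a(1)] v F by simp
  have I'': "Ind (f \<cdot>\<^bsub>V\<^esub> v) g a (f' \<cdot>\<^bsub>V\<^esub> v')" using Ind_vpaste[OF I I'] .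
  have v'C: "v' \<in> C" using C_base_change[OF v(6) a(1)] .
  have v'S: "f' \<cdot>\<^bsub>V\<^esub> v' \<in> S" using S_base_change[OF v(7) Ind_fibre_square[OF I'']] .
  define x where "x = foldr (Ori B (f \<cdot>\<^bsub>V\<^esub> v)) Ls (\<theta> (f \<cdot>\<^bsub>V\<^esub> v))"
  have x: "x \<in> carrier (Grp B (f \<cdot>\<^bsub>V\<^esub> v))"
    using cycle_value_closed(2)[OF F(1) v(2) _ v(6,7), of Ls] v F by (simp add: x_def)
  have "Pull B (f \<cdot>\<^bsub>V\<^esub> v) g a (f' \<cdot>\<^bsub>V\<^esub> v') x
    = foldr (Ori B (f' \<cdot>\<^bsub>V\<^esub> v')) (map (pb F a) Ls) (\<theta> (f' \<cdot>\<^bsub>V\<^esub> v'))"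
    using ori_list_pull[OF I'' _ theta_closed[OF v(7)], of Ls] theta_pull[OF v(7) I''] v F
    by (simp add: x_def)
  moreover have "set (map (pb F a) Ls) \<subseteq> fibre_objs F T'" using a v by simp
  ultimately have "transformation f' (frag_of (gen_pull V F g' A))
      = Push B v' f' (Pull B (f \<cdot>\<^bsub>V\<^esub> v) g a (f' \<cdot>\<^bsub>V\<^esub> v') x)"
    using gen_pull_class[OF a(1), of Ls] v F a
      transformation_class[OF F(7) a(3,7) v'C v'S, of "map (pb F a) Ls"]
    by (simp add: cycle_value_def)
  also have "\<dots> = Pull B f g g' f' (Push B v f x)"
    using OB.B6[OF I I' v(6) x] .
  also have "Push B v f x = transformation f (frag_of A)"
    using transformation_class[OF F(1) v(2,4,6,7), of Ls] F v by (simp add: x_def cycle_value_def)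
  finally show ?thesis .
qed

lemma transformation_ori_gens:
  assumes f: "f \<in> hom_set V X Y" and L: "L \<in> fibre_objs F X" and A: "A \<in> OM_gens V F C S f"
  shows "transformation f (frag_of (gen_ori V F f L A)) = Ori B f L (transformation f (frag_of A))"
proof -
  have F: "f \<in> Arr V" "Dom V f = X" "Cod V f = Y" using f by (simp_all add: hom_set_def)
  obtain v Ls T where v: "A = cycle_class V F X (v, Ls)" "v \<in> Arr V" "Dom V v = T" "Cod V v = X"
    "set Ls \<subseteq> fibre_objs F T" "v \<in> C" "f \<cdot>\<^bsub>V\<^esub> v \<in> S"
    using OM_gensE[OF A F(2)] .
  have hs: "v \<in> hom_set V T X" "f \<cdot>\<^bsub>V\<^esub> v \<in> hom_set V T Y"
    using F v by (simp_all add: hom_set_def)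
  have vL: "pb F v L \<in> fibre_objs F T" using pb_fibre_objs[of v L] v L by simp
  define x where "x = foldr (Ori B (f \<cdot>\<^bsub>V\<^esub> v)) Ls (\<theta> (f \<cdot>\<^bsub>V\<^esub> v))"
  have x: "x \<in> carrier (Grp B (f \<cdot>\<^bsub>V\<^esub> v))"
    using cycle_value_closed(2)[OF F(1) v(2) _ v(6,7), of Ls] v F by (simp add: x_def)
  have "transformation f (frag_of (gen_ori V F f L A)) = cycle_value f (v, Ls @ [pb F v L])"
    using gen_ori_class[of v f Ls L] transformation_class[OF F(1) v(2,4,6,7), of "Ls @ [pb F v L]"]
      F v L vL by simp
  also have "\<dots> = Push B v f (Ori B (f \<cdot>\<^bsub>V\<^esub> v) (pb F v L) x)"
    using ori_list_commute[OF hs(2) theta_closed[OF v(7)] vL v(5)]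
    by (simp add: cycle_value_def x_def)
  also have "\<dots> = Ori B f L (Push B v f x)"
    using OB.O4[OF hs(1) f v(6) L x] .
  also have "Push B v f x = transformation f (frag_of A)"
    using transformation_class[OF F(1) v(2,4,6,7), of Ls] F v by (simp add: x_def cycle_value_def)
  finally show ?thesis .
qed

theorem transformation_oriented:
  "oriented_grothendieck_transformation V F C Ind \<M> B transformation"
  unfolding oriented_grothendieck_transformation_def grothendieck_transformation_def
proof (intro conjI allI ballI impI)
  interpret OM: oriented_bivariant_theory V F C Ind \<M> by (rule OM_oriented_bivariant_theory)
  note comp_hom = hom_compose[unfolded comp_def]
  show "transformation f \<in> hom (Grp \<M> f) (Grp B f)" if "f \<in> Arr V" for f
    using transformation(1)[OF that] .
  show "transformation g (Push \<M> f g \<alpha>) = Push B f g (transformation (g \<cdot>\<^bsub>V\<^esub> f) \<alpha>)"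
    if fg: "f \<in> hom_set V X Y" "g \<in> hom_set V Y Z" "f \<in> C"
      and \<alpha>: "\<alpha> \<in> carrier (Grp \<M> (g \<cdot>\<^bsub>V\<^esub> f))" for f g X Y Z \<alpha>
  proof -
    have F: "g \<in> Arr V" "g \<cdot>\<^bsub>V\<^esub> f \<in> Arr V" using fg by (simp_all add: hom_set_def)
    show ?thesis
      using comp_hom[OF OM.push_hom[OF fg] transformation(1)[OF F(1)]]
        comp_hom[OF transformation(1)[OF F(2)] OB.push_hom[OF fg]] F(1) \<alpha>
      by (rule OM_hom_eqI) (simp add: transformation_push_gens[OF fg])
  qed
  show "transformation f' (Pull \<M> f g g' f' \<alpha>) = Pull B f g g' f' (transformation f \<alpha>)"
    if I: "Ind f g g' f'" and \<alpha>: "\<alpha> \<in> carrier (Grp \<M> f)" for f g g' f' \<alpha>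
  proof -
    have F: "f \<in> Arr V" "f' \<in> Arr V"
      using base.fibre_squareD[OF Ind_fibre_square[OF I]] by simp_all
    show ?thesis
      using comp_hom[OF OM.pull_hom[OF I] transformation(1)[OF F(2)]]
        comp_hom[OF transformation(1)[OF F(1)] OB.pull_hom[OF I]] F(2) \<alpha>
      by (rule OM_hom_eqI) (simp add: transformation_pull_gens[OF I])
  qed
  show "transformation f (Ori \<M> f L \<alpha>) = Ori B f L (transformation f \<alpha>)"
    if f: "f \<in> hom_set V X Y" and L: "L \<in> fibre_objs F X" and \<alpha>: "\<alpha> \<in> carrier (Grp \<M> f)"
    for f X Y L \<alpha>
  proof -
    have F: "f \<in> Arr V" using f by (simp add: hom_set_def)
    show ?thesis
      using comp_hom[OF OM.ori_hom[OF f L] transformation(1)[OF F]]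
        comp_hom[OF transformation(1)[OF F] OB.ori_hom[OF f L]] F \<alpha>
      by (rule OM_hom_eqI) (simp add: transformation_ori_gens[OF f L])
  qed
  show "transformation (g \<cdot>\<^bsub>V\<^esub> f) (Bprod \<M> f g \<alpha> \<beta>)
      = Bprod B f g (transformation f \<alpha>) (transformation g \<beta>)"
    if fg: "f \<in> hom_set V X Y" "g \<in> hom_set V Y Z"
      and \<alpha>: "\<alpha> \<in> carrier (Grp \<M> f)" and \<beta>: "\<beta> \<in> carrier (Grp \<M> g)" for f g X Y Z \<alpha> \<beta>
  proof -
    have F: "f \<in> Arr V" "g \<in> Arr V" "g \<cdot>\<^bsub>V\<^esub> f \<in> Arr V" using fg by (simp_all add: hom_set_def)
    have gen: "transformation (g \<cdot>\<^bsub>V\<^esub> f) (Bprod \<M> f g (frag_of A) \<beta>)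
        = Bprod B f g (transformation f (frag_of A)) (transformation g \<beta>)"
      if A: "A \<in> OM_gens V F C S f" for A
    proof -
      have c: "frag_of A \<in> carrier (Grp \<M> f)" using A by simp
      show ?thesis
        using comp_hom[OF OM.prod_hom_right[OF fg c] transformation(1)[OF F(3)]]
          comp_hom[OF transformation(1)[OF F(2)]
            OB.prod_hom_right[OF fg transformation_closed[OF F(1) c]]] F(3) \<beta>
        by (rule OM_hom_eqI) (simp add: transformation_prod_gens[OF fg A])
    qed
    show ?thesis
      using comp_hom[OF OM.prod_hom_left[OF fg \<beta>] transformation(1)[OF F(3)]]
        comp_hom[OF transformation(1)[OF F(1)]
          OB.prod_hom_left[OF fg transformation_closed[OF F(2) \<beta>]]] F(3) \<alpha>
      by (rule OM_hom_eqI) (rule gen)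
  qed
qed

theorem transformation_normalized: "normalized V F S B \<theta> transformation"
  unfolding normalized_def
proof (intro allI ballI impI)
  fix X Y f Ls assume f: "f \<in> hom_set V X Y \<inter> S" and Ls: "set Ls \<subseteq> fibre_objs F X"
  have F: "f \<in> Arr V" "Dom V f = X" "X \<in> Obj V" using f by (auto simp: hom_set_def)
  have h: "f \<in> hom_set V X Y" using f by simp
  have "foldr (Ori B f) Ls (\<theta> f) \<in> carrier (Grp B f)"
    using ori_list_closed[OF h Ls theta_closed] f by simp
  then show "transformation f (frag_of (cycle_class V F X (Ide V X, Ls))) = foldr (Ori B f) Ls (\<theta> f)"
    using transformation_class[of f "Ide V X" X Ls] OB.B2_ide[OF h] F f Ls C_ide
    by (simp add: cycle_value_def)
qed

end


section \<open>The universal oriented bivariant theory\<close>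

theorem theorem4p6:
  fixes V :: "('o, 'm) cat"
    and F :: "('o, 'm, 'l, 'k) fibred"
    and C :: "'m set"
    and Ind :: "'m \<Rightarrow> 'm \<Rightarrow> 'm \<Rightarrow> 'm \<Rightarrow> bool"
    and S :: "'m set"
    and OBT :: "('o, 'm, 'b, 'l) oriented_bivariant set"
    and \<theta> :: "('o, 'm, 'b, 'l) oriented_bivariant \<Rightarrow> 'm \<Rightarrow> 'b"
  assumes "bivariant_setting V F C Ind S"
  shows "oriented_bivariant_theory V F C Ind (OM V F C S) \<and>
    ((\<forall>OB \<in> OBT. oriented_bivariant_theory V F C Ind OB \<and>
        nice_canonical_orientation V Ind S OB (\<theta> OB)) \<longrightarrow>
     (\<forall>OB \<in> OBT.
        (cycle_squares_independent V C Ind S \<longrightarrow>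
          (\<exists>\<gamma>. oriented_grothendieck_transformation V F C Ind (OM V F C S) OB \<gamma> \<and>
               normalized V F S OB (\<theta> OB) \<gamma>)) \<and>
        (\<forall>\<gamma> \<gamma>'.
          oriented_grothendieck_transformation V F C Ind (OM V F C S) OB \<gamma> \<and>
          normalized V F S OB (\<theta> OB) \<gamma> \<and>
          oriented_grothendieck_transformation V F C Ind (OM V F C S) OB \<gamma>' \<and>
          normalized V F S OB (\<theta> OB) \<gamma>' \<longrightarrow>
          (\<forall>f \<in> Arr V. \<forall>x \<in> carrier (Grp (OM V F C S) f). \<gamma> f x = \<gamma>' f x))))"
proof -
  interpret bivariant_setting V F C Ind S by fact
  have exists: "\<exists>\<gamma>. oriented_grothendieck_transformation V F C Ind (OM V F C S) OB \<gamma> \<and>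
      normalized V F S OB (\<theta> OB) \<gamma>"
    if "oriented_bivariant_theory V F C Ind OB" "nice_canonical_orientation V Ind S OB (\<theta> OB)"
      "cycle_squares_independent V C Ind S" for OB
  proof -
    interpret OB: oriented_bivariant_theory V F C Ind OB by fact
    interpret independent_target V F C Ind S OB "\<theta> OB" by unfold_locales fact+
    show ?thesis using transformation_oriented transformation_normalized by blast
  qed
  have unique: "\<gamma> f x = \<gamma>' f x"
    if "oriented_bivariant_theory V F C Ind OB" "nice_canonical_orientation V Ind S OB (\<theta> OB)"
      and "oriented_grothendieck_transformation V F C Ind (OM V F C S) OB \<gamma>"
        "normalized V F S OB (\<theta> OB) \<gamma>"
        "oriented_grothendieck_transformation V F C Ind (OM V F C S) OB \<gamma>'"
        "normalized V F S OB (\<theta> OB) \<gamma>'"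
        "f \<in> Arr V" "x \<in> carrier (Grp (OM V F C S) f)" for OB \<gamma> \<gamma>' f x
  proof -
    interpret OB: oriented_bivariant_theory V F C Ind OB by fact
    interpret oriented_target V F C Ind S OB "\<theta> OB" by unfold_locales fact
    show ?thesis using that(3-8) by (rule transformation_unique)
  qed
  show ?thesis using OM_oriented_bivariant_theory exists unique by meson
qed

end
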